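(* Let $n\geq 1$, let $s,s_1$ be real parameters with $0<s_1<s<n$, let $\beta>0$, and set $$\theta=\frac{s-s_1}{\beta+s}\in(0,1).$$ Then there is a constant $C>0$ (independent of $f$ and $x$) such that for every smooth measurable function $f:\mathbb{R}^n\to\mathbb{R}$ belonging to the Besov space $\dot{B}^{-\beta,\infty}_{\infty}(\mathbb{R}^n)$ one has, for $x\in\mathbb{R}^n$, $$\left|(-\Delta)^{\frac{s_1}{2}}(f)(x)\right|^{\frac{1}{1-\theta}}\leq C\,\mathcal{M}\left((-\Delta)^{\frac{s}{2}}(f)\right)(x)\,\|f\|_{\dot{B}^{-\beta,\infty}_{\infty}(\mathbb{R}^n)}^{\frac{\theta}{1-\theta}}.$$
   Context: Fractional Laplacian: for $s>0$, $(-\Delta)^{\frac s2}$ is the operator defined at the Fourier level by $\widehat{(-\Delta)^{\frac s2}(f)}(\xi)=|\xi|^s\widehat{f}(\xi)$, extended to tempered distributions by standard procedures. Hardy–Littlewood maximal function: for a locally integrable $g:\mathbb{R}^n\to\mathbb{R}$, $\mathcal{M}(g)(x)=\sup_{B\ni x}\frac{1}{|B|}\int_B|g(y)|\,dy$, where the supremum is over open balls $B$ of $\mathbb{R}^n$ containing $x$. Besov space: for $\beta>0$, $\dot{B}^{-\beta,\infty}_{\infty}(\mathbb{R}^n)$ is the set of tempered distributions $f$ for which $\|f\|_{\dot{B}^{-\beta,\infty}_{\infty}(\mathbb{R}^n)}=\sup_{t>0}t^{\frac{\beta}{2}}\|h_t\ast f\|_{L^\infty(\mathbb{R}^n)}$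 is finite, where $h_t(x)=(4\pi t)^{-\frac n2}e^{-\frac{|x|^2}{4t}}$ is the heat kernel. *)

theory Defs
  imports "HOL-Analysis.Analysis" "HOL-Probability.Essential_Supremum"
begin

section \<open>Smooth functions, Schwartz functions and tempered distributions\<close>

definition partial_deriv :: "'n::finite \<Rightarrow> (real^'n \<Rightarrow> 'b::real_normed_vector) \<Rightarrow> real^'n \<Rightarrow> 'b"
  where "partial_deriv i f x = frechet_derivative f (at x) (axis i 1)"

text \<open>A list of indices plays the role of a multi-index.\<close>

primrec iterated_partial :: "'n::finite list \<Rightarrow> (real^'n \<Rightarrow> 'b::real_normed_vector) \<Rightarrow> real^'n \<Rightarrow> 'b"
  where
    "iterated_partial [] f = f"
  | "iterated_partial (i # is) f = partial_deriv i (iterated_partial is f)"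

definition smooth :: "(real^'n::finite \<Rightarrow> 'b::real_normed_vector) \<Rightarrow> bool"
  where "smooth f \<longleftrightarrow> (\<forall>is x. iterated_partial is f differentiable (at x))"

definition test_functions :: "(real^'n::finite \<Rightarrow> complex) set"
  where "test_functions = {\<phi>. smooth \<phi> \<and> compact (closure {x. \<phi> x \<noteq> 0})}"

definition schwartz_space :: "(real^'n::finite \<Rightarrow> complex) set"
  where "schwartz_space =
    {\<phi>. smooth \<phi> \<and>
        (\<forall>k::nat. \<forall>is. bounded (range (\<lambda>x. (1 + norm x) ^ k *\<^sub>R iterated_partial is \<phi> x)))}"

definition schwartz_seminorm :: "nat \<Rightarrow> nat \<Rightarrow> (real^'n::finite \<Rightarrow> complex) \<Rightarrow> real"
  where "schwartz_seminorm k m \<phi> =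
    (SUP (is, x) \<in> {is. length is \<le> m} \<times> UNIV. (1 + norm x) ^ k * norm (iterated_partial is \<phi> x))"

text \<open>Distributions are functionals on all functions \<open>\<real>\<^sup>n \<rightarrow> \<complex>\<close>; only their values on
  \<open>schwartz_space\<close> are meaningful.\<close>

type_synonym 'n distribution = "(real^'n \<Rightarrow> complex) \<Rightarrow> complex"

definition tempered :: "'n::finite distribution \<Rightarrow> bool"
  where "tempered u \<longleftrightarrow>
    (\<forall>\<phi>\<in>schwartz_space. \<forall>\<psi>\<in>schwartz_space. u (\<lambda>x. \<phi> x + \<psi> x) = u \<phi> + u \<psi>) \<and>
    (\<forall>c. \<forall>\<phi>\<in>schwartz_space. u (\<lambda>x. c * \<phi> x) = c * u \<phi>) \<and>
    (\<exists>C k m. \<forall>\<phi>\<in>schwartz_space. norm (u \<phi>) \<le> C * schwartz_seminorm k m \<phi>)"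

text \<open>The distribution \<open>u\<close> is the function \<open>g\<close>. Testing against compactly supported functions
  determines a tempered distribution, and makes sense for every locally integrable \<open>g\<close>,
  without any growth condition.\<close>

definition represents :: "'n::finite distribution \<Rightarrow> (real^'n \<Rightarrow> complex) \<Rightarrow> bool"
  where "represents u g \<longleftrightarrow> (\<forall>\<phi>\<in>test_functions. u \<phi> = (LINT x|lborel. g x * \<phi> x))"

definition continuous_representative :: "'n::finite distribution \<Rightarrow> real^'n \<Rightarrow> complex"
  where "continuous_representative u = (THE g. continuous_on UNIV g \<and> represents u g)"


section \<open>The fractional Laplacian\<close>

text \<open>With this normalisation of the Fourier transform \<open>-\<Delta>\<close> has symbol \<open>\<bar>\<xi>\<bar>\<^sup>2\<close> and
  \<open>heat_kernel t\<close> below has Fourier transform \<open>exp (- t \<bar>\<xi>\<bar>\<^sup>2)\<close>.\<close>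

definition fourier :: "(real^'n::finite \<Rightarrow> complex) \<Rightarrow> real^'n \<Rightarrow> complex"
  where "fourier \<phi> \<xi> = (LINT x|lborel. cis (- (x \<bullet> \<xi>)) * \<phi> x)"

definition inverse_fourier :: "(real^'n::finite \<Rightarrow> complex) \<Rightarrow> real^'n \<Rightarrow> complex"
  where "inverse_fourier \<phi> x =
    complex_of_real ((2 * pi) powr (- real CARD('n))) * (LINT \<xi>|lborel. cis (x \<bullet> \<xi>) * \<phi> \<xi>)"

definition fourier_dist :: "'n::finite distribution \<Rightarrow> 'n distribution"
  where "fourier_dist u = (\<lambda>\<phi>. u (fourier \<phi>))"

definition inverse_fourier_dist :: "'n::finite distribution \<Rightarrow> 'n distribution"
  where "inverse_fourier_dist u = (\<lambda>\<phi>. u (inverse_fourier \<phi>))"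

text \<open>The product \<open>\<bar>\<xi>\<bar>\<^sup>s \<cdot> U\<close>. Because \<open>\<bar>\<xi>\<bar>\<^sup>s\<close> need not be smooth at the origin, the product is
  the weak limit of the products of \<open>U\<close> with the smooth symbols
  \<open>(\<bar>\<xi>\<bar>\<^sup>2 + \<epsilon>\<^sup>2)\<^bsup>s/2\<^esup>\<close> as \<open>\<epsilon> \<down> 0\<close>. The limit exists, in particular, when \<open>U\<close> is the
  Fourier transform of a Schwartz function (where it is the pointwise product) and when it is
  the Fourier transform of an element of \<open>besov_space \<beta>\<close>, \<open>\<beta> > 0\<close>.\<close>

definition times_norm_powr :: "real \<Rightarrow> 'n::finite distribution \<Rightarrow> 'n distribution"
  where "times_norm_powr s U = (\<lambda>\<phi>. Lim (at_right 0)
    (\<lambda>\<epsilon>. U (\<lambda>\<xi>. complex_of_real (((norm \<xi>)\<^sup>2 + \<epsilon>\<^sup>2) powr (s / 2)) * \<phi> \<xi>)))"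

text \<open>\<open>frac_laplacian s\<close> is \<open>(-\<Delta>)\<^bsup>s/2\<^esup>\<close>.\<close>

definition frac_laplacian :: "real \<Rightarrow> 'n::finite distribution \<Rightarrow> 'n distribution"
  where "frac_laplacian s u = inverse_fourier_dist (times_norm_powr s (fourier_dist u))"


section \<open>The Hardy-Littlewood maximal function\<close>

definition maximal_function :: "(real^'n::finite \<Rightarrow> complex) \<Rightarrow> real^'n \<Rightarrow> ennreal"
  where "maximal_function g x =
    (SUP (c, r) \<in> {(c, r). 0 < r \<and> x \<in> ball c r}.
       (\<integral>\<^sup>+ y \<in> ball c r. ennreal (norm (g y)) \<partial>lborel) / emeasure lborel (ball c r))"


section \<open>Besov spaces of negative order\<close>

definition heat_kernel :: "real \<Rightarrow> real^'n::finite \<Rightarrow> real"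
  where "heat_kernel t x = (4 * pi * t) powr (- real CARD('n) / 2) * exp (- (norm x)\<^sup>2 / (4 * t))"

text \<open>The convolution of \<open>heat_kernel t\<close> with a tempered distribution.\<close>

definition heat_conv :: "real \<Rightarrow> 'n::finite distribution \<Rightarrow> real^'n \<Rightarrow> complex"
  where "heat_conv t u x = u (\<lambda>y. complex_of_real (heat_kernel t (x - y)))"

definition besov_enorm :: "real \<Rightarrow> 'n::finite distribution \<Rightarrow> ennreal"
  where "besov_enorm \<beta> u =
    (SUP t \<in> {0<..}. ennreal (t powr (\<beta> / 2)) * esssup lborel (\<lambda>x. ennreal (norm (heat_conv t u x))))"

definition besov_space :: "real \<Rightarrow> 'n::finite distribution set"
  where "besov_space \<beta> = {u. tempered u \<and> besov_enorm \<beta> u < \<infinity>}"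

definition besov_norm :: "real \<Rightarrow> 'n::finite distribution \<Rightarrow> real"
  where "besov_norm \<beta> u = enn2real (besov_enorm \<beta> u)"

end

theory Submission
  imports Defs "HOL-Probability.Characteristic_Functions" "HOL-Probability.Sinc_Integral" "HOL-Real_Asymp.Real_Asymp"
begin

text \<open>Let \<open>h\<^sub>t\<close> be the heat kernel, \<open>k\<close> a large integer and \<open>\<sigma> = k - s/2\<close>. Since
  \<open>a\<^bsup>s/2\<^esup> = \<Gamma>(\<sigma>)\<^sup>-\<^sup>1 \<integral> t\<^bsup>\<sigma>-1\<^esup> a\<^sup>k e\<^bsup>-ta\<^esup> dt\<close>, letting \<open>\<epsilon> \<down> 0\<close> in \<open>a = \<bar>\<xi>\<bar>\<^sup>2 + \<epsilon>\<^sup>2\<close> gives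
  \<open>(-\<Delta>)\<^bsup>s/2\<^esup> u = \<Gamma>(\<sigma>)\<^sup>-\<^sup>1 \<integral> t\<^bsup>\<sigma>-1\<^esup> V\<^sub>t dt\<close> with \<open>V\<^sub>t = (-\<Delta>)\<^sup>k h\<^sub>t * u\<close>. The Besov norm \<open>B\<close> yields
  \<open>\<bar>V\<^sub>t\<bar> \<le> C B t\<^bsup>-k-\<beta>/2\<^esup>\<close>, which is integrable at infinity, and smoothness of \<open>f\<close> keeps \<open>V\<^sub>t\<close>
  locally bounded as \<open>t \<rightarrow> 0\<close>, so the integral is a continuous function \<open>g\<^sub>s\<close>.

  For \<open>s\<^sub>1 < s\<close> and \<open>\<delta> = (s - s\<^sub>1)/2\<close> the beta integral turns this into
  \<open>g\<^bsub>s1\<^esub> = \<Gamma>(\<delta>)\<^sup>-\<^sup>1 \<integral> t\<^bsup>\<delta>-1\<^esup> h\<^sub>t * g\<^sub>s dt\<close>. For \<open>t \<le> T\<close> the integrand is controlled by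
  \<open>\<bar>h\<^sub>t * g\<^sub>s\<bar> \<le> M g\<^sub>s\<close>, for \<open>t \<ge> T\<close> by the decay of \<open>V\<close>, so
  \<open>\<bar>g\<^bsub>s1\<^esub>(x)\<bar> \<le> C (T\<^bsup>\<delta>\<^esup> M g\<^sub>s(x) + T\<^bsup>-(s1+\<beta>)/2\<^esup> B)\<close>; optimise in \<open>T\<close>.\<close>

subsection \<open>Calculus of iterated partial derivatives\<close>

text \<open>The obstacle is that \<open>u\<close> is only a functional: \<open>f\<close> represents
  it on compactly supported functions and need not be integrable against Schwartz functions, while
  the symbol is reached only through the limit in \<epsilon>. Writing a^(s/2) = a^k a^(-\<sigma>)
  separates a differential operator, which acts on the Schwartz side, from a superposition of
  Gaussians. The regularised operator is thus convolution with one kernel having all moments, so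
  \<open>u\<close> only has to be exchanged with convolutions, and the only Fourier transform
  evaluated explicitly is that of a Gaussian. Two conditions say how large k must be: \<sigma> \<ge>
  n for integrability in \<xi>, and \<sigma> > \<beta>/2 for integrability in t near 0 when only the
  Besov bound t^(-\<beta>/2) is at hand. The same k serves both orders, since k - s1/2 = \<sigma> +
  \<delta>; both representatives integrate the same V_t against different powers of t, which is what
  the beta integral needs. The bounds drawn from smoothness of \<open>f\<close> are local in space;
  they give existence and continuity of g_s, whereas every constant in the final inequality comes
  from the heat kernel alone.\<close>

lemma partial_deriv_eqI:
  "(f has_derivative D) (at x) \<Longrightarrow> partial_deriv i f x = D (axis i 1)"
  unfolding partial_deriv_def using frechet_derivative_at by metis

lemma has_derivative_partial_deriv:
  fixes f :: "real^'n::finite \<Rightarrow> 'b::real_normed_vector"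
  assumes "f differentiable at x"
  shows "(f has_derivative (\<lambda>h. \<Sum>i\<in>UNIV. (h $ i) *\<^sub>R partial_deriv i f x)) (at x)"
proof -
  have D: "(f has_derivative frechet_derivative f (at x)) (at x)"
    using assms frechet_derivative_works by blast
  have lin: "linear (frechet_derivative f (at x))"
    using assms linear_frechet_derivative by blast
  have "frechet_derivative f (at x) h = (\<Sum>i\<in>UNIV. (h $ i) *\<^sub>R partial_deriv i f x)" for h
  proof -
    have "frechet_derivative f (at x) h = frechet_derivative f (at x) (\<Sum>i\<in>UNIV. (h $ i) *s axis i 1)"
      by (simp add: basis_expansion)
    also have "\<dots> = (\<Sum>i\<in>UNIV. (h $ i) *\<^sub>R partial_deriv i f x)"
      by (simp add: linear_sum[OF lin] scalar_mult_eq_scaleR linear_scale[OF lin] partial_deriv_def)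
    finally show ?thesis .
  qed
  then show ?thesis using D by presburger
qed

lemma partial_deriv_cong_open:
  assumes "f differentiable at x" "open S" "x \<in> S" "\<And>y. y \<in> S \<Longrightarrow> f y = g y"
  shows "partial_deriv i f x = partial_deriv i g x"
  unfolding partial_deriv_def
  using frechet_derivative_transform_within_open[OF assms] by simp

lemma iterated_partial_append:
  "iterated_partial (xs @ ys) f = iterated_partial xs (iterated_partial ys f)"
  by (induction xs) auto

lemma smooth_differentiable: "smooth f \<Longrightarrow> f differentiable at x"
  unfolding smooth_def by (metis iterated_partial.simps(1))

lemma smooth_iterated_partial: "smooth f \<Longrightarrow> smooth (iterated_partial is f)"
  unfolding smooth_def by (metis iterated_partial_append)

lemma smooth_partial_deriv: "smooth f \<Longrightarrow> smooth (partial_deriv i f)"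
  using smooth_iterated_partial[of f "[i]"] by simp

lemma smooth_continuous: "smooth f \<Longrightarrow> continuous_on S f"
  by (meson continuous_at_imp_continuous_on differentiable_imp_continuous_within smooth_differentiable)

lemma smooth_measurable: "smooth f \<Longrightarrow> f \<in> borel_measurable borel"
  by (intro borel_measurable_continuous_onI smooth_continuous)

lemma iterated_partial_coinduct:
  assumes "\<And>f i. f \<in> S \<Longrightarrow> partial_deriv i f \<in> S" "f \<in> S"
  shows "iterated_partial is f \<in> S"
  by (induction "is") (auto intro: assms)

text \<open>Smoothness is obtained by exhibiting a class of differentiable functions closed under
  \<open>partial_deriv\<close>, so that no formula for higher derivatives has to be written
  down.\<close>

lemma smooth_coinduct:
  assumes "\<And>f i. f \<in> S \<Longrightarrow> partial_deriv i f \<in> S" "\<And>f x. f \<in> S \<Longrightarrow> f differentiable at x" "f \<in> S"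
  shows "smooth f"
  unfolding smooth_def using iterated_partial_coinduct[of S f] assms by blast

text \<open>Differentiation is local. This makes derivatives vanish off a support, and those of
  \<open>1 - ccutoff r\<close> vanish where the cutoff is constant.\<close>

lemma iterated_partial_cong_open:
  assumes f: "smooth f" and S: "open S" and eq: "\<And>y. y \<in> S \<Longrightarrow> f y = g y" and x: "x \<in> S"
  shows "iterated_partial is f x = iterated_partial is g x"
  using x
proof (induction "is" arbitrary: x)
  case (Cons i js)
  have "iterated_partial js f differentiable at x"
    using f smooth_def by blast
  then show ?case
    using partial_deriv_cong_open[OF _ S Cons.prems Cons.IH] by simp
qed (simp add: eq)

lemma sum_axis_scaleR: "(\<Sum>j\<in>UNIV. (axis i (1::real) $ j) *\<^sub>R v j) = (v (i::'n::finite) :: 'b::real_vector)"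
proof -
  have "(\<Sum>j\<in>UNIV. (axis i (1::real) $ j) *\<^sub>R v j) = (\<Sum>j\<in>UNIV. if j = i then v j else 0)"
    by (intro sum.cong) (auto simp: axis_def)
  then show ?thesis by simp
qed

lemma partial_deriv_bounded_linear:
  assumes T: "bounded_linear T" and f: "\<And>x. f differentiable at x"
  shows "partial_deriv i (\<lambda>x. T (f x)) = (\<lambda>x. T (partial_deriv i f x))"
proof
  fix x
  have "((\<lambda>x. T (f x)) has_derivative (\<lambda>h. T (\<Sum>i\<in>UNIV. (h $ i) *\<^sub>R partial_deriv i f x))) (at x)"
    by (rule bounded_linear.has_derivative[OF T has_derivative_partial_deriv[OF f]])
  from partial_deriv_eqI[OF this, of i]
  show "partial_deriv i (\<lambda>x. T (f x)) x = T (partial_deriv i f x)"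
    by (simp add: sum_axis_scaleR)
qed

lemma smooth_bounded_linear:
  assumes T: "bounded_linear T" and f: "smooth f"
  shows "smooth (\<lambda>x. T (f x))"
proof (rule smooth_coinduct[where S = "{\<lambda>x. T (g x) | g. smooth g}"])
  show "(\<lambda>x. T (f x)) \<in> {\<lambda>x. T (g x) | g. smooth g}" using f by blast
next
  fix h i assume "h \<in> {\<lambda>x. T (g x) | g. smooth g}"
  then obtain g where g: "smooth g" "h = (\<lambda>x. T (g x))" by blast
  show "partial_deriv i h \<in> {\<lambda>x. T (g x) | g. smooth g}"
    using g smooth_partial_deriv[OF g(1), of i]
    by (auto simp: partial_deriv_bounded_linear[OF T smooth_differentiable[OF g(1)]])
  show "h differentiable at x" for x
    using g(2) T smooth_differentiable[OF g(1), of x]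
    by (metis bounded_linear.has_derivative differentiable_def)
qed

lemma iterated_partial_bounded_linear:
  assumes T: "bounded_linear T" and f: "smooth f"
  shows "iterated_partial is (\<lambda>x. T (f x)) = (\<lambda>x. T (iterated_partial is f x))"
proof (induction "is")
  case (Cons i js)
  then show ?case
    using partial_deriv_bounded_linear[OF T smooth_differentiable[OF smooth_iterated_partial[OF f]]] by simp
qed simp

lemma partial_deriv_add:
  assumes "\<And>x. f differentiable at x" "\<And>x. g differentiable at x"
  shows "partial_deriv i (\<lambda>x. f x + g x) = (\<lambda>x. partial_deriv i f x + partial_deriv i g x)"
proof
  fix x
  have "((\<lambda>x. f x + g x) has_derivative (\<lambda>h. frechet_derivative f (at x) h + frechet_derivative g (at x) h)) (at x)"
    using assms frechet_derivative_works by (intro has_derivative_add) blast+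
  from partial_deriv_eqI[OF this] show "partial_deriv i (\<lambda>x. f x + g x) x = partial_deriv i f x + partial_deriv i g x"
    by (simp add: partial_deriv_def)
qed

lemma smooth_add:
  assumes "smooth f" "smooth g"
  shows "smooth (\<lambda>x. f x + g x)"
proof (rule smooth_coinduct[where S = "{\<lambda>x. f x + g x | f g. smooth f \<and> smooth g}"])
  show "(\<lambda>x. f x + g x) \<in> {\<lambda>x. f x + g x | f g. smooth f \<and> smooth g}" using assms by blast
next
  fix h i assume "h \<in> {\<lambda>x. f x + g x | f g. smooth f \<and> smooth g}"
  then obtain f g where g: "smooth f" "smooth g" "h = (\<lambda>x. f x + g x)" by blast
  show "partial_deriv i h \<in> {\<lambda>x. f x + g x | f g. smooth f \<and> smooth g}"
    using g smooth_partial_deriv[of _ i]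
    by (auto simp: partial_deriv_add[OF smooth_differentiable smooth_differentiable])
  show "h differentiable at x" for x
    using g smooth_differentiable by (auto intro!: differentiable_add)
qed

lemma iterated_partial_add:
  assumes f: "smooth f" "smooth g"
  shows "iterated_partial is (\<lambda>x. f x + g x) = (\<lambda>x. iterated_partial is f x + iterated_partial is g x)"
proof (induction "is")
  case (Cons i js)
  then show ?case
    using partial_deriv_add[OF smooth_differentiable smooth_differentiable, OF smooth_iterated_partial smooth_iterated_partial, OF f] by simp
qed simp

lemma partial_deriv_const: "partial_deriv i (\<lambda>x. c) = (\<lambda>x. 0)"
  by (rule ext, rule partial_deriv_eqI) simp

lemma iterated_partial_zero: "iterated_partial is (\<lambda>x. 0) = (\<lambda>x. 0)"
  by (induction "is") (auto simp: partial_deriv_const)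

lemma smooth_const: "smooth (\<lambda>x. c)"
  by (rule smooth_coinduct[where S = "range (\<lambda>c x. c)"]) (auto simp: partial_deriv_const)

lemma iterated_partial_sum:
  assumes "\<And>j. j \<in> I \<Longrightarrow> smooth (f j)"
  shows "smooth (\<lambda>x. \<Sum>j\<in>I. f j x) \<and>
    iterated_partial is (\<lambda>x. \<Sum>j\<in>I. f j x) = (\<lambda>x. \<Sum>j\<in>I. iterated_partial is (f j) x)"
  using assms
proof (induction I rule: infinite_finite_induct)
  case (insert j I)
  then show ?case
    using smooth_add[of "f j" "\<lambda>x. \<Sum>j\<in>I. f j x"] iterated_partial_add[of "f j" "\<lambda>x. \<Sum>j\<in>I. f j x"] by simp
qed (simp_all add: iterated_partial_zero smooth_const)

lemmas smooth_sum = iterated_partial_sum[THEN conjunct1]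

lemma iterated_partial_diff:
  assumes f: "smooth f" "smooth g"
  shows "smooth (\<lambda>x. f x - g x)"
    "iterated_partial is (\<lambda>x. f x - g x) = (\<lambda>x. iterated_partial is f x - iterated_partial is g x)"
  using smooth_add[OF f(1) smooth_bounded_linear[OF bounded_linear_minus[OF bounded_linear_ident] f(2)]]
    iterated_partial_add[OF f(1) smooth_bounded_linear[OF bounded_linear_minus[OF bounded_linear_ident] f(2)]]
    iterated_partial_bounded_linear[OF bounded_linear_minus[OF bounded_linear_ident] f(2)]
  by (simp_all add: id_def)

lemma partial_deriv_affine:
  assumes f: "\<And>x. f differentiable at x"
  shows "partial_deriv i (\<lambda>x. f (c *\<^sub>R x + a)) = (\<lambda>x. c *\<^sub>R partial_deriv i f (c *\<^sub>R x + a))"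
    "(\<lambda>x. f (c *\<^sub>R x + a)) differentiable at x"
proof -
  have *: "((\<lambda>x. f (c *\<^sub>R x + a)) has_derivative (\<lambda>h. frechet_derivative f (at (c *\<^sub>R x + a)) (c *\<^sub>R h))) (at x)" for x
  proof -
    have "((\<lambda>x. c *\<^sub>R x + a) has_derivative (\<lambda>h. c *\<^sub>R h)) (at x)"
      by (auto intro!: derivative_eq_intros)
    from has_derivative_compose[OF this] f show ?thesis
      using frechet_derivative_works by blast
  qed
  show "(\<lambda>x. f (c *\<^sub>R x + a)) differentiable at x" using * differentiable_def by blast
  show "partial_deriv i (\<lambda>x. f (c *\<^sub>R x + a)) = (\<lambda>x. c *\<^sub>R partial_deriv i f (c *\<^sub>R x + a))"
    using linear_scale[OF linear_frechet_derivative[OF f]]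
    by (intro ext, subst partial_deriv_eqI[OF *]) (auto simp: partial_deriv_def)
qed

lemma smooth_affine:
  assumes f: "smooth f"
  shows "smooth (\<lambda>x. f (c *\<^sub>R x + a))"
proof (rule smooth_coinduct[where S = "{\<lambda>x. g (c *\<^sub>R x + a) | g. smooth g}"])
  show "(\<lambda>x. f (c *\<^sub>R x + a)) \<in> {\<lambda>x. g (c *\<^sub>R x + a) | g. smooth g}" using f by blast
next
  fix h i assume "h \<in> {\<lambda>x. g (c *\<^sub>R x + a) | g. smooth g}"
  then obtain g where g: "smooth g" "h = (\<lambda>x. g (c *\<^sub>R x + a))" by blast
  have "smooth (\<lambda>x. c *\<^sub>R partial_deriv i g x)"
    by (rule smooth_bounded_linear[OF bounded_linear_scaleR_right smooth_partial_deriv[OF g(1)]])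
  moreover have "partial_deriv i h = (\<lambda>x. c *\<^sub>R partial_deriv i g (c *\<^sub>R x + a))"
    unfolding g(2) by (rule partial_deriv_affine[OF smooth_differentiable[OF g(1)]])
  ultimately show "partial_deriv i h \<in> {\<lambda>x. g (c *\<^sub>R x + a) | g. smooth g}"
    by (auto intro!: exI[of _ "\<lambda>x. c *\<^sub>R partial_deriv i g x"])
  show "h differentiable at x" for x
    unfolding g(2) by (rule partial_deriv_affine[OF smooth_differentiable[OF g(1)]])
qed

lemma iterated_partial_affine:
  assumes f: "smooth f"
  shows "iterated_partial is (\<lambda>x. f (c *\<^sub>R x + a)) = (\<lambda>x. c ^ length is *\<^sub>R iterated_partial is f (c *\<^sub>R x + a))"
proof (induction "is")
  case (Cons i js)
  have s: "smooth (iterated_partial js f)" using smooth_iterated_partial f by blast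
  show ?case
    using partial_deriv_bounded_linear[OF bounded_linear_scaleR_right[of "c ^ length js"]
        partial_deriv_affine(2)[OF smooth_differentiable[OF s]]]
      partial_deriv_affine(1)[OF smooth_differentiable[OF s]] Cons
    by (simp add: mult.commute)
qed simp

lemma partial_deriv_mult:
  fixes f g :: "real^'n::finite \<Rightarrow> 'b::real_normed_algebra"
  assumes "\<And>x. f differentiable at x" "\<And>x. g differentiable at x"
  shows "partial_deriv i (\<lambda>x. f x * g x) = (\<lambda>x. f x * partial_deriv i g x + partial_deriv i f x * g x)"
    "(\<lambda>x. f x * g x) differentiable at x"
proof -
  have *: "((\<lambda>x. f x * g x) has_derivative (\<lambda>h. f x * frechet_derivative g (at x) h + frechet_derivative f (at x) h * g x)) (at x)" for x
    using assms frechet_derivative_works by (intro has_derivative_mult) blast+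
  show "(\<lambda>x. f x * g x) differentiable at x" using * differentiable_def by blast
  show "partial_deriv i (\<lambda>x. f x * g x) = (\<lambda>x. f x * partial_deriv i g x + partial_deriv i f x * g x)"
    by (intro ext, subst partial_deriv_eqI[OF *]) (auto simp: partial_deriv_def)
qed

text \<open>Closed under partial derivatives, as \<open>smooth_coinduct\<close> requires.\<close>

inductive_set sum_prod :: "(real^'n::finite \<Rightarrow> 'b::real_normed_algebra) set" where
  "smooth f \<Longrightarrow> smooth g \<Longrightarrow> (\<lambda>x. f x * g x) \<in> sum_prod"
| "f \<in> sum_prod \<Longrightarrow> g \<in> sum_prod \<Longrightarrow> (\<lambda>x. f x + g x) \<in> sum_prod"

lemma smooth_mult:
  fixes f g :: "real^'n::finite \<Rightarrow> 'b::real_normed_algebra"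
  assumes "smooth f" "smooth g"
  shows "smooth (\<lambda>x. f x * g x)"
proof (rule smooth_coinduct[where S = sum_prod])
  show "(\<lambda>x. f x * g x) \<in> sum_prod" using assms by (rule sum_prod.intros)
  have *: "(\<forall>x. h differentiable at x) \<and> (\<forall>i. partial_deriv i h \<in> sum_prod)" if "h \<in> sum_prod" for h :: "real^'n \<Rightarrow> 'b"
    using that
  proof induction
    case (1 f g)
    then show ?case
      by (auto simp: partial_deriv_mult[OF smooth_differentiable smooth_differentiable]
          intro!: sum_prod.intros smooth_partial_deriv)
  next
    case (2 f g)
    then show ?case by (auto simp: partial_deriv_add intro!: sum_prod.intros)
  qed
  show "partial_deriv i h \<in> sum_prod" if "h \<in> sum_prod" for h :: "real^'n \<Rightarrow> 'b" and i using *[OF that] by blast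
  show "h differentiable at x" if "h \<in> sum_prod" for h :: "real^'n \<Rightarrow> 'b" and x using *[OF that] by blast
qed

text \<open>Each derivative doubles the number of terms in the Leibniz rule, hence the factor
  \<open>2 ^ length is\<close>; keeping only sup bounds on both factors avoids binomial
  coefficients.\<close>

lemma iterated_partial_mult_bound:
  fixes f g :: "real^'n::finite \<Rightarrow> 'b::real_normed_algebra"
  assumes "smooth f" "smooth g"
    and "\<And>js. length js \<le> length is \<Longrightarrow> norm (iterated_partial js f x) \<le> A"
    and "\<And>js. length js \<le> length is \<Longrightarrow> norm (iterated_partial js g x) \<le> B"
  shows "norm (iterated_partial is (\<lambda>x. f x * g x) x) \<le> 2 ^ length is * (A * B)"
  using assms
\<comment> \<open>The innermost derivative is peeled off, since it acts on the product itself; the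
  two products that arise satisfy the same bounds on one derivative fewer.\<close>
proof (induction "is" arbitrary: f g rule: rev_induct)
  case Nil
  from Nil(3)[of "[]"] Nil(4)[of "[]"] have "norm (f x) \<le> A" "norm (g x) \<le> B" by auto
  moreover have "0 \<le> A" using order_trans[OF norm_ge_zero \<open>norm (f x) \<le> A\<close>] .
  ultimately show ?case using norm_mult_ineq[of "f x" "g x"] mult_mono[of "norm (f x)" A "norm (g x)" B] by simp
next
  case (snoc i js)
  have d: "smooth (partial_deriv i f)" "smooth (partial_deriv i g)" using snoc.prems smooth_partial_deriv by blast+
  have A: "norm (iterated_partial ks (partial_deriv i f) x) \<le> A" if "length ks \<le> length js" for ks
    using snoc.prems(3)[of "ks @ [i]"] that by (simp add: iterated_partial_append)
  have B: "norm (iterated_partial ks (partial_deriv i g) x) \<le> B" if "length ks \<le> length js" for ks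
    using snoc.prems(4)[of "ks @ [i]"] that by (simp add: iterated_partial_append)
  have "iterated_partial (js @ [i]) (\<lambda>x. f x * g x) =
      iterated_partial js (\<lambda>x. f x * partial_deriv i g x + partial_deriv i f x * g x)"
    by (simp add: iterated_partial_append partial_deriv_mult[OF smooth_differentiable smooth_differentiable] snoc.prems)
  also have "\<dots> = (\<lambda>x. iterated_partial js (\<lambda>x. f x * partial_deriv i g x) x + iterated_partial js (\<lambda>x. partial_deriv i f x * g x) x)"
    by (intro iterated_partial_add smooth_mult d snoc.prems)
  finally have "norm (iterated_partial (js @ [i]) (\<lambda>x. f x * g x) x) \<le>
     norm (iterated_partial js (\<lambda>x. f x * partial_deriv i g x) x) + norm (iterated_partial js (\<lambda>x. partial_deriv i f x * g x) x)"
    by (simp add: norm_triangle_ineq)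
  also have "\<dots> \<le> 2 ^ length js * (A * B) + 2 ^ length js * (A * B)"
    by (intro add_mono snoc.IH d snoc.prems(1,2) A B) (auto intro: snoc.prems(3,4))
  finally show ?case by (simp add: mult_ac)
qed

lemma smooth_sub_const: "smooth f \<Longrightarrow> smooth (\<lambda>x. f (x - a))"
  using smooth_affine[of f 1 "-a"] by simp

subsection \<open>Schwartz functions\<close>

lemma schwartz_smooth: "\<phi> \<in> schwartz_space \<Longrightarrow> smooth \<phi>"
  by (simp add: schwartz_space_def)

lemma schwartz_spaceI:
  assumes "smooth \<phi>" "\<And>k is. \<exists>C. \<forall>x. (1 + norm x) ^ k * norm (iterated_partial is \<phi> x) \<le> C"
  shows "\<phi> \<in> schwartz_space"
proof -
  have "bounded (range (\<lambda>x. (1 + norm x) ^ k *\<^sub>R iterated_partial is \<phi> x))" for k "is"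
    using assms(2)[of k "is"] by (auto simp: bounded_iff)
  then show ?thesis using assms(1) by (auto simp: schwartz_space_def)
qed

lemma schwartz_bound:
  assumes "\<phi> \<in> schwartz_space"
  shows "\<exists>C\<ge>0. \<forall>x. (1 + norm x) ^ k * norm (iterated_partial is \<phi> x) \<le> C"
proof -
  have "bounded (range (\<lambda>x. (1 + norm x) ^ k *\<^sub>R iterated_partial is \<phi> x))"
    using assms by (simp add: schwartz_space_def)
  then obtain C where "\<And>x. norm ((1 + norm x) ^ k *\<^sub>R iterated_partial is \<phi> x) \<le> C"
    by (auto simp: bounded_iff)
  then have "\<And>x. (1 + norm x) ^ k * norm (iterated_partial is \<phi> x) \<le> max C 0"
    by (auto simp: le_max_iff_disj)
  then show ?thesis by (intro exI[of _ "max C 0"]) auto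
qed

text \<open>Decay has to be checked only on the members of the class themselves, since their
  derivatives are members too.\<close>

lemma schwartz_coinduct:
  assumes "\<And>f i. f \<in> S \<Longrightarrow> partial_deriv i f \<in> S" "\<And>f x. f \<in> S \<Longrightarrow> f differentiable at x"
    "\<And>f k. f \<in> S \<Longrightarrow> \<exists>C. \<forall>x. (1 + norm x) ^ k * norm (f x) \<le> C" "f \<in> S"
  shows "f \<in> schwartz_space"
proof (rule schwartz_spaceI)
  show "smooth f" using smooth_coinduct[of S f] assms by blast
  show "\<exists>C. \<forall>x. (1 + norm x) ^ k * norm (iterated_partial is f x) \<le> C" for k "is"
    using assms(3)[OF iterated_partial_coinduct[of S f]] assms by blast
qed

lemma schwartz_iterated_partial: "\<phi> \<in> schwartz_space \<Longrightarrow> iterated_partial is \<phi> \<in> schwartz_space"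
  by (simp add: schwartz_space_def smooth_iterated_partial flip: iterated_partial_append)

lemma schwartz_partial_deriv: "\<phi> \<in> schwartz_space \<Longrightarrow> partial_deriv i \<phi> \<in> schwartz_space"
  using schwartz_iterated_partial[of \<phi> "[i]"] by simp

text \<open>A real-valued \<open>SUP\<close> is meaningful only over a set bounded above. There are
  finitely many lists of length at most m, so the sum of their individual bounds serves.\<close>

lemma schwartz_seminorm_upper:
  fixes \<phi> :: "real^'n::finite \<Rightarrow> complex"
  assumes "\<phi> \<in> schwartz_space" "length is \<le> m"
  shows "(1 + norm x) ^ k * norm (iterated_partial is \<phi> x) \<le> schwartz_seminorm k m \<phi>"
proof -
  define C where "C is = (SOME C. \<forall>x. (1 + norm x) ^ k * norm (iterated_partial is \<phi> x) \<le> C)" for "is"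
  have C: "(1 + norm x) ^ k * norm (iterated_partial is \<phi> x) \<le> C is" for "is" x
  proof -
    have "\<exists>C. \<forall>x. (1 + norm x) ^ k * norm (iterated_partial is \<phi> x) \<le> C"
      using schwartz_bound[OF assms(1), of k "is"] by blast
    then have "\<forall>x. (1 + norm x) ^ k * norm (iterated_partial is \<phi> x) \<le> C is"
      unfolding C_def by (rule someI_ex)
    then show ?thesis by blast
  qed
  have fin: "finite {is :: 'n list. length is \<le> m}"
    using finite_lists_length_le[of "UNIV :: 'n set" m] by simp
  have "bdd_above ((\<lambda>(is, x). (1 + norm x) ^ k * norm (iterated_partial is \<phi> x)) ` ({is. length is \<le> m} \<times> UNIV))"
  proof (rule bdd_aboveI2[where M = "\<Sum>is | length is \<le> m. \<bar>C is\<bar>"], clarify)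
    fix js :: "'n list" and x assume js: "length js \<le> m"
    have "(1 + norm x) ^ k * norm (iterated_partial js \<phi> x) \<le> \<bar>C js\<bar>" using C[of x js] by linarith
    also have "\<dots> \<le> (\<Sum>is | length is \<le> m. \<bar>C is\<bar>)"
      by (rule member_le_sum) (use js fin in auto)
    finally show "(1 + norm x) ^ k * norm (iterated_partial js \<phi> x) \<le> (\<Sum>is | length is \<le> m. \<bar>C is\<bar>)" .
  qed
  from cSUP_upper[OF _ this, of "(is, x)"] assms(2) show ?thesis
    unfolding schwartz_seminorm_def by simp
qed

lemma schwartz_seminorm_nonneg:
  "\<phi> \<in> schwartz_space \<Longrightarrow> 0 \<le> schwartz_seminorm k m \<phi>"
  by (rule order_trans[OF _ schwartz_seminorm_upper[of \<phi> "[]" m 0 k]]) auto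

lemma schwartz_seminorm_least:
  assumes "\<And>is x. length is \<le> m \<Longrightarrow> (1 + norm x) ^ k * norm (iterated_partial is \<phi> x) \<le> C"
  shows "schwartz_seminorm k m \<phi> \<le> C"
  unfolding schwartz_seminorm_def
  by (rule cSUP_least) (use assms in \<open>auto intro!: exI[of _ "[]"]\<close>)

lemma schwartz_cmult:
  assumes "\<phi> \<in> schwartz_space"
  shows "(\<lambda>x. c * \<phi> x) \<in> schwartz_space"
proof (rule schwartz_spaceI)
  note T = bounded_linear_mult_right[of c]
  show "smooth (\<lambda>x. c * \<phi> x)" by (rule smooth_bounded_linear[OF T schwartz_smooth[OF assms]])
  fix k "is"
  obtain C where C: "\<And>x. (1 + norm x) ^ k * norm (iterated_partial is \<phi> x) \<le> C" using schwartz_bound[OF assms, of k "is"] by blast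
  then have "(1 + norm x) ^ k * norm (iterated_partial is (\<lambda>x. c * \<phi> x) x) \<le> norm c * C" for x
    using mult_left_mono[OF C, of "norm c" x]
    by (simp add: iterated_partial_bounded_linear[OF T schwartz_smooth[OF assms]] norm_mult mult_ac)
  then show "\<exists>C. \<forall>x. (1 + norm x) ^ k * norm (iterated_partial is (\<lambda>x. c * \<phi> x) x) \<le> C" by blast
qed

lemma schwartz_add:
  assumes "\<phi> \<in> schwartz_space" "\<psi> \<in> schwartz_space"
  shows "(\<lambda>x. \<phi> x + \<psi> x) \<in> schwartz_space"
proof (rule schwartz_spaceI)
  show "smooth (\<lambda>x. \<phi> x + \<psi> x)" using assms schwartz_smooth smooth_add by blast
  fix k "is"
  obtain C where C1: "\<And>x. (1 + norm x) ^ k * norm (iterated_partial is \<phi> x) \<le> C" using schwartz_bound[OF assms(1), of k "is"] by blast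
  obtain D where C2: "\<And>x. (1 + norm x) ^ k * norm (iterated_partial is \<psi> x) \<le> D" using schwartz_bound[OF assms(2), of k "is"] by blast
  have "(1 + norm x) ^ k * norm (iterated_partial is (\<lambda>x. \<phi> x + \<psi> x) x) \<le> C + D" for x
  proof -
    have "(1 + norm x) ^ k * norm (iterated_partial is (\<lambda>x. \<phi> x + \<psi> x) x)
      \<le> (1 + norm x) ^ k * (norm (iterated_partial is \<phi> x) + norm (iterated_partial is \<psi> x))"
      by (intro mult_left_mono) (auto simp: iterated_partial_add assms schwartz_smooth norm_triangle_ineq)
    then show ?thesis using C1[of x] C2[of x] by (simp add: distrib_left)
  qed
  then show "\<exists>C. \<forall>x. (1 + norm x) ^ k * norm (iterated_partial is (\<lambda>x. \<phi> x + \<psi> x) x) \<le> C" by blast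
qed

lemma schwartz_zero: "(\<lambda>x. 0) \<in> schwartz_space"
  by (rule schwartz_spaceI) (auto simp: smooth_const iterated_partial_zero)

lemma schwartz_sum:
  "(\<And>j. j \<in> I \<Longrightarrow> f j \<in> schwartz_space) \<Longrightarrow> (\<lambda>x. \<Sum>j\<in>I. f j x) \<in> schwartz_space"
  by (induction I rule: infinite_finite_induct) (auto intro: schwartz_add schwartz_zero)

lemma schwartz_diff:
  assumes "\<phi> \<in> schwartz_space" "\<psi> \<in> schwartz_space"
  shows "(\<lambda>x. \<phi> x - \<psi> x) \<in> schwartz_space"
  using schwartz_add[OF assms(1) schwartz_cmult[OF assms(2), of "-1"]] by simp

lemma one_plus_le_mult:
  fixes u v w :: real
  assumes "u \<le> w + v" "0 \<le> v" "0 \<le> w"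
  shows "1 + u \<le> (1 + v) * (1 + w)"
  using assms mult_nonneg_nonneg[OF assms(2,3)] unfolding ring_distribs by linarith

lemma schwartz_affine:
  fixes \<phi> :: "real^'n::finite \<Rightarrow> complex"
  assumes "\<phi> \<in> schwartz_space" "c \<noteq> 0"
  shows "(\<lambda>x. \<phi> (c *\<^sub>R x + a)) \<in> schwartz_space"
proof (rule schwartz_spaceI)
  show "smooth (\<lambda>x. \<phi> (c *\<^sub>R x + a))" using assms schwartz_smooth smooth_affine by blast
  fix k "is"
  obtain C where C: "C \<ge> 0" "\<And>x. (1 + norm x) ^ k * norm (iterated_partial is \<phi> x) \<le> C" using schwartz_bound[OF assms(1), of k "is"] by blast
  \<comment> \<open>The weights at x and at c x + a are compared in two moves: |x| = |c x| / |c|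
    gives the first factor, the triangle inequality the second.\<close>
  define M where "M = (1 + 1 / \<bar>c\<bar>) * (1 + norm a)"
  have M: "1 + norm x \<le> M * (1 + norm (c *\<^sub>R x + a))" for x :: "real^'n"
  proof -
    have "1 + norm x \<le> (1 + 1 / \<bar>c\<bar>) * (1 + norm (c *\<^sub>R x))"
      using assms(2) by (simp add: algebra_simps)
    also have "1 + norm (c *\<^sub>R x) \<le> (1 + norm a) * (1 + norm (c *\<^sub>R x + a))"
    proof -
      have "norm (c *\<^sub>R x) \<le> norm (c *\<^sub>R x + a) + norm a"
        using norm_triangle_ineq4[of "c *\<^sub>R x + a" a] by simp
      then show ?thesis by (rule one_plus_le_mult) auto
    qed
    then have "(1 + 1 / \<bar>c\<bar>) * (1 + norm (c *\<^sub>R x)) \<le> (1 + 1 / \<bar>c\<bar>) * ((1 + norm a) * (1 + norm (c *\<^sub>R x + a)))"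
      by (intro mult_left_mono) auto
    finally show ?thesis by (simp add: M_def mult.assoc)
  qed
  have "(1 + norm x) ^ k * norm (iterated_partial is (\<lambda>x. \<phi> (c *\<^sub>R x + a)) x) \<le> M ^ k * (\<bar>c\<bar> ^ length is * C)" for x
  proof -
    have "(1 + norm x) ^ k * norm (iterated_partial is (\<lambda>x. \<phi> (c *\<^sub>R x + a)) x)
      = (1 + norm x) ^ k * (\<bar>c\<bar> ^ length is * norm (iterated_partial is \<phi> (c *\<^sub>R x + a)))"
      by (simp add: iterated_partial_affine schwartz_smooth assms power_abs)
    also have "\<dots> \<le> (M * (1 + norm (c *\<^sub>R x + a))) ^ k * (\<bar>c\<bar> ^ length is * norm (iterated_partial is \<phi> (c *\<^sub>R x + a)))"
      by (intro mult_right_mono power_mono M) auto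
    also have "\<dots> = M ^ k * (\<bar>c\<bar> ^ length is * ((1 + norm (c *\<^sub>R x + a)) ^ k * norm (iterated_partial is \<phi> (c *\<^sub>R x + a))))"
      by (simp add: power_mult_distrib mult_ac)
    also have "\<dots> \<le> M ^ k * (\<bar>c\<bar> ^ length is * C)"
      by (intro mult_left_mono C) (auto simp: M_def)
    finally show ?thesis .
  qed
  then show "\<exists>C. \<forall>x. (1 + norm x) ^ k * norm (iterated_partial is (\<lambda>x. \<phi> (c *\<^sub>R x + a)) x) \<le> C" by blast
qed

lemma schwartz_translate: "\<phi> \<in> schwartz_space \<Longrightarrow> (\<lambda>x. \<phi> (x - a)) \<in> schwartz_space"
  using schwartz_affine[of \<phi> 1 "-a"] by simp

text \<open>Peetre's inequality. It moves a polynomial weight from x to x - z at the cost of a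
  weight in z, and underlies the estimates for translates and convolutions.\<close>

lemma one_norm_translate: "1 + norm x \<le> (1 + norm z) * (1 + norm (x - z :: 'a::real_normed_vector))"
  by (rule one_plus_le_mult) (use norm_triangle_ineq[of z "x - z"] in auto)

lemma schwartz_seminorm_translate:
  assumes "\<phi> \<in> schwartz_space"
  shows "schwartz_seminorm k m (\<lambda>x. \<phi> (x - z)) \<le> (1 + norm z) ^ k * schwartz_seminorm k m \<phi>"
proof (rule schwartz_seminorm_least)
  fix js :: "'a list" and x assume l: "length js \<le> m"
  have "(1 + norm x) ^ k * norm (iterated_partial js (\<lambda>x. \<phi> (x - z)) x)
    = (1 + norm x) ^ k * norm (iterated_partial js \<phi> (x - z))"
    using iterated_partial_affine[OF schwartz_smooth[OF assms], of js 1 "-z"] by simp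
  also have "\<dots> \<le> ((1 + norm z) * (1 + norm (x - z))) ^ k * norm (iterated_partial js \<phi> (x - z))"
    by (intro mult_right_mono power_mono one_norm_translate) auto
  also have "\<dots> = (1 + norm z) ^ k * ((1 + norm (x - z)) ^ k * norm (iterated_partial js \<phi> (x - z)))"
    by (simp add: power_mult_distrib)
  also have "\<dots> \<le> (1 + norm z) ^ k * schwartz_seminorm k m \<phi>"
    by (intro mult_left_mono schwartz_seminorm_upper assms l) auto
  finally show "(1 + norm x) ^ k * norm (iterated_partial js (\<lambda>x. \<phi> (x - z)) x) \<le> (1 + norm z) ^ k * schwartz_seminorm k m \<phi>" .
qed

text \<open>Off the closed support the function vanishes on an open set, so its derivatives do as
  well; on the support, continuity and compactness give the bound.\<close>

lemma compact_support_bound: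
  fixes f :: "real^'n::finite \<Rightarrow> 'b::real_normed_vector"
  assumes f: "smooth f" and K: "compact (closure {x. f x \<noteq> 0})"
  shows "\<exists>C. \<forall>x. (1 + norm x) ^ k * norm (iterated_partial is f x) \<le> C"
proof -
  let ?K = "closure {x. f x \<noteq> 0}"
  have z: "iterated_partial is f x = 0" if "x \<notin> ?K" for x
  proof -
    have 0: "f y = (\<lambda>x. 0) y" if "y \<in> - ?K" for y
      using that closure_subset[of "{x. f x \<noteq> 0}"] by blast
    have "iterated_partial is f x = iterated_partial is (\<lambda>x. 0) x"
      by (rule iterated_partial_cong_open[OF f open_Compl[OF closed_closure] 0]) (use that in auto)
    then show ?thesis by (simp only: iterated_partial_zero)
  qed
  have "continuous_on ?K (\<lambda>x. (1 + norm x) ^ k * norm (iterated_partial is f x))"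
    by (intro continuous_intros smooth_continuous smooth_iterated_partial f)
  then have "bounded ((\<lambda>x. (1 + norm x) ^ k * norm (iterated_partial is f x)) ` ?K)"
    using K compact_continuous_image compact_imp_bounded by blast
  then obtain C where C': "\<forall>y\<in>(\<lambda>x. (1 + norm x) ^ k * norm (iterated_partial is f x)) ` ?K. norm y \<le> C"
    unfolding bounded_iff by blast
  have C: "(1 + norm x) ^ k * norm (iterated_partial is f x) \<le> C" if "x \<in> ?K" for x
    using bspec[OF C' imageI[OF that]] by simp
  have "(1 + norm x) ^ k * norm (iterated_partial is f x) \<le> max C 0" for x
    using C[of x] z[of x] by (cases "x \<in> ?K") auto
  then show ?thesis by blast
qed

lemma test_functions_schwartz: "test_functions \<subseteq> schwartz_space"
  unfolding test_functions_def by (auto intro!: schwartz_spaceI compact_support_bound)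

lemma bounded_derivs_uniform:
  fixes a :: "real^'n::finite \<Rightarrow> 'b::real_normed_vector"
  assumes "\<And>is. \<exists>A. \<forall>x. norm (iterated_partial is a x) \<le> A"
  shows "\<exists>A. \<forall>is x. length is \<le> m \<longrightarrow> norm (iterated_partial is a x) \<le> A"
proof -
  obtain A where A: "\<And>is x. norm (iterated_partial is a x) \<le> A is" using assms by metis
  have fin: "finite {is :: 'n list. length is \<le> m}"
    using finite_lists_length_le[of "UNIV :: 'n set" m] by simp
  have "norm (iterated_partial is a x) \<le> (\<Sum>js | length js \<le> m. \<bar>A js\<bar>)" if "length is \<le> m" for "is" x
  proof -
    have "norm (iterated_partial is a x) \<le> \<bar>A is\<bar>" using A[of "is" x] by linarith
    also have "\<dots> \<le> (\<Sum>js | length js \<le> m. \<bar>A js\<bar>)" by (rule member_le_sum) (use that fin in auto)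
    finally show ?thesis .
  qed
  then show ?thesis by blast
qed

lemma test_function_mult:
  assumes "smooth f" "\<eta> \<in> test_functions"
  shows "(\<lambda>x. f x * \<eta> x) \<in> test_functions" "(\<lambda>x. \<eta> x * f x) \<in> test_functions"
proof -
  have c: "compact (closure {x. \<eta> x \<noteq> 0})" using assms(2) by (simp add: test_functions_def)
  have "closure {x. f x * \<eta> x \<noteq> 0} \<subseteq> closure {x. \<eta> x \<noteq> 0}" by (intro closure_mono) auto
  then have "compact (closure {x. f x * \<eta> x \<noteq> 0})"
    using compact_Int_closed[OF c closed_closure, of "{x. f x * \<eta> x \<noteq> 0}"] by (simp add: Int_absorb1)
  then show "(\<lambda>x. f x * \<eta> x) \<in> test_functions"
    using assms by (auto simp: test_functions_def smooth_mult)
  then show "(\<lambda>x. \<eta> x * f x) \<in> test_functions" by (simp add: mult.commute)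
qed

subsection \<open>Integration on Euclidean space\<close>

text \<open>This covers a non-integrable \<open>f\<close> too: its integral is then 0 by convention,
  while that of \<open>g\<close> is nonnegative.\<close>

lemma norm_integral_le_AE:
  fixes f :: "'a \<Rightarrow> 'b::{banach,second_countable_topology}"
  assumes "integrable M g" "AE x in M. norm (f x) \<le> g x"
  shows "norm (LINT x|M. f x) \<le> (LINT x|M. g x)"
proof -
  have "AE x in M. 0 \<le> g x" using assms(2) by (rule eventually_mono) (rule order_trans[OF norm_ge_zero])
  then show ?thesis by (rule order_trans[OF integral_norm_bound integral_mono_AE'[OF assms]])
qed

lemma measurable_vec_nth [measurable]: "(\<lambda>x::real^'n::finite. x $ i) \<in> borel_measurable borel"
  by (intro borel_measurable_continuous_onI continuous_intros)

text \<open>Lebesgue measure on \<open>real^'n\<close> is the image of a product measure indexed by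
  \<open>Basis\<close>; the axis vectors reindex \<open>Basis\<close> by \<open>'n\<close>, after
  which both claims are the product rules for integrals.\<close>

lemma
  fixes f :: "'n::finite \<Rightarrow> real \<Rightarrow> 'b::{real_normed_field,banach,second_countable_topology}"
  assumes f: "\<And>i. integrable lborel (f i)"
  shows integrable_prod_component: "integrable lborel (\<lambda>x::real^'n. \<Prod>i\<in>UNIV. f i (x $ i))"
    and integral_prod_component: "(LINT x|(lborel :: (real^'n) measure). (\<Prod>i\<in>UNIV. f i (x $ i))) = (\<Prod>i\<in>UNIV. (LINT t|lborel. f i t))"
proof -
  interpret product_sigma_finite "\<lambda>_ :: real^'n. lborel :: real measure" ..
  let ?e = "\<lambda>i::'n. axis i (1::real)"
  let ?T = "\<lambda>g :: real^'n \<Rightarrow> real. \<Sum>b\<in>Basis. g b *\<^sub>R b"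
  define F where "F b = f (inv ?e b)" for b
  have inj: "inj ?e" by (rule injI) (simp add: axis_eq_axis)
  have B: "(Basis :: (real^'n) set) = range ?e" by (auto simp: Basis_vec_def)
  have [measurable]: "f i \<in> borel_measurable borel" for i
    using f[of i] by (simp add: borel_measurable_integrable)
  have T[measurable]: "?T \<in> (\<Pi>\<^sub>M b\<in>(Basis :: (real^'n) set). lborel) \<rightarrow>\<^sub>M borel" by simp
  have comp: "?T g $ i = g (?e i)" for g i
  proof -
    have "?T g $ i = (\<Sum>j\<in>UNIV. g (?e j) * (?e j $ i))"
      unfolding B by (subst sum.reindex[OF inj]) (simp add: sum_component)
    also have "\<dots> = (\<Sum>j\<in>UNIV. if j = i then g (?e j) else 0)"
      by (intro sum.cong) (auto simp: axis_def)
    finally show ?thesis by simp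
  qed
  have eq: "(\<Prod>i\<in>UNIV. f i (?T g $ i)) = (\<Prod>b\<in>Basis. F b (g b))" for g
    unfolding comp unfolding B by (subst prod.reindex[OF inj]) (simp add: F_def inv_f_f[OF inj])
  have F: "integrable lborel (F b)" for b using f by (simp add: F_def)
  have m: "(\<lambda>x::real^'n. \<Prod>i\<in>UNIV. f i (x $ i)) \<in> borel_measurable borel" by measurable
  show "integrable lborel (\<lambda>x::real^'n. \<Prod>i\<in>UNIV. f i (x $ i))"
    by (subst lborel_eq, subst integrable_distr_eq[OF T m])
       (unfold eq, rule product_integrable_prod, auto intro: F)
  have "(LINT x|(lborel :: (real^'n) measure). (\<Prod>i\<in>UNIV. f i (x $ i))) = (\<Prod>b\<in>Basis. (LINT t|lborel. F b t))"
    by (subst lborel_eq, subst integral_distr[OF T m])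
       (unfold eq, rule product_integral_prod, auto intro: F)
  also have "\<dots> = (\<Prod>i\<in>UNIV. (LINT t|lborel. f i t))"
    unfolding B by (subst prod.reindex[OF inj]) (simp add: F_def inv_f_f[OF inj])
  finally show "(LINT x|(lborel :: (real^'n) measure). (\<Prod>i\<in>UNIV. f i (x $ i))) = (\<Prod>i\<in>UNIV. (LINT t|lborel. f i t))" .
qed

lemma integrable_one_plus_square: "integrable lborel (\<lambda>t::real. 1 / (1 + t\<^sup>2))"
  using integrable_inverse_1_plus_square unfolding set_integrable_def by (simp add: divide_inverse)

text \<open>Each of the n factors 1 + x_i^2 is at most (1 + |x|)^2, so the weight of order 2n is
  dominated by a product of one-dimensional integrable functions. The exponent is not sharp, which
  is harmless because k may be taken large.\<close>

lemma integrable_one_plus_norm: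
  assumes "k \<ge> 2 * CARD('n::finite)"
  shows "integrable lborel (\<lambda>x::real^'n. 1 / (1 + norm x) ^ k)"
proof (rule Bochner_Integration.integrable_bound)
  show "integrable lborel (\<lambda>x::real^'n. \<Prod>i\<in>UNIV. 1 / (1 + (x $ i)\<^sup>2))"
    by (rule integrable_prod_component[OF integrable_one_plus_square])
  show "AE x::real^'n in lborel. norm (1 / (1 + norm x) ^ k) \<le> norm (\<Prod>i\<in>UNIV. 1 / (1 + (x $ i)\<^sup>2))"
  proof (rule AE_I2)
    fix x :: "real^'n"
    have "(\<Prod>i\<in>UNIV. 1 + (x $ i)\<^sup>2) \<le> (\<Prod>i\<in>(UNIV::'n set). (1 + norm x)\<^sup>2)"
    proof (rule prod_mono)
      fix i :: 'n
      have "(x $ i)\<^sup>2 \<le> (norm x)\<^sup>2"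
        using component_le_norm_cart[of x i] by (simp add: abs_le_square_iff[symmetric])
      moreover have "(1 + norm x)\<^sup>2 = 1 + 2 * norm x + (norm x)\<^sup>2" by (simp add: power2_sum)
      ultimately show "0 \<le> 1 + (x $ i)\<^sup>2 \<and> 1 + (x $ i)\<^sup>2 \<le> (1 + norm x)\<^sup>2"
        using norm_ge_zero[of x] zero_le_power2[of "x $ i"] by (intro conjI; linarith)
    qed
    also have "\<dots> = (1 + norm x) ^ (2 * CARD('n))" by (simp add: power_mult)
    also have "\<dots> \<le> (1 + norm x) ^ k" by (rule power_increasing[OF assms]) auto
    finally have "(\<Prod>i\<in>UNIV. 1 + (x $ i)\<^sup>2) \<le> (1 + norm x) ^ k" .
    moreover have "0 < (\<Prod>i\<in>UNIV. 1 + (x $ i)\<^sup>2)" by (intro prod_pos) (auto simp: add_pos_nonneg)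
    ultimately have "1 / (1 + norm x) ^ k \<le> 1 / (\<Prod>i\<in>UNIV. 1 + (x $ i)\<^sup>2)"
      by (intro divide_left_mono mult_pos_pos zero_less_power) (auto simp: add_pos_nonneg)
    moreover have "0 \<le> (\<Prod>i\<in>UNIV. 1 / (1 + (x $ i)\<^sup>2))" by (intro prod_nonneg) auto
    ultimately show "norm (1 / (1 + norm x) ^ k) \<le> norm (\<Prod>i\<in>UNIV. 1 / (1 + (x $ i)\<^sup>2))"
      by (simp add: prod_dividef)
  qed
qed measurable

lemma integral_affine:
  fixes f :: "'a::euclidean_space \<Rightarrow> 'b::{banach,second_countable_topology}"
  assumes [measurable]: "f \<in> borel_measurable borel" and c: "c \<noteq> 0"
  shows "(LINT x|lborel. f (t + c *\<^sub>R x)) = (1 / \<bar>c\<bar> ^ DIM('a)) *\<^sub>R (LINT x|lborel. f x)"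
proof -
  have "(LINT x|lborel. f x) = \<bar>c\<bar> ^ DIM('a) *\<^sub>R (LINT x|lborel. f (t + c *\<^sub>R x))"
    by (subst lborel_affine[OF c, of t]) (simp add: integral_density integral_distr)
  then show ?thesis using c by simp
qed

lemma integrable_affine:
  fixes f :: "'a::euclidean_space \<Rightarrow> 'b::{banach,second_countable_topology}"
  assumes [measurable]: "f \<in> borel_measurable borel" and c: "c \<noteq> 0"
  shows "integrable lborel (\<lambda>x. f (t + c *\<^sub>R x)) \<longleftrightarrow> integrable lborel f"
proof -
  have "integrable lborel f \<longleftrightarrow> integrable lborel (\<lambda>x. \<bar>c\<bar> ^ DIM('a) *\<^sub>R f (t + c *\<^sub>R x))"
    by (subst lborel_affine[OF c, of t]) (simp add: integrable_density integrable_distr_eq)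
  also have "\<dots> \<longleftrightarrow> integrable lborel (\<lambda>x. f (t + c *\<^sub>R x))"
    using c integrable_scaleR_right[of "1 / \<bar>c\<bar> ^ DIM('a)" lborel "\<lambda>x. \<bar>c\<bar> ^ DIM('a) *\<^sub>R f (t + c *\<^sub>R x)"]
    by (auto intro: integrable_scaleR_right)
  finally show ?thesis by simp
qed

lemma integral_reflect:
  fixes f :: "'a::euclidean_space \<Rightarrow> 'b::{banach,second_countable_topology}"
  assumes "f \<in> borel_measurable borel"
  shows "(LINT x|lborel. f (a - x)) = (LINT x|lborel. f x)"
  using integral_affine[OF assms, of "-1" a] by simp

lemma integrable_reflect:
  fixes f :: "'a::euclidean_space \<Rightarrow> 'b::{banach,second_countable_topology}"
  assumes "f \<in> borel_measurable borel"
  shows "integrable lborel (\<lambda>x. f (a - x)) \<longleftrightarrow> integrable lborel f"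
  using integrable_affine[OF assms, of "-1" a] by simp

lemma integral_translate:
  fixes f :: "'a::euclidean_space \<Rightarrow> 'b::{banach,second_countable_topology}"
  assumes "f \<in> borel_measurable borel"
  shows "(LINT x|lborel. f (x - a)) = (LINT x|lborel. f x)"
  using integral_affine[OF assms, of 1 "-a"] by simp

lemma schwartz_measurable: "\<phi> \<in> schwartz_space \<Longrightarrow> \<phi> \<in> borel_measurable borel"
  by (simp add: schwartz_smooth smooth_measurable)

lemma schwartz_integrable_weighted:
  fixes \<phi> :: "real^'n::finite \<Rightarrow> complex"
  assumes "\<phi> \<in> schwartz_space"
  shows "integrable lborel (\<lambda>x. (1 + norm x) ^ k * norm (\<phi> x))"
proof -
  let ?m = "2 * CARD('n)"
  obtain C where C: "C \<ge> 0" "\<And>x. (1 + norm x) ^ (k + ?m) * norm (\<phi> x) \<le> C"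
    using schwartz_bound[OF assms, of "k + ?m" "[]"] by auto
  have [measurable]: "\<phi> \<in> borel_measurable borel" by (rule schwartz_measurable[OF assms])
  have "integrable lborel (\<lambda>x::real^'n. C * (1 / (1 + norm x) ^ ?m))"
    by (intro integrable_mult_right integrable_one_plus_norm) simp
  then show ?thesis
  proof (rule Bochner_Integration.integrable_bound)
    show "AE x in lborel. norm ((1 + norm x) ^ k * norm (\<phi> x)) \<le> norm (C * (1 / (1 + norm x) ^ ?m))"
    proof (rule AE_I2)
      fix x :: "real^'n"
      have p: "(1 + norm x) ^ ?m > 0" by (simp add: add_pos_nonneg)
      have "(1 + norm x) ^ k * norm (\<phi> x) \<le> C * (1 / (1 + norm x) ^ ?m)"
        using C(2)[of x] p by (simp add: field_simps power_add)
      then show "norm ((1 + norm x) ^ k * norm (\<phi> x)) \<le> norm (C * (1 / (1 + norm x) ^ ?m))"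
        using C(1) by (simp add: abs_mult)
    qed
  qed simp
qed

lemma schwartz_integrable:
  assumes "\<phi> \<in> schwartz_space"
  shows "integrable lborel \<phi>"
  using schwartz_integrable_weighted[OF assms, of 0] schwartz_measurable[OF assms]
  by (simp add: integrable_norm_iff)

subsection \<open>Convolution with Schwartz functions\<close>

text \<open>Polynomial growth in an averaged sense: just what convolution with a Schwartz function
  needs in order to converge and to be smooth.\<close>

definition tempered_density :: "(real^'n::finite \<Rightarrow> complex) \<Rightarrow> bool" where
  "tempered_density w \<longleftrightarrow> w \<in> borel_measurable borel \<and> (\<exists>N. integrable lborel (\<lambda>z. norm (w z) / (1 + norm z) ^ N))"

text \<open>All moments finite: enough for convolution to map Schwartz functions to Schwartz
  functions, with no smoothness of \<open>w\<close>. This is the class in which the Bessel kernel is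
  placed.\<close>

definition moment_density :: "(real^'n::finite \<Rightarrow> complex) \<Rightarrow> bool" where
  "moment_density w \<longleftrightarrow> w \<in> borel_measurable borel \<and> (\<forall>k. integrable lborel (\<lambda>z. (1 + norm z) ^ k * norm (w z)))"

definition conv :: "(real^'n::finite \<Rightarrow> complex) \<Rightarrow> (real^'n \<Rightarrow> complex) \<Rightarrow> real^'n \<Rightarrow> complex" where
  "conv w \<phi> x = (LINT z|lborel. w z * \<phi> (x - z))"

lemma moment_density_tempered: "moment_density w \<Longrightarrow> tempered_density w"
  unfolding moment_density_def tempered_density_def
  by (auto intro!: exI[of _ 0] dest: spec[of _ 0])

lemma schwartz_moment_density: "\<phi> \<in> schwartz_space \<Longrightarrow> moment_density \<phi>"
  by (simp add: moment_density_def schwartz_measurable schwartz_integrable_weighted)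

lemma bounded_tempered_density:
  fixes w :: "real^'n::finite \<Rightarrow> complex"
  assumes [measurable]: "w \<in> borel_measurable borel" and B: "AE z in lborel. norm (w z) \<le> B"
  shows "tempered_density w"
  unfolding tempered_density_def
proof (intro conjI exI)
  have "integrable lborel (\<lambda>z::real^'n. B * (1 / (1 + norm z) ^ (2 * CARD('n))))"
    by (intro integrable_mult_right integrable_one_plus_norm) simp
  then show "integrable lborel (\<lambda>z. norm (w z) / (1 + norm z) ^ (2 * CARD('n)))"
  proof (rule Bochner_Integration.integrable_bound)
    show "AE z in lborel. norm (norm (w z) / (1 + norm z) ^ (2 * CARD('n))) \<le> norm (B * (1 / (1 + norm z) ^ (2 * CARD('n))))"
      using B
    proof eventually_elim
      case (elim z)
      then have "norm (w z) \<le> \<bar>B\<bar>" by linarith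
      then show ?case by (simp add: divide_right_mono abs_mult)
    qed
  qed simp
qed fact

lemma conv_integrable:
  fixes w :: "real^'n::finite \<Rightarrow> complex"
  assumes w: "tempered_density w" and \<phi>: "\<phi> \<in> schwartz_space"
  shows "integrable lborel (\<lambda>z. w z * \<phi> (x - z))"
proof -
  obtain N where N: "integrable lborel (\<lambda>z. norm (w z) / (1 + norm z) ^ N)" and [measurable]: "w \<in> borel_measurable borel"
    using w by (auto simp: tempered_density_def)
  have [measurable]: "\<phi> \<in> borel_measurable borel" by (rule schwartz_measurable[OF \<phi>])
  obtain C where C: "C \<ge> 0" "\<And>x. (1 + norm x) ^ N * norm (\<phi> x) \<le> C"
    using schwartz_bound[OF \<phi>, of N "[]"] by auto
  have "integrable lborel (\<lambda>z. ((1 + norm x) ^ N * C) * (norm (w z) / (1 + norm z) ^ N))"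
    by (rule integrable_mult_right[OF N])
  then show ?thesis
  proof (rule Bochner_Integration.integrable_bound)
    show "AE z in lborel. norm (w z * \<phi> (x - z)) \<le> norm (((1 + norm x) ^ N * C) * (norm (w z) / (1 + norm z) ^ N))"
    proof (rule AE_I2)
      fix z :: "real^'n"
      have p: "(1 + norm z) ^ N > 0" by (simp add: add_pos_nonneg)
      have "(1 + norm z) ^ N * norm (\<phi> (x - z)) \<le> ((1 + norm x) * (1 + norm (x - z))) ^ N * norm (\<phi> (x - z))"
        using one_norm_translate[of z x] by (intro mult_right_mono power_mono) (auto simp: norm_minus_commute)
      also have "\<dots> = (1 + norm x) ^ N * ((1 + norm (x - z)) ^ N * norm (\<phi> (x - z)))"
        by (simp add: power_mult_distrib)
      also have "\<dots> \<le> (1 + norm x) ^ N * C" by (intro mult_left_mono C) auto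
      finally have "norm (\<phi> (x - z)) \<le> (1 + norm x) ^ N * C / (1 + norm z) ^ N"
        using p by (simp add: pos_le_divide_eq mult.commute)
      from mult_left_mono[OF this, of "norm (w z)"]
      show "norm (w z * \<phi> (x - z)) \<le> norm (((1 + norm x) ^ N * C) * (norm (w z) / (1 + norm z) ^ N))"
        using C(1) by (simp add: norm_mult abs_mult mult_ac)
    qed
  qed simp
qed

lemma lipschitz_partial_deriv:
  fixes f :: "real^'n::finite \<Rightarrow> 'b::real_normed_vector" and L :: real
  assumes "convex S" "\<And>y. y \<in> S \<Longrightarrow> f differentiable at y"
    and L: "\<And>i y. y \<in> S \<Longrightarrow> norm (partial_deriv i f y) \<le> L" and xy: "x \<in> S" "y \<in> S"
  shows "norm (f x - f y) \<le> (CARD('n) * L) * norm (x - y)"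
proof (rule differentiable_bound[OF assms(1) _ _ xy])
  show "(f has_derivative (\<lambda>h. \<Sum>i\<in>UNIV. (h $ i) *\<^sub>R partial_deriv i f y)) (at y within S)" if "y \<in> S" for y
    using has_derivative_partial_deriv[OF assms(2)[OF that]] has_derivative_at_withinI by blast
  have "0 \<le> L" using order_trans[OF norm_ge_zero L[OF xy(1)]] by simp
  show "onorm (\<lambda>h. \<Sum>i\<in>UNIV. (h $ i) *\<^sub>R partial_deriv i f y) \<le> CARD('n) * L" if "y \<in> S" for y
  proof (rule onorm_bound)
    fix h :: "real^'n"
    have "norm (\<Sum>i\<in>UNIV. (h $ i) *\<^sub>R partial_deriv i f y) \<le> (\<Sum>i\<in>(UNIV :: 'n set). norm h * L)"
      by (rule sum_norm_le) (auto intro!: mult_mono component_le_norm_cart L that)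
    then show "norm (\<Sum>i\<in>UNIV. (h $ i) *\<^sub>R partial_deriv i f y) \<le> CARD('n) * L * norm h"
      by (simp add: mult_ac)
  qed (use \<open>0 \<le> L\<close> in auto)
qed

text \<open>The weighted second-order remainder allows differentiation under the convolution integral
  against every density of polynomial growth, without dominated convergence.\<close>

lemma schwartz_taylor:
  fixes \<phi> :: "real^'n::finite \<Rightarrow> complex"
  assumes \<phi>: "\<phi> \<in> schwartz_space"
  shows "\<exists>C\<ge>0. \<forall>x h. norm h \<le> 1 \<longrightarrow>
    norm (\<phi> (x + h) - \<phi> x - (\<Sum>i\<in>UNIV. (h $ i) *\<^sub>R partial_deriv i \<phi> x)) \<le> C * (norm h)\<^sup>2 / (1 + norm x) ^ N"
proof -
  define p where "p = schwartz_seminorm N 2 \<phi>"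
  have p: "p \<ge> 0" unfolding p_def by (rule schwartz_seminorm_nonneg[OF \<phi>])
  \<comment> \<open>One factor n for each of two applications of the mean value inequality;
    \<open>2 ^ N\<close> because 1 + |x| \<le> 2 (1 + |y|) within distance 1 of x.\<close>
  define C where "C = real CARD('n) * (real CARD('n) * (2 ^ N * p))"
  have diff: "partial_deriv i \<phi> differentiable at x" for i x
    using smooth_differentiable[OF smooth_partial_deriv[OF schwartz_smooth[OF \<phi>]]] .
  have diff0: "\<phi> differentiable at x" for x
    using smooth_differentiable[OF schwartz_smooth[OF \<phi>]] .
  have "norm (\<phi> (x + h) - \<phi> x - (\<Sum>i\<in>UNIV. (h $ i) *\<^sub>R partial_deriv i \<phi> x)) \<le> C * (norm h)\<^sup>2 / (1 + norm x) ^ N"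
    if h: "norm h \<le> 1" for x h
  proof -
    define L where "L = 2 ^ N * p / (1 + norm x) ^ N"
    have L0: "0 \<le> L" using p by (simp add: L_def)
    have L: "norm (partial_deriv j (partial_deriv i \<phi>) y) \<le> L" if "y \<in> cball x (norm h)" for i j y
    proof -
      have d: "norm (x - y) \<le> 1" using that h by (simp add: dist_norm)
      have "1 + norm x \<le> (1 + norm y) * 2"
        using one_norm_translate[of x y] mult_left_mono[OF d, of "1 + norm y"] by (simp add: algebra_simps)
      then have "(1 + norm x) ^ N \<le> ((1 + norm y) * 2) ^ N" by (intro power_mono) auto
      then have "(1 + norm x) ^ N * norm (partial_deriv j (partial_deriv i \<phi>) y) \<le>
        ((1 + norm y) * 2) ^ N * norm (partial_deriv j (partial_deriv i \<phi>) y)" by (rule mult_right_mono) simp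
      also have "\<dots> = 2 ^ N * ((1 + norm y) ^ N * norm (iterated_partial [j, i] \<phi> y))"
        by (simp only: power_mult_distrib iterated_partial.simps mult_ac)
      also have "\<dots> \<le> 2 ^ N * p" unfolding p_def
        by (intro mult_left_mono schwartz_seminorm_upper \<phi>) auto
      finally show ?thesis by (simp add: L_def pos_le_divide_eq add_pos_nonneg mult.commute)
    qed
    have L1: "norm (partial_deriv i \<phi> y - partial_deriv i \<phi> x) \<le> CARD('n) * L * norm h" if "y \<in> cball x (norm h)" for i y
    proof -
      have "norm (partial_deriv i \<phi> y - partial_deriv i \<phi> x) \<le> CARD('n) * L * norm (y - x)"
        by (rule lipschitz_partial_deriv[where f = "partial_deriv i \<phi>" and S = "cball x (norm h)"])
           (use that L diff in auto)
      also have "\<dots> \<le> CARD('n) * L * norm h"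
        using that L0 by (intro mult_left_mono) (auto simp: dist_norm norm_minus_commute)
      finally show ?thesis .
    qed
    \<comment> \<open>\<open>r\<close> is \<phi> minus its linear part at x, so its partial
      derivatives at y are the increments already bounded in \<open>L1\<close>.\<close>
    define r where "r y = \<phi> y - (\<Sum>i\<in>UNIV. ((y - x) $ i) *\<^sub>R partial_deriv i \<phi> x)" for y
    have rd: "(r has_derivative (\<lambda>k. (\<Sum>i\<in>UNIV. (k $ i) *\<^sub>R partial_deriv i \<phi> y) - (\<Sum>i\<in>UNIV. (k $ i) *\<^sub>R partial_deriv i \<phi> x))) (at y)" for y
      unfolding r_def
      by (intro has_derivative_diff has_derivative_partial_deriv diff0)
         (auto intro!: derivative_eq_intros bounded_linear.has_derivative[OF bounded_linear_vec_nth])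
    have pr: "partial_deriv j r y = partial_deriv j \<phi> y - partial_deriv j \<phi> x" for j y
      using partial_deriv_eqI[OF rd, of j y] by (simp add: sum_axis_scaleR)
    have "norm (r (x + h) - r x) \<le> (CARD('n) * (CARD('n) * L * norm h)) * norm (x + h - x)"
      by (rule lipschitz_partial_deriv[where f = r and S = "cball x (norm h)"]) (auto simp: pr dist_norm L1 intro: rd differentiableI)
    also have "\<dots> = C * (norm h)\<^sup>2 / (1 + norm x) ^ N"
      by (simp add: C_def L_def power2_eq_square)
    finally show ?thesis by (simp add: r_def algebra_simps)
  qed
  moreover have "C \<ge> 0" using p by (simp add: C_def)
  ultimately show ?thesis by blast
qed

lemma conv_has_derivative:
  fixes w :: "real^'n::finite \<Rightarrow> complex"
  assumes w: "tempered_density w" and \<phi>: "\<phi> \<in> schwartz_space"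
  shows "(conv w \<phi> has_derivative (\<lambda>h. \<Sum>i\<in>UNIV. (h $ i) *\<^sub>R conv w (partial_deriv i \<phi>) x)) (at x)"
proof -
  obtain N where N: "integrable lborel (\<lambda>z. norm (w z) / (1 + norm z) ^ N)" and [measurable]: "w \<in> borel_measurable borel"
    using w by (auto simp: tempered_density_def)
  obtain C where C: "C \<ge> 0" and T: "\<And>x h. norm h \<le> 1 \<Longrightarrow>
    norm (\<phi> (x + h) - \<phi> x - (\<Sum>i\<in>UNIV. (h $ i) *\<^sub>R partial_deriv i \<phi> x)) \<le> C * (norm h)\<^sup>2 / (1 + norm x) ^ N"
    using schwartz_taylor[OF \<phi>, of N] by blast
  define I where "I = (LINT z|lborel. norm (w z) / (1 + norm z) ^ N)"
  define K where "K = C * (1 + norm x) ^ N * I"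
  note ci = conv_integrable[OF w \<phi>] conv_integrable[OF w schwartz_partial_deriv[OF \<phi>]]
  have main: "norm (conv w \<phi> (x + h) - conv w \<phi> x - (\<Sum>i\<in>UNIV. (h $ i) *\<^sub>R conv w (partial_deriv i \<phi>) x)) \<le> K * (norm h)\<^sup>2"
    if h: "norm h \<le> 1" for h
  proof -
    let ?r = "\<lambda>z. \<phi> (x - z + h) - \<phi> (x - z) - (\<Sum>i\<in>UNIV. (h $ i) *\<^sub>R partial_deriv i \<phi> (x - z))"
    have eq: "w z * ?r z = w z * \<phi> (x + h - z) - w z * \<phi> (x - z) - (\<Sum>i\<in>UNIV. (h $ i) *\<^sub>R (w z * partial_deriv i \<phi> (x - z)))" for z
      by (simp add: algebra_simps sum_distrib_left)
    have int: "integrable lborel (\<lambda>z. w z * ?r z)"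
      unfolding eq by (intro Bochner_Integration.integrable_diff Bochner_Integration.integrable_sum integrable_scaleR_right ci)
    have "conv w \<phi> (x + h) - conv w \<phi> x - (\<Sum>i\<in>UNIV. (h $ i) *\<^sub>R conv w (partial_deriv i \<phi>) x) = (LINT z|lborel. w z * ?r z)"
      unfolding eq conv_def
      by (subst Bochner_Integration.integral_diff integral_scaleR_right[symmetric] Bochner_Integration.integral_sum[symmetric];
          (intro Bochner_Integration.integrable_diff Bochner_Integration.integrable_sum integrable_scaleR_right ci)?)+
         (simp add: integral_scaleR_right)
    also have "norm \<dots> \<le> (LINT z|lborel. (C * (norm h)\<^sup>2 * (1 + norm x) ^ N) * (norm (w z) / (1 + norm z) ^ N))"
    proof (rule Bochner_Integration.integral_norm_bound_integral[OF int])
      show "integrable lborel (\<lambda>z. (C * (norm h)\<^sup>2 * (1 + norm x) ^ N) * (norm (w z) / (1 + norm z) ^ N))"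
        by (rule integrable_mult_right[OF N])
      fix z :: "real^'n"
      have p: "(1 + norm z) ^ N > 0" "(1 + norm (x - z)) ^ N > 0" by (simp_all add: add_pos_nonneg)
      \<comment> \<open>Decay of the remainder in x - z is traded for decay in z, the weight against
        which \<open>w\<close> is integrable; the price is a power of 1 + |x|, constant
        here.\<close>
      have "(1 + norm z) ^ N \<le> ((1 + norm x) * (1 + norm (x - z))) ^ N"
        using one_norm_translate[of z x] by (intro power_mono) (auto simp: norm_minus_commute)
      then have "1 / (1 + norm (x - z)) ^ N \<le> (1 + norm x) ^ N / (1 + norm z) ^ N"
        using p by (simp add: divide_simps power_mult_distrib)
      then have "C * (norm h)\<^sup>2 * (1 / (1 + norm (x - z)) ^ N) \<le> C * (norm h)\<^sup>2 * ((1 + norm x) ^ N / (1 + norm z) ^ N)"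
        using C by (intro mult_left_mono) auto
      with T[OF h, of "x - z"] have "norm (?r z) \<le> C * (norm h)\<^sup>2 * ((1 + norm x) ^ N / (1 + norm z) ^ N)"
        by simp
      from mult_left_mono[OF this, of "norm (w z)"]
      show "norm (w z * ?r z) \<le> (C * (norm h)\<^sup>2 * (1 + norm x) ^ N) * (norm (w z) / (1 + norm z) ^ N)"
        by (simp add: norm_mult mult_ac)
    qed
    also have "\<dots> = K * (norm h)\<^sup>2" unfolding K_def I_def by (simp only: integral_mult_right_zero mult_ac)
    finally show ?thesis .
  qed
  show ?thesis
  proof (rule has_derivativeI_sandwich[of 1 _ UNIV _ _ "\<lambda>y. K * norm (y - x)"])
    show "bounded_linear (\<lambda>h. \<Sum>i\<in>UNIV. (h $ i) *\<^sub>R conv w (partial_deriv i \<phi>) x)"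
      by (intro bounded_linear_sum bounded_linear_scaleR_const bounded_linear_vec_nth)
    show "norm (conv w \<phi> y - conv w \<phi> x - (\<Sum>i\<in>UNIV. ((y - x) $ i) *\<^sub>R conv w (partial_deriv i \<phi>) x)) / norm (y - x) \<le> K * norm (y - x)"
      if "y \<noteq> x" "dist y x < 1" for y
      using main[of "y - x"] that by (simp add: dist_norm pos_divide_le_eq power2_eq_square mult_ac)
    show "((\<lambda>y. K * norm (y - x)) \<longlongrightarrow> 0) (at x)"
      by (intro tendsto_eq_intros | simp)+
  qed simp
qed

lemma conv_differentiable:
  "tempered_density w \<Longrightarrow> \<phi> \<in> schwartz_space \<Longrightarrow> conv w \<phi> differentiable at x"
  using conv_has_derivative differentiableI by blast

lemma partial_deriv_conv:
  assumes "tempered_density w" "\<phi> \<in> schwartz_space"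
  shows "partial_deriv i (conv w \<phi>) = conv w (partial_deriv i \<phi>)"
  by (rule ext, subst partial_deriv_eqI[OF conv_has_derivative[OF assms]]) (simp add: sum_axis_scaleR)

lemma smooth_conv:
  assumes "tempered_density w" "\<phi> \<in> schwartz_space"
  shows "smooth (conv w \<phi>)"
  by (rule smooth_coinduct[where S = "{conv w \<phi> | \<phi>. \<phi> \<in> schwartz_space}"])
     (use assms in \<open>auto simp: partial_deriv_conv intro: conv_differentiable schwartz_partial_deriv\<close>)

text \<open>All derivatives fall on \<phi>, so only decay matters: Peetre's inequality splits the
  weight between \<open>w\<close>, whose k-th moment is finite, and \<phi>.\<close>

lemma conv_schwartz:
  fixes w :: "real^'n::finite \<Rightarrow> complex"
  assumes w: "moment_density w" and \<phi>: "\<phi> \<in> schwartz_space"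
  shows "conv w \<phi> \<in> schwartz_space"
proof (rule schwartz_coinduct[where S = "{conv w \<phi> | \<phi>. \<phi> \<in> schwartz_space}"])
  note wt = moment_density_tempered[OF w]
  fix f assume "f \<in> {conv w \<phi> | \<phi>. \<phi> \<in> schwartz_space}"
  then obtain \<phi> where \<phi>: "\<phi> \<in> schwartz_space" and f: "f = conv w \<phi>" by blast
  show "partial_deriv i f \<in> {conv w \<phi> | \<phi>. \<phi> \<in> schwartz_space}" for i
    using \<phi> by (auto simp: f partial_deriv_conv[OF wt] intro: schwartz_partial_deriv)
  show "f differentiable at x" for x unfolding f by (rule conv_differentiable[OF wt \<phi>])
  fix k
  have W: "integrable lborel (\<lambda>z. (1 + norm z) ^ k * norm (w z))" using w by (simp add: moment_density_def)
  obtain C where C: "C \<ge> 0" "\<And>x. (1 + norm x) ^ k * norm (\<phi> x) \<le> C"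
    using schwartz_bound[OF \<phi>, of k "[]"] by auto
  have "(1 + norm x) ^ k * norm (f x) \<le> (LINT z|lborel. C * ((1 + norm z) ^ k * norm (w z)))" for x
  proof -
    have "(1 + norm x) ^ k * norm (f x) = norm (LINT z|lborel. (1 + norm x) ^ k *\<^sub>R (w z * \<phi> (x - z)))"
      unfolding f conv_def by (subst integral_scaleR_right) simp
    also have "\<dots> \<le> (LINT z|lborel. C * ((1 + norm z) ^ k * norm (w z)))"
    proof (rule Bochner_Integration.integral_norm_bound_integral)
      show "integrable lborel (\<lambda>z. (1 + norm x) ^ k *\<^sub>R (w z * \<phi> (x - z)))"
        by (intro integrable_scaleR_right conv_integrable wt \<phi>)
      show "integrable lborel (\<lambda>z. C * ((1 + norm z) ^ k * norm (w z)))" by (intro integrable_mult_right W)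
      fix z :: "real^'n"
      have "(1 + norm x) ^ k * norm (\<phi> (x - z)) \<le> ((1 + norm z) * (1 + norm (x - z))) ^ k * norm (\<phi> (x - z))"
        by (intro mult_right_mono power_mono one_norm_translate) auto
      also have "\<dots> = (1 + norm z) ^ k * ((1 + norm (x - z)) ^ k * norm (\<phi> (x - z)))"
        by (simp add: power_mult_distrib)
      also have "\<dots> \<le> (1 + norm z) ^ k * C" by (intro mult_left_mono C) auto
      finally have "norm (w z) * ((1 + norm x) ^ k * norm (\<phi> (x - z))) \<le> norm (w z) * ((1 + norm z) ^ k * C)"
        by (rule mult_left_mono) simp
      then show "norm ((1 + norm x) ^ k *\<^sub>R (w z * \<phi> (x - z))) \<le> C * ((1 + norm z) ^ k * norm (w z))"
        by (simp add: norm_mult mult_ac)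
    qed
    finally show ?thesis .
  qed
  then show "\<exists>C. \<forall>x. (1 + norm x) ^ k * norm (f x) \<le> C" by blast
qed (use \<phi> in blast)

lemma conv_commute:
  assumes [measurable]: "f \<in> borel_measurable borel" "g \<in> borel_measurable borel"
  shows "conv f g = conv g f"
proof
  fix x
  have "conv f g x = (LINT z|lborel. (\<lambda>z. f z * g (x - z)) (x - z))"
    unfolding conv_def by (subst integral_reflect) simp_all
  then show "conv f g x = conv g f x" by (simp add: conv_def mult.commute)
qed

subsection \<open>Bump functions and cutoffs\<close>

text \<open>The module over polynomials in the coordinates generated by S. Derivatives of the bump
  and of the Gaussian are polynomial combinations of generators, so differentiability and decay need
  checking on the generators alone.\<close>

inductive_set poly_hull :: "(real^'n::finite \<Rightarrow> complex) set \<Rightarrow> (real^'n \<Rightarrow> complex) set" for S where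
  base: "f \<in> S \<Longrightarrow> f \<in> poly_hull S"
| coord: "f \<in> poly_hull S \<Longrightarrow> (\<lambda>x. complex_of_real (x $ i) * f x) \<in> poly_hull S"
| add: "f \<in> poly_hull S \<Longrightarrow> g \<in> poly_hull S \<Longrightarrow> (\<lambda>x. f x + g x) \<in> poly_hull S"
| cmult: "f \<in> poly_hull S \<Longrightarrow> (\<lambda>x. c * f x) \<in> poly_hull S"

lemma poly_hull_deriv:
  fixes f :: "real^'n::finite \<Rightarrow> complex"
  assumes S: "\<And>f. f \<in> S \<Longrightarrow> (\<forall>x. f differentiable at x) \<and> (\<forall>i. partial_deriv i f \<in> poly_hull S)"
    and f: "f \<in> poly_hull S"
  shows "(\<forall>x. f differentiable at x) \<and> (\<forall>i. partial_deriv i f \<in> poly_hull S)"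
  using f
proof induction
  case (base f)
  then show ?case by (rule S)
next
  case (coord f i)
  have d: "((\<lambda>x. complex_of_real (x $ i)) has_derivative (\<lambda>h. complex_of_real (h $ i))) (at x)" for x :: "real^'n"
    by (rule bounded_linear.has_derivative[OF bounded_linear_compose[OF bounded_linear_of_real bounded_linear_vec_nth] has_derivative_ident])
  have p: "partial_deriv j (\<lambda>x. complex_of_real (x $ i)) = (\<lambda>x. complex_of_real (axis j 1 $ i))" for j
    using partial_deriv_eqI[OF d] by blast
  note m = partial_deriv_mult[of "\<lambda>x. complex_of_real (x $ i)" f, OF differentiableI[OF d]]
  have "(\<lambda>x. complex_of_real (x $ i) * partial_deriv j f x + complex_of_real (axis j 1 $ i) * f x) \<in> poly_hull S" for j
    using coord by (intro poly_hull.add poly_hull.coord poly_hull.cmult) auto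
  then show ?case using coord.IH by (simp add: m p)
next
  case (add f g)
  then have "(\<lambda>x. partial_deriv i f x + partial_deriv i g x) \<in> poly_hull S" for i
    by (intro poly_hull.add) auto
  then show ?case using add.IH by (simp add: partial_deriv_add)
next
  case (cmult f c)
  then have "(\<lambda>x. c * partial_deriv i f x) \<in> poly_hull S" for i
    by (intro poly_hull.cmult) auto
  then show ?case using cmult.IH by (simp add: partial_deriv_bounded_linear[OF bounded_linear_mult_right])
qed

lemma poly_hull_weight:
  fixes f :: "real^'n::finite \<Rightarrow> complex"
  assumes S: "\<And>f k. f \<in> S \<Longrightarrow> \<exists>C. \<forall>x. (1 + norm x) ^ k * norm (f x) \<le> C"
    and f: "f \<in> poly_hull S"
  shows "\<exists>C. \<forall>x. (1 + norm x) ^ k * norm (f x) \<le> C"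
  using f
proof (induction arbitrary: k)
  case (base f)
  then show ?case by (rule S)
next
  case (coord f i)
  \<comment> \<open>A coordinate factor costs one power of the weight, so the bound for
    \<open>f\<close> is taken at \<open>Suc k\<close>.\<close>
  obtain C where C: "\<forall>x. (1 + norm x) ^ Suc k * norm (f x) \<le> C" using coord.IH by blast
  have "(1 + norm x) ^ k * norm (complex_of_real (x $ i) * f x) \<le> C" for x
  proof -
    have "\<bar>x $ i\<bar> \<le> 1 + norm x" using component_le_norm_cart[of x i] by linarith
    then have "((1 + norm x) ^ k * norm (f x)) * \<bar>x $ i\<bar> \<le> ((1 + norm x) ^ k * norm (f x)) * (1 + norm x)"
      by (rule mult_left_mono) auto
    also have "\<dots> \<le> C" using C[rule_format, of x] by (simp add: mult_ac)
    finally show ?thesis by (simp add: norm_mult mult_ac)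
  qed
  then show ?case by blast
next
  case (add f g)
  obtain C D where C: "\<forall>x. (1 + norm x) ^ k * norm (f x) \<le> C" and D: "\<forall>x. (1 + norm x) ^ k * norm (g x) \<le> D" using add.IH by blast
  have "(1 + norm x) ^ k * norm (f x + g x) \<le> C + D" for x
  proof -
    have "(1 + norm x) ^ k * norm (f x + g x) \<le> (1 + norm x) ^ k * (norm (f x) + norm (g x))"
      by (intro mult_left_mono norm_triangle_ineq) auto
    then show ?thesis using C[rule_format, of x] D[rule_format, of x] by (simp add: distrib_left)
  qed
  then show ?case by blast
next
  case (cmult f c)
  obtain C where C: "\<forall>x. (1 + norm x) ^ k * norm (f x) \<le> C" using cmult.IH by blast
  have "(1 + norm x) ^ k * norm (c * f x) \<le> norm c * C" for x
    using mult_left_mono[OF C[rule_format, of x], of "norm c"] by (simp add: norm_mult mult_ac)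
  then show ?case by blast
qed

lemma poly_hull_schwartz:
  assumes "\<And>f. f \<in> S \<Longrightarrow> (\<forall>x. f differentiable at x) \<and> (\<forall>i. partial_deriv i f \<in> poly_hull S)"
    and "\<And>f k. f \<in> S \<Longrightarrow> \<exists>C. \<forall>x. (1 + norm x) ^ k * norm (f x) \<le> C"
  shows "poly_hull S \<subseteq> schwartz_space"
proof
  fix f assume "f \<in> poly_hull S"
  then show "f \<in> schwartz_space"
    using poly_hull_deriv[of S, OF assms(1)] poly_hull_weight[of S, OF assms(2)]
    by (intro schwartz_coinduct[of "poly_hull S"]) blast+
qed

text \<open>The inequality y \<le> exp y at y = x / m, raised to the m-th power; for m = 0 the
  constant is \<open>0 ^ 0\<close>, which is 1. The constants of the form j^j further on stem from
  here.\<close>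

lemma power_le_exp:
  fixes x :: real
  assumes "0 \<le> x"
  shows "x ^ m \<le> real m ^ m * exp x"
proof (cases "m = 0")
  case False
  then have "x / m \<le> exp (x / m)" using exp_ge_add_one_self[of "x / m"] by linarith
  then have "x \<le> m * exp (x / m)" using False by (simp add: field_simps)
  then have "x ^ m \<le> (m * exp (x / m)) ^ m" using assms by (intro power_mono)
  also have "\<dots> = real m ^ m * exp x"
    using False by (simp add: power_mult_distrib exp_of_nat_mult[symmetric])
  finally show ?thesis .
qed (use assms in simp)

text \<open>The functions \<open>exp_inv_pow j\<close> span a space closed under differentiation.\<close>

definition exp_inv_pow :: "nat \<Rightarrow> real \<Rightarrow> real" where
  "exp_inv_pow j r = (if r > 0 then (1 / r) ^ j * exp (- (1 / r)) else 0)"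

lemma exp_inv_pow_nonneg: "0 \<le> exp_inv_pow j r"
  by (simp add: exp_inv_pow_def)

lemma exp_inv_pow_le: "exp_inv_pow j r \<le> real j ^ j"
proof (cases "r > 0")
  case True
  have "(1 / r) ^ j * exp (- (1 / r)) \<le> (real j ^ j * exp (1 / r)) * exp (- (1 / r))"
    using True by (intro mult_right_mono power_le_exp) auto
  also have "\<dots> = real j ^ j" by (simp add: exp_minus)
  finally show ?thesis using True by (simp add: exp_inv_pow_def)
qed (simp add: exp_inv_pow_def)

lemma exp_inv_pow_Suc: "exp_inv_pow j r = r * exp_inv_pow (Suc j) r"
  by (simp add: exp_inv_pow_def)

lemma DERIV_exp_inv_pow:
  "(exp_inv_pow j has_real_derivative exp_inv_pow (j + 2) r - real j * exp_inv_pow (Suc j) r) (at r)"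
proof -
  consider "r < 0" | "r = 0" | "r > 0" by linarith
  then show ?thesis
  proof cases
    case 1
    have "((\<lambda>r. 0) has_real_derivative exp_inv_pow (j + 2) r - real j * exp_inv_pow (Suc j) r) (at r)"
      using 1 by (simp add: exp_inv_pow_def)
    then show ?thesis
      by (rule has_field_derivative_transform_within_open[of _ _ _ "{..<0}"]) (use 1 in \<open>auto simp: exp_inv_pow_def\<close>)
  next
    case 2
    \<comment> \<open>At 0 the difference quotient of \<open>exp_inv_pow j\<close> is
      \<open>exp_inv_pow (Suc j)\<close> itself, which is h times a bounded function and so tends to
      0.\<close>
    have "((\<lambda>h. exp_inv_pow (Suc j) h) \<longlongrightarrow> 0) (at 0)"
    proof (rule Lim_null_comparison)
      show "\<forall>\<^sub>F h in at 0. norm (exp_inv_pow (Suc j) h) \<le> \<bar>h\<bar> * real (Suc (Suc j)) ^ Suc (Suc j)"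
        using exp_inv_pow_le[of "Suc (Suc j)"] exp_inv_pow_nonneg[of "Suc (Suc j)"]
        by (subst exp_inv_pow_Suc) (auto simp: abs_mult intro!: always_eventually mult_left_mono)
      show "((\<lambda>h. \<bar>h\<bar> * real (Suc (Suc j)) ^ Suc (Suc j)) \<longlongrightarrow> 0) (at 0)"
        by (intro tendsto_mult_left_zero tendsto_rabs_zero tendsto_ident_at)
    qed
    moreover have "\<forall>\<^sub>F h in at 0. exp_inv_pow (Suc j) h = (exp_inv_pow j h - exp_inv_pow j 0) / (h - 0)"
      by (subst exp_inv_pow_Suc[of j]) (auto simp: eventually_at_filter exp_inv_pow_def)
    ultimately have "((\<lambda>h. (exp_inv_pow j h - exp_inv_pow j 0) / (h - 0)) \<longlongrightarrow> 0) (at 0)"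
      using tendsto_cong by force
    then show ?thesis using 2 by (simp add: has_field_derivative_iff exp_inv_pow_def)
  next
    case 3
    have "((\<lambda>r. (1 / r) ^ j * exp (- (1 / r))) has_real_derivative
        (1 / r) ^ j * (exp (- (1 / r)) * (1 / r\<^sup>2)) + real j * ((1 / r) ^ (j - 1)) * (- (1 / r\<^sup>2)) * exp (- (1 / r))) (at r)"
      using 3 by (auto intro!: derivative_eq_intros simp: power2_eq_square)
    also have "(1 / r) ^ j * (exp (- (1 / r)) * (1 / r\<^sup>2)) + real j * ((1 / r) ^ (j - 1)) * (- (1 / r\<^sup>2)) * exp (- (1 / r)) =
       exp_inv_pow (j + 2) r - real j * exp_inv_pow (Suc j) r"
      using 3 by (cases j) (simp_all add: exp_inv_pow_def power2_eq_square power_divide field_simps)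
    finally show ?thesis
      by (rule has_field_derivative_transform_within_open[of _ _ _ "{0<..}"]) (use 3 in \<open>auto simp: exp_inv_pow_def\<close>)
  qed
qed

lemma has_derivative_norm_square:
  "((\<lambda>x. (norm x)\<^sup>2) has_derivative (\<lambda>h. 2 * (x \<bullet> h))) (at (x :: 'a::real_inner))"
  unfolding power2_norm_eq_inner
  by (auto intro!: derivative_eq_intros simp: inner_commute)

definition bump :: "real^'n::finite \<Rightarrow> real" where "bump x = exp_inv_pow 0 (1 - (norm x)\<^sup>2)"

lemma bump_schwartz: "(\<lambda>x::real^'n::finite. complex_of_real (bump x)) \<in> schwartz_space"
proof -
  define b :: "nat \<Rightarrow> real^'n \<Rightarrow> complex" where "b j x = complex_of_real (exp_inv_pow j (1 - (norm x)\<^sup>2))" for j x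
  have "poly_hull (range b) \<subseteq> schwartz_space"
  proof (rule poly_hull_schwartz)
    fix f assume "f \<in> range b"
    then obtain j where f: "f = b j" by blast
    have D: "(b j has_derivative (\<lambda>h. complex_of_real ((exp_inv_pow (j + 2) (1 - (norm x)\<^sup>2) - real j * exp_inv_pow (Suc j) (1 - (norm x)\<^sup>2)) * (- 2 * (x \<bullet> h))))) (at x)" for x
    proof -
      have "((\<lambda>x. 1 - (norm x)\<^sup>2) has_derivative (\<lambda>h. - 2 * (x \<bullet> h))) (at x)"
        by (rule has_derivative_eq_rhs, rule has_derivative_diff[OF has_derivative_const has_derivative_norm_square]) auto
      from has_derivative_compose[OF this DERIV_exp_inv_pow[THEN has_field_derivative_imp_has_derivative]]
      show ?thesis unfolding b_def[abs_def] by (intro has_derivative_of_real)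
    qed
    have "partial_deriv i (b j) = (\<lambda>x. complex_of_real (x $ i) * ((- 2) * b (j + 2) x + (2 * of_nat j) * b (Suc j) x))" for i
      by (rule ext, subst partial_deriv_eqI[OF D]) (simp add: inner_axis b_def algebra_simps)
    moreover have "(\<lambda>x. complex_of_real (x $ i) * ((- 2) * b (j + 2) x + (2 * of_nat j) * b (Suc j) x)) \<in> poly_hull (range b)" for i
      by (intro poly_hull.intros rangeI)
    ultimately show "(\<forall>x. f differentiable at x) \<and> (\<forall>i. partial_deriv i f \<in> poly_hull (range b))"
      unfolding f using differentiableI[OF D] by simp
    show "\<exists>C. \<forall>x. (1 + norm x) ^ k * norm (f x) \<le> C" for k
    proof (intro exI allI)
      fix x
      show "(1 + norm x) ^ k * norm (f x) \<le> 2 ^ k * real j ^ j"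
      proof (cases "norm x < 1")
        case True
        then show ?thesis unfolding f b_def
          using exp_inv_pow_le[of j] exp_inv_pow_nonneg[of j] by (intro mult_mono power_mono) auto
      next
        case False
        then have "(norm x)\<^sup>2 \<ge> 1" by simp
        then show ?thesis unfolding f b_def by (simp add: exp_inv_pow_def)
      qed
    qed
  qed
  moreover have "b 0 \<in> poly_hull (range b)" by (intro poly_hull.intros) simp
  ultimately show ?thesis by (auto simp: b_def[abs_def] bump_def)
qed

lemma bump_nonneg: "0 \<le> bump x"
  by (simp add: bump_def exp_inv_pow_nonneg)

lemma bump_eq_0_iff: "bump x = 0 \<longleftrightarrow> 1 \<le> norm x"
proof -
  have "1 - (norm x)\<^sup>2 > 0 \<longleftrightarrow> norm x < 1"
    by (simp add: power_less_one_iff abs_square_less_1)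
  then show ?thesis by (auto simp: bump_def exp_inv_pow_def)
qed

lemma emeasure_ball_pos: "r > 0 \<Longrightarrow> emeasure lborel (ball (c :: real^'n::finite) r) > 0"
  by (simp add: emeasure_ball ennreal_zero_less_mult_iff)

text \<open>The indicator of the ball of radius 2 is mollified by the normalised bump supported in
  the unit ball; this explains the radii 1 = 2 - 1 and 3 = 2 + 1.\<close>

lemma cutoff_exists:
  "\<exists>\<eta>::real^'n::finite \<Rightarrow> real. smooth (\<lambda>x. complex_of_real (\<eta> x)) \<and> (\<forall>x. 0 \<le> \<eta> x \<and> \<eta> x \<le> 1)
     \<and> (\<forall>x. norm x \<le> 1 \<longrightarrow> \<eta> x = 1) \<and> (\<forall>x. 3 \<le> norm x \<longrightarrow> \<eta> x = 0)"
proof -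
  let ?b = "\<lambda>x::real^'n. complex_of_real (bump x)"
  let ?w = "\<lambda>x::real^'n. complex_of_real (indicator (ball 0 2) x)"
  have ib: "integrable lborel (bump :: real^'n \<Rightarrow> real)"
    using schwartz_integrable[OF bump_schwartz] complex_of_real_integrable_eq by blast
  have [measurable]: "(bump :: real^'n \<Rightarrow> real) \<in> borel_measurable borel"
    using borel_measurable_integrable[OF ib] by simp
  define I where "I = (LINT x|lborel. bump (x::real^'n))"
  have "I \<noteq> 0"
  proof
    assume "I = 0"
    then have "AE x in lborel. bump (x::real^'n) = 0"
      unfolding I_def using integral_nonneg_eq_0_iff_AE[OF ib] bump_nonneg by auto
    then have "AE x in lborel. (x::real^'n) \<notin> ball 0 1" by eventually_elim (auto simp: bump_eq_0_iff)
    then have "emeasure lborel (ball (0 :: real^'n) 1) = 0"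
      by (rule AE_iff_measurable[THEN iffD1, rotated 2]) auto
    then show False using emeasure_ball_pos[of 1 "0 :: real^'n"] by simp
  qed
  moreover have "I \<ge> 0" unfolding I_def by (intro integral_nonneg_AE) (simp add: bump_nonneg)
  ultimately have I: "I > 0" by simp
  define J where "J x = (LINT z|lborel. indicator (ball 0 2) z * bump (x - z))" for x :: "real^'n"
  have ibx: "integrable lborel (\<lambda>z. bump (x - z))" "(LINT z|lborel. bump (x - z)) = I" for x :: "real^'n"
    using integrable_reflect[of bump x] integral_reflect[of bump x] ib by (auto simp: I_def)
  have iJ: "integrable lborel (\<lambda>z. indicator (ball 0 2) z * bump (x - z))" for x :: "real^'n"
    by (rule Bochner_Integration.integrable_bound[OF ibx(1)[of x]]) (auto simp: indicator_def)
  have w: "tempered_density ?w"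
    by (rule bounded_tempered_density[where B = 1]) (auto simp: indicator_def)
  have J: "conv ?w ?b x = complex_of_real (J x)" for x
    unfolding conv_def J_def by (simp flip: of_real_mult)
  show ?thesis
  proof (intro exI[of _ "\<lambda>x. J x / I"] conjI allI impI)
    have "smooth (\<lambda>x. (1 / complex_of_real I) * conv ?w ?b x)"
      by (intro smooth_bounded_linear[OF bounded_linear_mult_right] smooth_conv w bump_schwartz)
    then show "smooth (\<lambda>x. complex_of_real (J x / I))" by (simp add: J)
    fix x
    show "0 \<le> J x / I" unfolding J_def using I
      by (intro divide_nonneg_pos integral_nonneg_AE) (auto simp: bump_nonneg)
    have "J x \<le> I" unfolding J_def ibx(2)[of x, symmetric]
      by (intro integral_mono iJ ibx) (auto simp: indicator_def bump_nonneg)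
    then show "J x / I \<le> 1" using I by simp
    show "J x / I = 1" if x: "norm x \<le> 1"
    proof -
      have "indicator (ball 0 2) z * bump (x - z) = bump (x - z)" for z
      proof (cases "norm (x - z) < 1")
        case True
        then have "norm z < 2" using x norm_triangle_ineq4[of x "x - z"] by simp
        then show ?thesis by simp
      next
        case False
        then show ?thesis by (simp add: bump_eq_0_iff not_less)
      qed
      then have "J x = I" unfolding J_def by (simp only: ibx)
      then show ?thesis using I by simp
    qed
    show "J x / I = 0" if x: "3 \<le> norm x"
    proof -
      have "indicator (ball 0 2) z * bump (x - z) = 0" for z
      proof (cases "norm (x - z) < 1")
        case True
        then have "2 \<le> norm z" using x norm_triangle_sub[of x z] by simp
        then show ?thesis by simp
      next
        case False
        then show ?thesis by (simp add: bump_eq_0_iff not_less)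
      qed
      then have "J x = 0" unfolding J_def by (simp only: Bochner_Integration.integral_zero)
      then show ?thesis by simp
    qed
  qed
qed

section \<open>Rescaled cutoffs, with derivative bounds uniform in the scale\<close>

definition unit_cutoff :: "real^'n::finite \<Rightarrow> real" where
  "unit_cutoff = (SOME \<eta>. smooth (\<lambda>x. complex_of_real (\<eta> x)) \<and> (\<forall>x. 0 \<le> \<eta> x \<and> \<eta> x \<le> 1)
     \<and> (\<forall>x. norm x \<le> 1 \<longrightarrow> \<eta> x = 1) \<and> (\<forall>x. 3 \<le> norm x \<longrightarrow> \<eta> x = 0))"

lemma unit_cutoff:
  shows unit_cutoff_smooth: "smooth (\<lambda>x::real^'n::finite. complex_of_real (unit_cutoff x))"
    and unit_cutoff_range: "0 \<le> unit_cutoff (x::real^'n)" "unit_cutoff x \<le> 1"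
    and unit_cutoff_1: "norm x \<le> 1 \<Longrightarrow> unit_cutoff x = 1"
    and unit_cutoff_0: "3 \<le> norm x \<Longrightarrow> unit_cutoff x = 0"
  using someI_ex[OF cutoff_exists] unfolding unit_cutoff_def[symmetric] by auto

definition cutoff :: "real \<Rightarrow> real^'n::finite \<Rightarrow> real" where
  "cutoff r x = unit_cutoff ((1 / r) *\<^sub>R x)"

abbreviation ccutoff :: "real \<Rightarrow> real^'n::finite \<Rightarrow> complex" where
  "ccutoff r x \<equiv> complex_of_real (cutoff r x)"

lemma cutoff_range: "0 \<le> cutoff r x" "cutoff r x \<le> 1"
  by (simp_all add: cutoff_def unit_cutoff_range)

lemma cutoff_1: "r > 0 \<Longrightarrow> norm x \<le> r \<Longrightarrow> cutoff r x = 1"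
  unfolding cutoff_def by (rule unit_cutoff_1) (simp add: field_simps)

lemma cutoff_0: "r > 0 \<Longrightarrow> 3 * r \<le> norm x \<Longrightarrow> cutoff r x = 0"
  unfolding cutoff_def by (rule unit_cutoff_0) (simp add: field_simps)

lemma cutoff_smooth: "smooth (ccutoff r)"
  using smooth_affine[OF unit_cutoff_smooth, of "1 / r" 0] by (simp add: cutoff_def)

lemma cutoff_measurable [measurable]: "cutoff r \<in> borel_measurable borel"
  using measurable_compose[OF smooth_measurable[OF cutoff_smooth[of r]] borel_measurable_Re] by simp

lemma compact_closure_support:
  assumes "\<And>x :: 'a::euclidean_space. r \<le> norm (x - a) \<Longrightarrow> f x = 0"
  shows "compact (closure {x. f x \<noteq> 0})"
proof -
  have "{x. f x \<noteq> 0} \<subseteq> cball a r"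
    using assms by (auto simp: dist_norm norm_minus_commute) (metis linorder_linear)
  then have "bounded {x. f x \<noteq> 0}" using bounded_subset bounded_cball by blast
  then show ?thesis by (simp add: compact_closure)
qed

lemma cutoff_test: "r > 0 \<Longrightarrow> (\<lambda>x. ccutoff r (x - a)) \<in> test_functions"
  unfolding test_functions_def
  using smooth_sub_const[OF cutoff_smooth[of r], of a]
  by (intro CollectI conjI compact_closure_support[of "3 * r" a]) (auto simp: cutoff_0)

lemma cutoff_test0: "r > 0 \<Longrightarrow> ccutoff r \<in> test_functions"
  using cutoff_test[of r 0] by simp

text \<open>A derivative of order l scales like r^(-l), which is at most 1 for r \<ge> 1. Uniformity
  in r is what keeps truncated pairings under one fixed seminorm.\<close>

lemma cutoff_deriv_bound:
  "\<exists>A\<ge>0. \<forall>r\<ge>1. \<forall>is x. length is \<le> m \<longrightarrow> norm (iterated_partial is (ccutoff r :: real^'n::finite \<Rightarrow> complex) x) \<le> A"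
proof -
  have "(\<lambda>x::real^'n. complex_of_real (unit_cutoff x)) = ccutoff 1" by (simp add: cutoff_def)
  then have "(\<lambda>x::real^'n. complex_of_real (unit_cutoff x)) \<in> schwartz_space"
    using subsetD[OF test_functions_schwartz cutoff_test0[of 1]] by simp
  from schwartz_bound[OF this, of 0]
  have "\<exists>A. \<forall>x. norm (iterated_partial is (\<lambda>x::real^'n. complex_of_real (unit_cutoff x)) x) \<le> A" for "is" by auto
  from bounded_derivs_uniform[of _ m, OF this] obtain A where
    A: "\<And>is x. length is \<le> m \<Longrightarrow> norm (iterated_partial is (\<lambda>x::real^'n. complex_of_real (unit_cutoff x)) x) \<le> A" by blast
  have "A \<ge> 0" using order_trans[OF norm_ge_zero A[of "[]" 0]] by simp
  moreover have "norm (iterated_partial is (ccutoff r) (x::real^'n)) \<le> A" if r: "r \<ge> 1" and l: "length is \<le> m" for r "is" x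
  proof -
    have "iterated_partial is (ccutoff r) x = (1 / r) ^ length is *\<^sub>R iterated_partial is (\<lambda>x. complex_of_real (unit_cutoff x)) ((1 / r) *\<^sub>R x)"
      using iterated_partial_affine[OF unit_cutoff_smooth, of "is" "1 / r" 0] by (simp add: cutoff_def)
    also have "norm \<dots> = (1 / r) ^ length is * norm (iterated_partial is (\<lambda>x. complex_of_real (unit_cutoff x)) ((1 / r) *\<^sub>R x))"
      using r by simp
    also have "\<dots> \<le> 1 * A"
      using r by (intro mult_mono A l power_le_one) auto
    finally show ?thesis by simp
  qed
  ultimately show ?thesis by blast
qed

lemma iterated_partial_const: "is \<noteq> [] \<Longrightarrow> iterated_partial is (\<lambda>x. c) = (\<lambda>x. 0)"
  by (induction "is" rule: rev_induct) (simp_all add: iterated_partial_append partial_deriv_const iterated_partial_zero)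

lemma cocutoff_smooth: "smooth (\<lambda>x. 1 - ccutoff r x)"
  by (intro iterated_partial_diff smooth_const cutoff_smooth)

lemma cocutoff_deriv_bound:
  "\<exists>A\<ge>0. \<forall>r\<ge>1. \<forall>is x. length is \<le> m \<longrightarrow> norm (iterated_partial is (\<lambda>x :: real^'n::finite. 1 - ccutoff r x) x) \<le> A"
proof -
  obtain A where A: "A \<ge> 0" "\<forall>r\<ge>1. \<forall>is x. length is \<le> m \<longrightarrow> norm (iterated_partial is (ccutoff r :: real^'n::finite \<Rightarrow> complex) x) \<le> A"
    using cutoff_deriv_bound by blast
  have "norm (iterated_partial is (\<lambda>x :: real^'n::finite. 1 - ccutoff r x) x) \<le> 1 + A" if "r \<ge> 1" "length is \<le> m" for r "is" x
  proof -
    have "norm (iterated_partial is (\<lambda>x :: real^'n::finite. 1 :: complex) x) \<le> 1"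
      by (cases "is = []") (auto simp: iterated_partial_const)
    moreover have "norm (iterated_partial is (ccutoff r) x) \<le> A" using A that by blast
    ultimately show ?thesis
      unfolding iterated_partial_diff(2)[OF smooth_const cutoff_smooth]
      by (intro norm_triangle_le_diff add_mono)
  qed
  then show ?thesis using A(1) by (intro exI[of _ "1 + A"]) auto
qed

lemma cocutoff_deriv_zero:
  assumes "r > 0" "norm x < r"
  shows "iterated_partial is (\<lambda>x. 1 - ccutoff r x) x = 0"
proof -
  have "iterated_partial is (\<lambda>x. 1 - ccutoff r x) x = iterated_partial is (\<lambda>x. 0) x"
    by (rule iterated_partial_cong_open[OF cocutoff_smooth, of "ball 0 r"]) (use assms in \<open>auto simp: cutoff_1\<close>)
  then show ?thesis by (simp only: iterated_partial_zero)
qed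

text \<open>The fundamental lemma of the calculus of variations, tested with a cutoff concentrated
  where \<open>d\<close> stays close to its value at \<open>x0\<close>.\<close>

lemma test_integral_zero_imp_zero:
  fixes d :: "real^'n::finite \<Rightarrow> complex"
  assumes d: "continuous_on UNIV d" and z: "\<And>\<phi>. \<phi> \<in> test_functions \<Longrightarrow> (LINT x|lborel. d x * \<phi> x) = 0"
    and int: "\<And>\<phi>. \<phi> \<in> test_functions \<Longrightarrow> integrable lborel (\<lambda>x. d x * \<phi> x)"
  shows "d x0 = 0"
proof (rule ccontr)
  assume nz: "d x0 \<noteq> 0"
  \<comment> \<open>Multiplying by the conjugate of \<open>d x0\<close> rotates the value at
    \<open>x0\<close> onto the positive axis, so the real part is positive nearby.\<close>
  define q where "q x = Re (cnj (d x0) * d x)" for x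
  have "continuous_on UNIV q" unfolding q_def by (intro continuous_intros d)
  moreover have q0: "q x0 > 0" using nz by (simp add: q_def complex_neq_0 power2_eq_square[symmetric])
  ultimately obtain e where e: "e > 0" "\<And>x. x \<in> ball x0 e \<Longrightarrow> q x > 0"
    using continuous_on_open_vimage[of UNIV q] open_contains_ball[of "q -` {0<..}"]
    by (metis (no_types, lifting) Int_UNIV_right greaterThan_iff open_UNIV open_greaterThan subsetD vimage_eq)
  \<comment> \<open>The cutoff of scale r vanishes only from distance 3r on, hence the
    third.\<close>
  define r where "r = e / 3"
  have r: "r > 0" using e by (simp add: r_def)
  let ?c = "\<lambda>x. ccutoff r (x - x0)"
  have eq: "q x * cutoff r (x - x0) = Re (cnj (d x0) * (d x * ?c x))" for x
    by (simp add: q_def algebra_simps)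
  have i: "integrable lborel (\<lambda>x. cnj (d x0) * (d x * ?c x))"
    by (intro integrable_mult_right int cutoff_test r)
  have i': "integrable lborel (\<lambda>x. q x * cutoff r (x - x0))" unfolding eq by (rule integrable_Re[OF i])
  have "(LINT x|lborel. q x * cutoff r (x - x0)) = Re (LINT x|lborel. cnj (d x0) * (d x * ?c x))"
    unfolding eq by (rule integral_Re[OF i])
  also have "\<dots> = 0" by (simp add: z[OF cutoff_test[OF r]])
  finally have "(LINT x|lborel. q x * cutoff r (x - x0)) = 0" .
  moreover have nn: "0 \<le> q x * cutoff r (x - x0)" for x
  proof (cases "x \<in> ball x0 e")
    case True
    then show ?thesis using e cutoff_range(1)[of r "x - x0"] by (simp add: less_imp_le)
  next
    case False
    then have "cutoff r (x - x0) = 0" using r by (intro cutoff_0) (auto simp: r_def dist_norm norm_minus_commute)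
    then show ?thesis by simp
  qed
  ultimately have "AE x in lborel. q x * cutoff r (x - x0) = 0"
    using integral_nonneg_eq_0_iff_AE[OF i'] by auto
  then have "AE x in lborel. x \<notin> ball x0 r"
  proof eventually_elim
    case (elim x)
    show ?case
    proof
      assume x: "x \<in> ball x0 r"
      then have "cutoff r (x - x0) = 1" using r by (intro cutoff_1) (auto simp: dist_norm norm_minus_commute)
      moreover have "q x > 0" using x e r by (auto simp: r_def)
      ultimately show False using elim by simp
    qed
  qed
  then have "emeasure lborel (ball x0 r) = 0"
    by (rule AE_iff_measurable[THEN iffD1, rotated 2]) auto
  then show False using emeasure_ball_pos[OF r, of x0] by simp
qed

subsection \<open>The heat kernel\<close>

abbreviation heat :: "real \<Rightarrow> real^'n::finite \<Rightarrow> complex" where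
  "heat t x \<equiv> complex_of_real (heat_kernel t x)"

lemma heat_kernel_nonneg: "0 \<le> heat_kernel t x"
  by (simp add: heat_kernel_def)

lemma heat_kernel_minus: "heat_kernel t (x - y) = heat_kernel t (y - x)"
  by (simp add: heat_kernel_def norm_minus_commute)

lemma heat_kernel_measurable [measurable]: "heat_kernel t \<in> borel_measurable borel"
  unfolding heat_kernel_def[abs_def] by measurable

lemma heat_kernel_scale:
  fixes x :: "real^'n::finite"
  assumes "t > 0"
  shows "heat_kernel t x = t powr (- real CARD('n) / 2) * heat_kernel 1 ((1 / sqrt t) *\<^sub>R x)"
proof -
  have "(norm ((1 / sqrt t) *\<^sub>R x))\<^sup>2 = (norm x)\<^sup>2 / t"
    using assms by (simp add: power_mult_distrib power_divide)
  moreover have "(4 * pi * t) powr (- real CARD('n) / 2) = t powr (- real CARD('n) / 2) * (4 * pi) powr (- real CARD('n) / 2)"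
    using assms powr_mult[of "4 * pi" t "- real CARD('n) / 2"] by simp
  ultimately show ?thesis by (simp add: heat_kernel_def mult_ac)
qed

lemma heat1_schwartz: "(heat 1 :: real^'n::finite \<Rightarrow> complex) \<in> schwartz_space"
proof -
  define g where "g = (\<lambda>x::real^'n::finite. complex_of_real (exp (- (norm x)\<^sup>2 / 4)))"
  have "poly_hull {g} \<subseteq> schwartz_space"
  proof (rule poly_hull_schwartz)
    fix f assume "f \<in> {g}"
    then have f: "f = g" by blast
    have D: "(g has_derivative (\<lambda>h. complex_of_real (exp (- (norm x)\<^sup>2 / 4) * (- (x \<bullet> h) / 2)))) (at x)" for x
      unfolding g_def by (rule has_derivative_of_real, rule has_derivative_eq_rhs, rule has_derivative_exp,
          rule has_derivative_divide[OF has_derivative_minus[OF has_derivative_norm_square] has_derivative_const]) auto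
    have "partial_deriv i g = (\<lambda>x. complex_of_real (x $ i) * ((- 1 / 2) * g x))" for i
      by (rule ext, subst partial_deriv_eqI[OF D]) (simp add: inner_axis mult_ac g_def)
    moreover have "(\<lambda>x. complex_of_real (x $ i) * ((- 1 / 2) * g x)) \<in> poly_hull {g}" for i
      by (intro poly_hull.intros singletonI)
    ultimately show "(\<forall>x. f differentiable at x) \<and> (\<forall>i. partial_deriv i f \<in> poly_hull {g})"
      unfolding f using differentiableI[OF D] by (simp only: simp_thms)
    show "\<exists>C. \<forall>x. (1 + norm x) ^ k * norm (f x) \<le> C" for k
    proof (intro exI allI)
      fix x :: "real^'n"
      \<comment> \<open>The weight is turned into a power of 1 + |x|^2/4, whose exponential undoes
        the Gaussian up to the factor exp 1.\<close>
      have sq: "(1 + norm x) ^ 2 \<le> 8 * (1 + (norm x)\<^sup>2 / 4)"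
        using zero_le_power2[of "norm x - 1"] by (simp add: power2_eq_square algebra_simps)
      have "(1 + norm x) ^ k \<le> ((1 + norm x)\<^sup>2) ^ k"
        by (intro power_mono) (auto simp: power2_eq_square algebra_simps)
      also have "\<dots> \<le> (8 * (1 + (norm x)\<^sup>2 / 4)) ^ k" by (intro power_mono sq) simp
      also have "\<dots> = 8 ^ k * (1 + (norm x)\<^sup>2 / 4) ^ k" by (rule power_mult_distrib)
      also have "\<dots> \<le> 8 ^ k * (real k ^ k * exp (1 + (norm x)\<^sup>2 / 4))"
        by (intro mult_left_mono power_le_exp) auto
      finally have "(1 + norm x) ^ k * exp (- (norm x)\<^sup>2 / 4) \<le> 8 ^ k * (real k ^ k * exp (1 + (norm x)\<^sup>2 / 4)) * exp (- (norm x)\<^sup>2 / 4)"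
        by (rule mult_right_mono) simp
      also have "\<dots> = 8 ^ k * real k ^ k * (exp (1 + (norm x)\<^sup>2 / 4) * exp (- (norm x)\<^sup>2 / 4))"
        by (simp only: mult.assoc)
      also have "exp (1 + (norm x)\<^sup>2 / 4) * exp (- (norm x)\<^sup>2 / 4) = exp 1" by (simp flip: exp_add)
      finally show "(1 + norm x) ^ k * norm (f x) \<le> 8 ^ k * real k ^ k * exp 1" by (simp add: f g_def)
    qed
  qed
  moreover have "g \<in> poly_hull {g}" by (intro poly_hull.intros) simp
  ultimately have "g \<in> schwartz_space" by blast
  from schwartz_cmult[OF this, of "complex_of_real ((4 * pi) powr (- real CARD('n) / 2))"]
  show ?thesis by (simp add: heat_kernel_def g_def)
qed

lemma heat_scale:
  fixes x :: "real^'n::finite"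
  assumes "t > 0"
  shows "heat t x = complex_of_real (t powr (- real CARD('n) / 2)) * heat 1 ((1 / sqrt t) *\<^sub>R x + 0)"
  using heat_kernel_scale[OF assms, of x] by simp

lemma heat_schwartz: "t > 0 \<Longrightarrow> (heat t :: real^'n::finite \<Rightarrow> complex) \<in> schwartz_space"
  unfolding heat_scale by (intro schwartz_cmult schwartz_affine heat1_schwartz) simp

subsection \<open>Powers of the Laplacian\<close>

text \<open>This is -\<Delta> rather than \<Delta>: its symbol |\<xi>|^2 is nonnegative, and its
  powers carry no signs.\<close>

definition nlap :: "(real^'n::finite \<Rightarrow> complex) \<Rightarrow> real^'n \<Rightarrow> complex" where
  "nlap \<phi> x = (\<Sum>i\<in>UNIV. - iterated_partial [i, i] \<phi> x)"

lemma smooth_minus: "smooth f \<Longrightarrow> smooth (\<lambda>x. - f x)"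
  by (rule smooth_bounded_linear[OF bounded_linear_minus[OF bounded_linear_ident]])

lemma nlap_smooth: "smooth \<phi> \<Longrightarrow> smooth (nlap \<phi>)"
  unfolding nlap_def[abs_def] by (intro smooth_sum smooth_minus smooth_iterated_partial)

lemma nlap_pow_smooth: "smooth \<phi> \<Longrightarrow> smooth ((nlap ^^ k) \<phi>)"
  by (induction k) (auto intro: nlap_smooth)

lemma nlap_schwartz:
  assumes "\<phi> \<in> schwartz_space"
  shows "nlap \<phi> \<in> schwartz_space"
proof -
  have *: "(\<lambda>x. - iterated_partial [i, i] \<phi> x) \<in> schwartz_space" for i
    using schwartz_cmult[OF schwartz_iterated_partial[OF assms], of "-1" "[i, i]"] by simp
  show ?thesis unfolding nlap_def[abs_def] by (rule schwartz_sum) (rule *)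
qed

lemma nlap_pow_schwartz: "\<phi> \<in> schwartz_space \<Longrightarrow> (nlap ^^ k) \<phi> \<in> schwartz_space"
  by (induction k) (auto intro: nlap_schwartz)

lemma nlap_cmult:
  assumes "smooth f"
  shows "nlap (\<lambda>x. c * f x) = (\<lambda>x. c * nlap f x)"
  unfolding nlap_def[abs_def] iterated_partial_bounded_linear[OF bounded_linear_mult_right assms]
  by (simp add: sum_distrib_left)

lemma nlap_pow_cmult:
  assumes "smooth f"
  shows "(nlap ^^ k) (\<lambda>x. c * f x) = (\<lambda>x. c * (nlap ^^ k) f x)"
  by (induction k) (simp_all add: nlap_cmult nlap_pow_smooth assms)

lemma nlap_affine:
  assumes "smooth f"
  shows "nlap (\<lambda>x. f (c *\<^sub>R x + a)) = (\<lambda>x. complex_of_real (c\<^sup>2) * nlap f (c *\<^sub>R x + a))"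
  unfolding nlap_def[abs_def] iterated_partial_affine[OF assms]
  by (simp add: sum_distrib_left scaleR_conv_of_real power2_eq_square)

lemma nlap_pow_affine:
  assumes "smooth f"
  shows "(nlap ^^ k) (\<lambda>x. f (c *\<^sub>R x + a)) = (\<lambda>x. complex_of_real (c ^ (2 * k)) * (nlap ^^ k) f (c *\<^sub>R x + a))"
proof (induction k)
  case (Suc k)
  show ?case
    by (simp add: Suc nlap_cmult smooth_affine nlap_affine nlap_pow_smooth assms power_add[symmetric] mult_ac power2_eq_square)
qed simp

lemma iterated_partial_conv:
  assumes "tempered_density w" "\<phi> \<in> schwartz_space"
  shows "iterated_partial is (conv w \<phi>) = conv w (iterated_partial is \<phi>)"
  by (induction "is") (simp_all add: partial_deriv_conv assms schwartz_iterated_partial)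

lemma nlap_conv:
  assumes "tempered_density w" "\<phi> \<in> schwartz_space"
  shows "nlap (conv w \<phi>) = conv w (nlap \<phi>)"
proof
  fix x
  have i: "integrable lborel (\<lambda>z. w z * (- iterated_partial [j, j] \<phi> (x - z)))" for j
    using conv_integrable[OF assms(1) schwartz_cmult[OF schwartz_iterated_partial[OF assms(2)], of "-1" "[j, j]"], of x] by simp
  have "conv w (nlap \<phi>) x = (LINT z|lborel. (\<Sum>j\<in>UNIV. w z * (- iterated_partial [j, j] \<phi> (x - z))))"
    unfolding conv_def nlap_def sum_distrib_left ..
  also have "\<dots> = (\<Sum>j\<in>UNIV. (LINT z|lborel. w z * (- iterated_partial [j, j] \<phi> (x - z))))"
    by (rule Bochner_Integration.integral_sum) (rule i)
  also have "\<dots> = nlap (conv w \<phi>) x"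
    unfolding nlap_def iterated_partial_conv[OF assms] conv_def by simp
  finally show "nlap (conv w \<phi>) x = conv w (nlap \<phi>) x" ..
qed

lemma nlap_pow_conv:
  assumes "tempered_density w" "\<phi> \<in> schwartz_space"
  shows "(nlap ^^ k) (conv w \<phi>) = conv w ((nlap ^^ k) \<phi>)"
  by (induction k) (simp_all add: nlap_conv assms nlap_pow_schwartz)

lemma iterated_partial_nlap:
  assumes "smooth \<phi>"
  shows "iterated_partial js (nlap \<phi>) x = (\<Sum>i\<in>UNIV. - iterated_partial (js @ [i, i]) \<phi> x)"
proof -
  have *: "smooth (\<lambda>x. - iterated_partial [i, i] \<phi> x)" for i
    by (intro smooth_minus smooth_iterated_partial assms)
  have "iterated_partial js (nlap \<phi>) = (\<lambda>x. \<Sum>i\<in>UNIV. iterated_partial js (\<lambda>x. - iterated_partial [i, i] \<phi> x) x)"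
    unfolding nlap_def[abs_def] by (rule iterated_partial_sum[THEN conjunct2]) (rule *)
  then show ?thesis
    by (simp only: iterated_partial_bounded_linear[OF bounded_linear_minus[OF bounded_linear_ident] smooth_iterated_partial[OF assms]] iterated_partial_append)
qed

lemma nlap_pow_bound:
  fixes \<phi> :: "real^'n::finite \<Rightarrow> complex"
  assumes "smooth \<phi>" "\<And>is. length is \<le> 2 * k \<Longrightarrow> norm (iterated_partial is \<phi> x) \<le> B"
  shows "norm ((nlap ^^ k) \<phi> x) \<le> real CARD('n) ^ k * B"
  using assms
proof (induction k arbitrary: \<phi> B)
  case 0
  then show ?case using 0(2)[of "[]"] by simp
next
  case (Suc k)
  have "norm ((nlap ^^ k) (nlap \<phi>) x) \<le> real CARD('n) ^ k * (real CARD('n) * B)"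
  proof (rule Suc.IH[OF nlap_smooth[OF Suc.prems(1)]])
    fix js :: "'n list" assume "length js \<le> 2 * k"
    then have "norm (\<Sum>i\<in>UNIV. - iterated_partial (js @ [i, i]) \<phi> x) \<le> (\<Sum>i\<in>(UNIV :: 'n set). B)"
      by (intro sum_norm_le) (auto intro!: Suc.prems(2))
    then show "norm (iterated_partial js (nlap \<phi>) x) \<le> real CARD('n) * B"
      by (simp add: iterated_partial_nlap Suc.prems(1))
  qed
  then show ?case by (simp add: funpow_swap1 mult_ac)
qed

definition heat_lap :: "nat \<Rightarrow> real \<Rightarrow> real^'n::finite \<Rightarrow> complex" where
  "heat_lap k t = (nlap ^^ k) (heat t)"

lemma heat_lap_schwartz: "t > 0 \<Longrightarrow> heat_lap k t \<in> schwartz_space"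
  unfolding heat_lap_def by (intro nlap_pow_schwartz heat_schwartz)

text \<open>Parabolic scaling: two space derivatives cost one power of 1/t. It reduces L1 norms,
  far-field bounds and measurability in t to the kernel at time 1.\<close>

lemma heat_lap_scale:
  fixes x :: "real^'n::finite"
  assumes "t > 0"
  shows "heat_lap k t = (\<lambda>x :: real^'n. complex_of_real (t powr (- real CARD('n) / 2 - real k)) * heat_lap k 1 ((1 / sqrt t) *\<^sub>R x + 0))"
proof -
  note s = schwartz_smooth[OF heat1_schwartz]
  have "(1 / sqrt t) ^ (2 * k) = t powr (- real k)"
    using assms by (simp add: power_mult power_divide powr_minus powr_realpow divide_simps)
  then have c: "complex_of_real (t powr (- real CARD('n) / 2)) * complex_of_real ((1 / sqrt t) ^ (2 * k)) = complex_of_real (t powr (- real CARD('n) / 2 - real k))"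
    by (simp only: of_real_mult[symmetric] powr_add[symmetric] diff_conv_add_uminus)
  have "heat t = (\<lambda>x :: real^'n. complex_of_real (t powr (- real CARD('n) / 2)) * heat 1 ((1 / sqrt t) *\<^sub>R x + 0))"
    by (rule ext) (rule heat_scale[OF assms])
  then have "heat_lap k t = (nlap ^^ k) (\<lambda>x :: real^'n. complex_of_real (t powr (- real CARD('n) / 2)) * heat 1 ((1 / sqrt t) *\<^sub>R x + 0))"
    unfolding heat_lap_def by (rule arg_cong)
  also have "\<dots> = (\<lambda>x. complex_of_real (t powr (- real CARD('n) / 2)) * (nlap ^^ k) (\<lambda>x. heat 1 ((1 / sqrt t) *\<^sub>R x + 0)) x)"
    by (rule nlap_pow_cmult[OF smooth_affine[OF s]])
  also have "\<dots> = (\<lambda>x. complex_of_real (t powr (- real CARD('n) / 2 - real k)) * heat_lap k 1 ((1 / sqrt t) *\<^sub>R x + 0))"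
    by (simp only: nlap_pow_affine[OF s] mult.assoc[symmetric] c heat_lap_def)
  finally show ?thesis .
qed

lemma heat_lap_even: "t > 0 \<Longrightarrow> heat_lap k t (x - y) = heat_lap k t (y - x)"
proof -
  assume t: "t > 0"
  have "heat_lap k t = (nlap ^^ k) (\<lambda>x. heat t ((-1) *\<^sub>R x + 0))"
    unfolding heat_lap_def by (rule arg_cong[where f = "nlap ^^ k"]) (simp add: heat_kernel_def)
  also have "\<dots> = (\<lambda>x. complex_of_real ((-1) ^ (2 * k)) * (nlap ^^ k) (heat t) ((-1) *\<^sub>R x + 0))"
    by (rule nlap_pow_affine[OF schwartz_smooth[OF heat_schwartz[OF t]]])
  finally have "heat_lap k t (x - y) = complex_of_real ((-1) ^ (2 * k)) * (nlap ^^ k) (heat t) ((-1) *\<^sub>R (x - y) + 0)"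
    by (rule fun_cong)
  then show ?thesis by (simp add: heat_lap_def)
qed

text \<open>The Laplacians change factor without integration by parts: derivatives of a convolution
  may be put on either Schwartz factor, and convolution commutes.\<close>

lemma conv_heat_nlap:
  assumes "t > 0" "\<phi> \<in> schwartz_space"
  shows "conv (heat t) ((nlap ^^ k) \<phi>) = conv \<phi> (heat_lap k t)"
proof -
  note h = heat_schwartz[OF assms(1)]
  note d = moment_density_tempered[OF schwartz_moment_density]
  have "conv (heat t) ((nlap ^^ k) \<phi>) = (nlap ^^ k) (conv (heat t) \<phi>)"
    by (rule nlap_pow_conv[OF d[OF h] assms(2), symmetric])
  also have "conv (heat t) \<phi> = conv \<phi> (heat t)" by (intro conv_commute schwartz_measurable h assms)
  also have "(nlap ^^ k) (conv \<phi> (heat t)) = conv \<phi> (heat_lap k t)"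
    unfolding heat_lap_def by (rule nlap_pow_conv[OF d[OF assms(2)] h])
  finally show ?thesis .
qed

lemma heat_lap_L1:
  assumes "t > 0"
  shows "(LINT x|lborel. norm (heat_lap k t (x :: real^'n::finite))) = t powr (- real k) * (LINT x|lborel. norm (heat_lap k 1 (x :: real^'n)))"
proof -
  let ?n = "real CARD('n)"
  have m[measurable]: "heat_lap k 1 \<in> borel_measurable (borel :: (real^'n) measure)"
    by (rule schwartz_measurable[OF heat_lap_schwartz]) simp
  have "(LINT x|lborel. norm (heat_lap k t (x :: real^'n))) = (LINT x|lborel. t powr (- ?n / 2 - real k) * norm (heat_lap k 1 (0 + (1 / sqrt t) *\<^sub>R (x::real^'n))))"
    by (simp add: heat_lap_scale[OF assms] norm_mult)
  also have "\<dots> = t powr (- ?n / 2 - real k) * ((1 / \<bar>1 / sqrt t\<bar> ^ CARD('n)) * (LINT x|lborel. norm (heat_lap k 1 (x :: real^'n))))"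
    using assms by (subst integral_mult_right_zero, subst integral_affine) auto
  also have "1 / \<bar>1 / sqrt t\<bar> ^ CARD('n) = t powr (?n / 2)"
    using assms by (simp add: power_divide powr_half_sqrt[symmetric] powr_realpow[symmetric] powr_powr)
  also have "t powr (- ?n / 2 - real k) * (t powr (?n / 2) * (LINT x|lborel. norm (heat_lap k 1 (x :: real^'n)))) = t powr (- real k) * (LINT x|lborel. norm (heat_lap k 1 (x :: real^'n)))"
    by (simp flip: powr_add mult.assoc)
  finally show ?thesis .
qed

subsection \<open>Gaussian integrals\<close>

lemma gauss_fourier_1:
  fixes t x :: real
  assumes t: "t > 0"
  shows "integrable lborel (\<lambda>\<xi>. cis (- (x * \<xi>)) * complex_of_real (exp (- (t * \<xi>\<^sup>2))))"
    "(LINT \<xi>|lborel. cis (- (x * \<xi>)) * complex_of_real (exp (- (t * \<xi>\<^sup>2)))) = complex_of_real (sqrt (pi / t) * exp (- (x\<^sup>2 / (4 * t))))"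
proof -
  \<comment> \<open>The substitution y = sqrt (2 t) \<xi> turns the Gaussian into the standard
    normal density, whose characteristic function is known.\<close>
  define c where "c = sqrt (2 * t)"
  have c: "c > 0" "c\<^sup>2 = 2 * t" using t by (simp_all add: c_def)
  let ?f = "\<lambda>y. complex_of_real (std_normal_density y) * cis (- (x / c) * y)"
  have [measurable]: "(\<lambda>y. cis (- (x / c) * y)) \<in> borel_measurable borel"
    by (intro borel_measurable_continuous_onI continuous_intros)
  have m: "?f \<in> borel_measurable borel" by measurable
  have "integrable lborel ?f"
    by (rule Bochner_Integration.integrable_bound[OF integrable_normal_density[of 1 0]]) (use m in \<open>auto simp: norm_mult\<close>)
  have char: "(LINT y|lborel. ?f y) = complex_of_real (exp (- (x\<^sup>2 / (4 * t))))"
  proof -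
    have "(LINT y|lborel. ?f y) = char std_normal_distribution (- (x / c))"
      unfolding char_def by (subst integral_density) (auto simp: cis_conv_exp scaleR_conv_of_real mult_ac)
    also have "\<dots> = complex_of_real (exp (- (x\<^sup>2 / (4 * t))))"
      unfolding char_std_normal_distribution using c by (simp add: power_divide)
    finally show ?thesis .
  qed
  have eq: "?f (0 + c *\<^sub>R \<xi>) = complex_of_real (1 / sqrt (2 * pi)) * (cis (- (x * \<xi>)) * complex_of_real (exp (- (t * \<xi>\<^sup>2))))" for \<xi>
    using c by (simp add: std_normal_density_def power_mult_distrib)
  have nz: "complex_of_real (1 / sqrt (2 * pi)) \<noteq> 0" by simp
  show i: "integrable lborel (\<lambda>\<xi>. cis (- (x * \<xi>)) * complex_of_real (exp (- (t * \<xi>\<^sup>2))))"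
  proof -
    have "integrable lborel (\<lambda>\<xi>. complex_of_real (1 / sqrt (2 * pi)) * (cis (- (x * \<xi>)) * complex_of_real (exp (- (t * \<xi>\<^sup>2)))))"
      using integrable_affine[OF m, of c 0] \<open>integrable lborel ?f\<close> c unfolding eq by blast
    from integrable_mult_right[OF this, of "inverse (complex_of_real (1 / sqrt (2 * pi)))"] show ?thesis
      by (simp only: mult.assoc[symmetric] left_inverse[OF nz] mult_1_left)
  qed
  have "(LINT \<xi>|lborel. ?f (0 + c *\<^sub>R \<xi>)) = complex_of_real (1 / c * exp (- (x\<^sup>2 / (4 * t))))"
    using integral_affine[OF m, of c 0] c char by (simp add: scaleR_conv_of_real)
  then have "complex_of_real (1 / sqrt (2 * pi)) * (LINT \<xi>|lborel. cis (- (x * \<xi>)) * complex_of_real (exp (- (t * \<xi>\<^sup>2)))) = complex_of_real (1 / c * exp (- (x\<^sup>2 / (4 * t))))"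
    unfolding eq by (simp only: integral_mult_right_zero)
  then have "(LINT \<xi>|lborel. cis (- (x * \<xi>)) * complex_of_real (exp (- (t * \<xi>\<^sup>2)))) = complex_of_real (sqrt (2 * pi) * (1 / c * exp (- (x\<^sup>2 / (4 * t)))))"
    by (simp add: field_simps)
  also have "sqrt (2 * pi) * (1 / c * exp (- (x\<^sup>2 / (4 * t)))) = sqrt (pi / t) * exp (- (x\<^sup>2 / (4 * t)))"
    using t by (simp add: c_def real_sqrt_mult real_sqrt_divide)
  finally show "(LINT \<xi>|lborel. cis (- (x * \<xi>)) * complex_of_real (exp (- (t * \<xi>\<^sup>2)))) = complex_of_real (sqrt (pi / t) * exp (- (x\<^sup>2 / (4 * t))))" .
qed

lemma cis_sum: "finite I \<Longrightarrow> cis (sum f I) = (\<Prod>i\<in>I. cis (f i))"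
  by (induction rule: finite_induct) (auto simp: cis_mult[symmetric])

lemma norm_square_sum: "(norm (x :: real^'n::finite))\<^sup>2 = (\<Sum>i\<in>UNIV. (x $ i)\<^sup>2)"
  unfolding power2_norm_eq_inner inner_vec_def by (simp add: power2_eq_square)

text \<open>The character and the Gaussian both factor over the coordinates, which reduces the claim
  to dimension one.\<close>

lemma gauss_fourier:
  fixes x :: "real^'n::finite"
  assumes t: "t > 0"
  shows "integrable lborel (\<lambda>\<xi>. cis (- (x \<bullet> \<xi>)) * complex_of_real (exp (- (t * (norm \<xi>)\<^sup>2))))"
    "(LINT \<xi>|lborel. cis (- (x \<bullet> \<xi>)) * complex_of_real (exp (- (t * (norm \<xi>)\<^sup>2)))) = complex_of_real ((2 * pi) powr real CARD('n) * heat_kernel t x)"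
proof -
  have eq: "cis (- (x \<bullet> \<xi>)) * complex_of_real (exp (- (t * (norm \<xi>)\<^sup>2))) =
      (\<Prod>i\<in>UNIV. cis (- (x $ i * \<xi> $ i)) * complex_of_real (exp (- (t * (\<xi> $ i)\<^sup>2))))" for \<xi>
    unfolding prod.distrib by (simp add: norm_square_sum inner_vec_def cis_sum[symmetric] sum_negf
      exp_sum[symmetric] sum_distrib_left flip: of_real_prod)
  show "integrable lborel (\<lambda>\<xi>. cis (- (x \<bullet> \<xi>)) * complex_of_real (exp (- (t * (norm \<xi>)\<^sup>2))))"
    unfolding eq by (rule integrable_prod_component[OF gauss_fourier_1(1)[OF t]])
  have "(LINT \<xi>|lborel. cis (- (x \<bullet> \<xi>)) * complex_of_real (exp (- (t * (norm \<xi>)\<^sup>2)))) = (\<Prod>i\<in>UNIV. complex_of_real (sqrt (pi / t) * exp (- ((x $ i)\<^sup>2 / (4 * t)))))"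
    unfolding eq by (subst integral_prod_component[OF gauss_fourier_1(1)[OF t]]) (simp only: gauss_fourier_1(2)[OF t])
  also have "\<dots> = complex_of_real (sqrt (pi / t) ^ CARD('n) * exp (- ((norm x)\<^sup>2 / (4 * t))))"
    by (simp add: norm_square_sum exp_sum[symmetric] sum_negf[symmetric] sum_divide_distrib prod.distrib flip: of_real_prod)
  also have "sqrt (pi / t) ^ CARD('n) = (2 * pi) powr real CARD('n) * (4 * pi * t) powr (- real CARD('n) / 2)"
  proof -
    have "sqrt (pi / t) ^ CARD('n) = (pi / t) powr (real CARD('n) / 2)"
      using t by (simp add: powr_half_sqrt[symmetric] powr_realpow[symmetric] powr_powr)
    also have "\<dots> = (((2 * pi) * (2 * pi)) * (1 / (4 * pi * t))) powr (real CARD('n) / 2)"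
      by (rule arg_cong[where f = "\<lambda>z. z powr (real CARD('n) / 2)"]) (use t in \<open>simp add: field_simps\<close>)
    also have "\<dots> = ((2 * pi) powr (real CARD('n) / 2) * (2 * pi) powr (real CARD('n) / 2)) * (1 / (4 * pi * t)) powr (real CARD('n) / 2)"
      by (simp only: powr_mult)
    also have "(2 * pi) powr (real CARD('n) / 2) * (2 * pi) powr (real CARD('n) / 2) = (2 * pi) powr real CARD('n)"
      by (simp flip: powr_add)
    also have "(1 / (4 * pi * t)) powr (real CARD('n) / 2) = (4 * pi * t) powr (- real CARD('n) / 2)"
      using t by (simp add: powr_minus powr_divide inverse_eq_divide)
    finally show ?thesis .
  qed
  finally show "(LINT \<xi>|lborel. cis (- (x \<bullet> \<xi>)) * complex_of_real (exp (- (t * (norm \<xi>)\<^sup>2)))) = complex_of_real ((2 * pi) powr real CARD('n) * heat_kernel t x)"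
    by (simp add: heat_kernel_def)
qed

lemma heat_kernel_integrable: "t > 0 \<Longrightarrow> integrable lborel (heat_kernel t :: real^'n::finite \<Rightarrow> real)"
  using schwartz_integrable[OF heat_schwartz] complex_of_real_integrable_eq by blast

text \<open>The heat kernel is a multiple of the Gaussian with parameter 1/(4t), so its mass is the
  value of \<open>gauss_fourier\<close> at the origin for that parameter.\<close>

lemma heat_kernel_integral:
  assumes "t > 0"
  shows "(LINT x|lborel. heat_kernel t (x :: real^'n::finite)) = 1"
proof -
  have "complex_of_real (LINT x|lborel. exp (- ((1 / (4 * t)) * (norm (x :: real^'n))\<^sup>2))) = complex_of_real ((2 * pi) powr real CARD('n) * heat_kernel (1 / (4 * t)) (0 :: real^'n))"
    using gauss_fourier(2)[of "1 / (4 * t)" "0 :: real^'n"] assms by (simp flip: integral_complex_of_real)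
  then have "(LINT x|lborel. exp (- ((norm (x :: real^'n))\<^sup>2 / (4 * t)))) = (2 * pi) powr real CARD('n) * (pi / t) powr (- real CARD('n) / 2)"
    by (subst (asm) of_real_eq_iff) (simp add: heat_kernel_def)
  then have "(LINT x|lborel. heat_kernel t (x :: real^'n)) = (4 * pi * t) powr (- real CARD('n) / 2) * ((2 * pi) powr real CARD('n) * (pi / t) powr (- real CARD('n) / 2))"
    by (simp add: heat_kernel_def)
  also have "\<dots> = ((4 * pi * t) * (pi / t)) powr (- real CARD('n) / 2) * (2 * pi) powr real CARD('n)"
    using assms by (subst powr_mult) simp_all
  also have "(4 * pi * t) * (pi / t) = (2 * pi) powr 2" using assms by (simp add: power2_eq_square)
  also have "((2 * pi) powr 2) powr (- real CARD('n) / 2) = (2 * pi) powr (- real CARD('n))"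
    by (simp only: powr_powr) simp
  also have "(2 * pi) powr (- real CARD('n)) * (2 * pi) powr real CARD('n) = 1"
    by (simp only: powr_add[symmetric]) simp
  finally show ?thesis .
qed

text \<open>Completing the square in z: the product of the two Gaussians is
  \<open>heat_kernel (a + b) x\<close> times a heat kernel in z at time c = a b / (a + b), centred
  at a x / (a + b), and the latter has mass 1.\<close>

lemma conv_heat_heat:
  fixes a b :: real
  assumes "a > 0" "b > 0"
  shows "conv (heat a) (heat b) = (heat (a + b) :: real^'n::finite \<Rightarrow> complex)"
proof
  fix x :: "real^'n"
  define c where "c = a * b / (a + b)"
  have c: "c > 0" using assms by (simp add: c_def)
  have eq: "heat_kernel a z * heat_kernel b (x - z) = heat_kernel (a + b) x * heat_kernel c (z - (a / (a + b)) *\<^sub>R x)" for z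
  proof -
    have "- (norm z)\<^sup>2 / (4 * a) + - (norm (x - z))\<^sup>2 / (4 * b) = - (norm x)\<^sup>2 / (4 * (a + b)) + - (norm (z - (a / (a + b)) *\<^sub>R x))\<^sup>2 / (4 * c)"
    proof -
      have ab: "a + b \<noteq> 0" "a \<noteq> 0" "b \<noteq> 0" using assms by auto
      define p q r where "p = x \<bullet> x" and "q = x \<bullet> z" and "r = z \<bullet> z"
      have "(norm (x - z))\<^sup>2 = p - 2 * q + r" "(norm z)\<^sup>2 = r" "(norm x)\<^sup>2 = p"
        "(norm (z - (a / (a + b)) *\<^sub>R x))\<^sup>2 = r - 2 * (a / (a + b)) * q + (a / (a + b))\<^sup>2 * p"
        unfolding power2_norm_eq_inner p_def q_def r_def by (simp_all add: inner_simps inner_commute power2_eq_square algebra_simps)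
      note F = this
      show ?thesis unfolding F c_def using ab by (simp add: divide_simps) (simp add: power2_eq_square algebra_simps)
    qed
    then have E: "exp (- (norm z)\<^sup>2 / (4 * a)) * exp (- (norm (x - z))\<^sup>2 / (4 * b)) = exp (- (norm x)\<^sup>2 / (4 * (a + b))) * exp (- (norm (z - (a / (a + b)) *\<^sub>R x))\<^sup>2 / (4 * c))"
      by (simp only: exp_add[symmetric])
    have "(4 * pi * a) powr (- real CARD('n) / 2) * (4 * pi * b) powr (- real CARD('n) / 2) = ((4 * pi * a) * (4 * pi * b)) powr (- real CARD('n) / 2)"
      by (rule powr_mult[symmetric])
    also have "(4 * pi * a) * (4 * pi * b) = (4 * pi * (a + b)) * (4 * pi * c)" using assms by (simp add: c_def)
    also have "\<dots> powr (- real CARD('n) / 2) = (4 * pi * (a + b)) powr (- real CARD('n) / 2) * (4 * pi * c) powr (- real CARD('n) / 2)"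
      by (rule powr_mult)
    finally have P: "(4 * pi * a) powr (- real CARD('n) / 2) * (4 * pi * b) powr (- real CARD('n) / 2) = (4 * pi * (a + b)) powr (- real CARD('n) / 2) * (4 * pi * c) powr (- real CARD('n) / 2)" .
    show ?thesis unfolding heat_kernel_def using arg_cong2[where f = "(*)", OF P E] by (simp only: mult_ac)
  qed
  have "conv (heat a) (heat b) x = complex_of_real (LINT z|lborel. heat_kernel a z * heat_kernel b (x - z))"
    unfolding conv_def by (simp flip: integral_complex_of_real)
  also have "\<dots> = complex_of_real (heat_kernel (a + b) x)"
    unfolding eq integral_mult_right_zero by (subst integral_translate) (simp_all add: heat_kernel_integral[OF c])
  finally show "conv (heat a) (heat b) x = heat (a + b) x" .
qed

lemma heat_lap_semigroup:
  assumes "a > 0" "b > 0"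
  shows "conv (heat a) (heat_lap k b) = heat_lap k (a + b)"
  unfolding heat_lap_def conv_heat_heat[OF assms, symmetric]
  by (intro nlap_pow_conv[symmetric] heat_schwartz assms moment_density_tempered schwartz_moment_density)

subsection \<open>Tempered distributions given by a smooth function\<close>

lemma fubini_swap:
  fixes F :: "'a::euclidean_space \<Rightarrow> 'b::euclidean_space \<Rightarrow> complex"
  assumes m: "(\<lambda>(x, y). F x y) \<in> borel_measurable (lborel \<Otimes>\<^sub>M lborel)"
    and i: "AE x in lborel. integrable lborel (F x)"
    and n: "integrable lborel (\<lambda>x. LINT y|lborel. norm (F x y))"
  shows "(LINT x|lborel. (LINT y|lborel. F x y)) = (LINT y|lborel. (LINT x|lborel. F x y))"
    "integrable lborel (\<lambda>x. LINT y|lborel. F x y)" "integrable lborel (\<lambda>y. LINT x|lborel. F x y)"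
proof -
  have "integrable (lborel \<Otimes>\<^sub>M lborel) (\<lambda>(x, y). F x y)"
    by (rule lborel_pair.Fubini_integrable[OF m]) (use i n in auto)
  then show "(LINT x|lborel. (LINT y|lborel. F x y)) = (LINT y|lborel. (LINT x|lborel. F x y))"
    "integrable lborel (\<lambda>x. LINT y|lborel. F x y)" "integrable lborel (\<lambda>y. LINT x|lborel. F x y)"
    using lborel_pair.Fubini_integral lborel_pair.integrable_fst lborel_pair.integrable_snd by (metis, fastforce, fastforce)
qed

lemma fubini_product_bound:
  fixes F :: "'a::euclidean_space \<Rightarrow> 'b::euclidean_space \<Rightarrow> complex" and a b :: "_ \<Rightarrow> real"
  assumes m: "(\<lambda>(x, y). F x y) \<in> borel_measurable (lborel \<Otimes>\<^sub>M lborel)"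
    and a: "integrable lborel a" and b: "integrable lborel b" and ab: "\<And>x y. norm (F x y) \<le> a x * b y"
  shows "(LINT x|lborel. (LINT y|lborel. F x y)) = (LINT y|lborel. (LINT x|lborel. F x y))"
    "integrable lborel (\<lambda>x. LINT y|lborel. F x y)" "integrable lborel (\<lambda>y. LINT x|lborel. F x y)"
proof -
  have [measurable]: "(\<lambda>(x, y). F x y) \<in> borel_measurable (borel \<Otimes>\<^sub>M borel)"
    using m by (simp cong: measurable_cong_sets)
  have i: "integrable lborel (F x)" for x
  proof (rule Bochner_Integration.integrable_bound[OF integrable_mult_right[OF b, of "a x"]])
    show "AE y in lborel. norm (F x y) \<le> norm (a x * b y)"
      using ab[of x] by (intro AE_I2) (metis abs_ge_self order_trans real_norm_def)
  qed measurable
  have n: "integrable lborel (\<lambda>x. LINT y|lborel. norm (F x y))"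
  proof (rule Bochner_Integration.integrable_bound[OF integrable_mult_left[OF a, of "LINT y|lborel. b y"]])
    show "AE x in lborel. norm (LINT y|lborel. norm (F x y)) \<le> norm (a x * (LINT y|lborel. b y))"
    proof (rule AE_I2)
      fix x
      have "norm (LINT y|lborel. norm (F x y)) \<le> (LINT y|lborel. a x * b y)"
        by (rule norm_integral_le_AE) (use ab b in auto)
      then show "norm (LINT y|lborel. norm (F x y)) \<le> norm (a x * (LINT y|lborel. b y))" by simp
    qed
  qed measurable
  show "(LINT x|lborel. (LINT y|lborel. F x y)) = (LINT y|lborel. (LINT x|lborel. F x y))"
    "integrable lborel (\<lambda>x. LINT y|lborel. F x y)" "integrable lborel (\<lambda>y. LINT x|lborel. F x y)"
    using fubini_swap[OF m _ n] i by auto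
qed

text \<open>A multiplier vanishing on the ball of radius r only sees points where l extra powers of
  the weight are worth at least (1 + r)^l. With r = l = 0 this is plain continuity of
  multiplication; with a complementary cutoff it makes tails small.\<close>

lemma schwartz_seminorm_mult:
  fixes \<phi> :: "real^'n::finite \<Rightarrow> complex"
  assumes \<phi>: "\<phi> \<in> schwartz_space" and a: "smooth a"
    and A: "\<And>is x. length is \<le> m \<Longrightarrow> norm (iterated_partial is a x) \<le> A"
    and z: "\<And>is x. length is \<le> m \<Longrightarrow> norm x < r \<Longrightarrow> iterated_partial is a x = 0" and r: "r \<ge> 0"
  shows "schwartz_seminorm k m (\<lambda>x. a x * \<phi> x) \<le> 2 ^ m * A / (1 + r) ^ l * schwartz_seminorm (k + l) m \<phi>"
proof (rule schwartz_seminorm_least)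
  fix js :: "'n list" and x :: "real^'n" assume l: "length js \<le> m"
  have "A \<ge> 0" using order_trans[OF norm_ge_zero A[of "[]" 0]] by simp
  let ?p = "schwartz_seminorm (k + l) m \<phi>"
  have p: "?p \<ge> 0" by (rule schwartz_seminorm_nonneg[OF \<phi>])
  have pos: "(1 + norm x) ^ j > 0" "(1 + r) ^ j > 0" for j using r by (simp_all add: add_pos_nonneg)
  have B: "norm (iterated_partial ks \<phi> x) \<le> ?p / (1 + norm x) ^ (k + l)" if "length ks \<le> length js" for ks
    using schwartz_seminorm_upper[OF \<phi>, of ks m x "k + l"] that l pos by (simp add: pos_le_divide_eq mult.commute)
  show "(1 + norm x) ^ k * norm (iterated_partial js (\<lambda>x. a x * \<phi> x) x) \<le> 2 ^ m * A / (1 + r) ^ l * ?p"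
  proof (cases "norm x < r")
    case True
    have "norm (iterated_partial js (\<lambda>x. a x * \<phi> x) x) \<le> 2 ^ length js * (0 * (?p / (1 + norm x) ^ (k + l)))"
      by (rule iterated_partial_mult_bound[OF a schwartz_smooth[OF \<phi>]]) (use z True l B in auto)
    then show ?thesis using \<open>A \<ge> 0\<close> p pos(2)[of l] by (simp add: less_imp_le)
  next
    case False
    have "norm (iterated_partial js (\<lambda>x. a x * \<phi> x) x) \<le> 2 ^ length js * (A * (?p / (1 + norm x) ^ (k + l)))"
      by (rule iterated_partial_mult_bound[OF a schwartz_smooth[OF \<phi>]]) (use A l B in auto)
    also have "\<dots> \<le> 2 ^ m * (A * (?p / (1 + norm x) ^ (k + l)))"
      using l p \<open>A \<ge> 0\<close> pos by (intro mult_right_mono) (auto intro!: mult_nonneg_nonneg divide_nonneg_pos)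
    finally have "(1 + norm x) ^ k * norm (iterated_partial js (\<lambda>x. a x * \<phi> x) x) \<le> (1 + norm x) ^ k * (2 ^ m * (A * (?p / (1 + norm x) ^ (k + l))))"
      by (rule mult_left_mono) (use pos in \<open>simp add: less_imp_le\<close>)
    also have "\<dots> = (2 ^ m * A * ?p) / (1 + norm x) ^ l"
    proof -
      have "1 + norm x \<noteq> 0" using norm_ge_zero[of x] by linarith
      then show ?thesis by (simp add: power_add divide_simps)
    qed
    also have "\<dots> \<le> (2 ^ m * A * ?p) / (1 + r) ^ l"
      using False r p \<open>A \<ge> 0\<close> pos by (intro divide_left_mono power_mono mult_nonneg_nonneg mult_pos_pos) auto
    finally show ?thesis by simp
  qed
qed

lemma schwartz_cutoff_mult: "\<phi> \<in> schwartz_space \<Longrightarrow> r > 0 \<Longrightarrow> (\<lambda>x. ccutoff r x * \<phi> x) \<in> test_functions"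
  by (rule test_function_mult(2)[OF schwartz_smooth cutoff_test0])

text \<open>The link between \<open>u\<close> and \<open>f\<close> holds on test functions only.
  Since \<open>f\<close> carries no growth condition, its integral against a Schwartz function may
  diverge, and every use of \<open>f\<close> goes through a cutoff.\<close>

locale smooth_tempered =
  fixes u :: "'n::finite distribution" and f :: "real^'n \<Rightarrow> complex"
  assumes tempered: "tempered u" and smooth_f: "smooth f" and rep: "represents u f"
begin

lemma u_add: "\<phi> \<in> schwartz_space \<Longrightarrow> \<psi> \<in> schwartz_space \<Longrightarrow> u (\<lambda>x. \<phi> x + \<psi> x) = u \<phi> + u \<psi>"
  using tempered by (simp add: tempered_def)

lemma u_cmult: "\<phi> \<in> schwartz_space \<Longrightarrow> u (\<lambda>x. c * \<phi> x) = c * u \<phi>"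
  using tempered by (simp add: tempered_def)

lemma u_bound: "\<exists>C\<ge>0. \<exists>k m. \<forall>\<phi>\<in>schwartz_space. norm (u \<phi>) \<le> C * schwartz_seminorm k m \<phi>"
proof -
  obtain C k m where C: "\<forall>\<phi>\<in>schwartz_space. norm (u \<phi>) \<le> C * schwartz_seminorm k m \<phi>"
    using tempered by (auto simp: tempered_def)
  have "norm (u \<phi>) \<le> \<bar>C\<bar> * schwartz_seminorm k m \<phi>" if "\<phi> \<in> schwartz_space" for \<phi>
    using C[rule_format, OF that] mult_right_mono[OF abs_ge_self[of C] schwartz_seminorm_nonneg[OF that, of k m]] by linarith
  then show ?thesis by (intro exI[of _ "\<bar>C\<bar>"]) auto
qed

lemma u_test: "\<phi> \<in> test_functions \<Longrightarrow> u \<phi> = (LINT x|lborel. f x * \<phi> x)"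
  using rep by (simp add: represents_def)

lemma f_measurable [measurable]: "f \<in> borel_measurable borel"
  by (rule smooth_measurable[OF smooth_f])

lemma f_test_integrable: "\<phi> \<in> test_functions \<Longrightarrow> integrable lborel (\<lambda>x. f x * \<phi> x)"
  using test_function_mult(1)[OF smooth_f] test_functions_schwartz schwartz_integrable by blast

lemma cutoff_split:
  assumes \<phi>: "\<phi> \<in> schwartz_space" and r: "r \<ge> 1"
  shows "(\<lambda>x. (1 - ccutoff r x) * \<phi> x) \<in> schwartz_space"
    "u \<phi> = u (\<lambda>x. ccutoff r x * \<phi> x) + u (\<lambda>x. (1 - ccutoff r x) * \<phi> x)"
proof -
  have c: "(\<lambda>x. ccutoff r x * \<phi> x) \<in> schwartz_space"
    using schwartz_cutoff_mult[OF \<phi>, of r] r test_functions_schwartz by auto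
  from schwartz_diff[OF \<phi> c] show s: "(\<lambda>x. (1 - ccutoff r x) * \<phi> x) \<in> schwartz_space"
    by (simp add: algebra_simps)
  from u_add[OF c s] show "u \<phi> = u (\<lambda>x. ccutoff r x * \<phi> x) + u (\<lambda>x. (1 - ccutoff r x) * \<phi> x)"
    by (simp add: algebra_simps)
qed

text \<open>The discarded tail is controlled by continuity of \<open>u\<close>: one extra power of
  the weight (l = 1 in \<open>schwartz_seminorm_mult\<close>) yields the rate 1/(1 + r).\<close>

lemma u_cutoff_tendsto:
  assumes \<phi>: "\<phi> \<in> schwartz_space"
  shows "(\<lambda>j. LINT x|lborel. f x * (ccutoff (real (Suc j)) x * \<phi> x)) \<longlonglongrightarrow> u \<phi>"
proof -
  obtain C k m where C: "C \<ge> 0" "\<forall>\<phi>\<in>schwartz_space. norm (u \<phi>) \<le> C * schwartz_seminorm k m \<phi>" using u_bound by blast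
  obtain A where A: "A \<ge> 0" "\<forall>r\<ge>1. \<forall>is x. length is \<le> m \<longrightarrow> norm (iterated_partial is (\<lambda>x :: real^'n. 1 - ccutoff r x) x) \<le> A"
    using cocutoff_deriv_bound by blast
  define D where "D = C * (2 ^ m * A * schwartz_seminorm (k + 1) m \<phi>)"
  have eq: "(LINT x|lborel. f x * (ccutoff (real (Suc j)) x * \<phi> x)) = u (\<lambda>x. ccutoff (real (Suc j)) x * \<phi> x)" for j
    by (rule u_test[symmetric]) (rule schwartz_cutoff_mult[OF \<phi>], simp)
  have "norm (u (\<lambda>x. ccutoff (real (Suc j)) x * \<phi> x) - u \<phi>) \<le> D * inverse (real (Suc j))" for j
  proof -
    let ?r = "real (Suc j)"
    have "norm (u (\<lambda>x. ccutoff ?r x * \<phi> x) - u \<phi>) = norm (u (\<lambda>x. (1 - ccutoff ?r x) * \<phi> x))"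
      using cutoff_split(2)[OF \<phi>, of ?r] by (simp add: norm_minus_commute)
    also have "\<dots> \<le> C * schwartz_seminorm k m (\<lambda>x. (1 - ccutoff ?r x) * \<phi> x)"
      using C cutoff_split(1)[OF \<phi>, of ?r] by simp
    also have "\<dots> \<le> C * (2 ^ m * A / (1 + ?r) ^ 1 * schwartz_seminorm (k + 1) m \<phi>)"
      by (intro mult_left_mono C schwartz_seminorm_mult \<phi> cocutoff_smooth) (use A in \<open>auto intro: cocutoff_deriv_zero\<close>)
    also have "\<dots> = D * inverse (1 + ?r)" by (simp add: D_def divide_inverse)
    also have "\<dots> \<le> D * inverse ?r"
      using C A schwartz_seminorm_nonneg[OF \<phi>] by (intro mult_left_mono) (auto simp: D_def)
    finally show ?thesis .
  qed
  note bnd = this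
  have null: "(\<lambda>j. D * inverse (real (Suc j))) \<longlonglongrightarrow> 0"
    by (rule tendsto_mult_right_zero[OF LIMSEQ_inverse_real_of_nat])
  have "(\<lambda>j. u (\<lambda>x. ccutoff (real (Suc j)) x * \<phi> x) - u \<phi>) \<longlonglongrightarrow> 0"
    by (rule Lim_null_comparison[OF always_eventually[OF allI[OF bnd]] null])
  then show ?thesis unfolding eq by (simp add: LIM_zero_iff)
qed

text \<open>One and the same seminorm bounds \<open>u\<close> and all its truncations; this
  uniformity in j supplies the majorants for dominated convergence.\<close>

lemma u_cutoff_bound:
  "\<exists>C\<ge>0. \<exists>k m. \<forall>\<phi>\<in>schwartz_space. norm (u \<phi>) \<le> C * schwartz_seminorm k m \<phi> \<and>
     (\<forall>j. norm (LINT x|lborel. f x * (ccutoff (real (Suc j)) x * \<phi> x)) \<le> C * schwartz_seminorm k m \<phi>)"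
proof -
  obtain C k m where C: "C \<ge> 0" "\<forall>\<phi>\<in>schwartz_space. norm (u \<phi>) \<le> C * schwartz_seminorm k m \<phi>" using u_bound by blast
  obtain A where A: "A \<ge> 0" "\<forall>r\<ge>1. \<forall>is x. length is \<le> m \<longrightarrow> norm (iterated_partial is (ccutoff r :: real^'n \<Rightarrow> complex) x) \<le> A"
    using cutoff_deriv_bound by blast
  define D where "D = C + C * (2 ^ m * A)"
  have "norm (u \<phi>) \<le> D * schwartz_seminorm k m \<phi> \<and>
     (\<forall>j. norm (LINT x|lborel. f x * (ccutoff (real (Suc j)) x * \<phi> x)) \<le> D * schwartz_seminorm k m \<phi>)"
    if \<phi>: "\<phi> \<in> schwartz_space" for \<phi>
  proof (intro conjI allI)
    have p: "0 \<le> schwartz_seminorm k m \<phi>" by (rule schwartz_seminorm_nonneg[OF \<phi>])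
    have "norm (u \<phi>) \<le> C * schwartz_seminorm k m \<phi>" using C \<phi> by blast
    also have "\<dots> \<le> D * schwartz_seminorm k m \<phi>" using p C A by (intro mult_right_mono) (auto simp: D_def)
    finally show "norm (u \<phi>) \<le> D * schwartz_seminorm k m \<phi>" .
    fix j
    let ?r = "real (Suc j)"
    have t: "(\<lambda>x. ccutoff ?r x * \<phi> x) \<in> test_functions" by (rule schwartz_cutoff_mult[OF \<phi>]) simp
    have "norm (LINT x|lborel. f x * (ccutoff ?r x * \<phi> x)) = norm (u (\<lambda>x. ccutoff ?r x * \<phi> x))"
      by (simp only: u_test[OF t])
    also have "\<dots> \<le> C * schwartz_seminorm k m (\<lambda>x. ccutoff ?r x * \<phi> x)"
      using C t test_functions_schwartz by blast
    also have "\<dots> \<le> C * (2 ^ m * A / (1 + 0) ^ 0 * schwartz_seminorm (k + 0) m \<phi>)"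
      by (intro mult_left_mono C schwartz_seminorm_mult \<phi> cutoff_smooth) (use A in auto)
    also have "\<dots> \<le> D * schwartz_seminorm k m \<phi>" using p C by (simp add: D_def algebra_simps)
    finally show "norm (LINT x|lborel. f x * (ccutoff ?r x * \<phi> x)) \<le> D * schwartz_seminorm k m \<phi>" .
  qed
  moreover have "D \<ge> 0" using C A by (simp add: D_def)
  ultimately show ?thesis by blast
qed

text \<open>The convolution of \<open>u\<close> with the reflection of \<psi>. For the heat kernel
  and its Laplacians, which are even, it is the convolution with \<psi> itself.\<close>

definition shift_eval :: "(real^'n \<Rightarrow> complex) \<Rightarrow> real^'n \<Rightarrow> complex" where
  "shift_eval \<psi> z = u (\<lambda>x. \<psi> (x - z))"

lemma shift_eval_tendsto:
  "\<psi> \<in> schwartz_space \<Longrightarrow> (\<lambda>j. LINT x|lborel. f x * (ccutoff (real (Suc j)) x * \<psi> (x - z))) \<longlonglongrightarrow> shift_eval \<psi> z"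
  unfolding shift_eval_def by (rule u_cutoff_tendsto[OF schwartz_translate])

lemma cutoff_eval_measurable:
  assumes \<psi>: "\<psi> \<in> schwartz_space"
  shows "(\<lambda>z. LINT x|lborel. f x * (ccutoff r x * \<psi> (x - z))) \<in> borel_measurable borel"
proof -
  have [measurable]: "\<psi> \<in> borel_measurable borel" by (rule schwartz_measurable[OF \<psi>])
  show ?thesis by (rule lborel.borel_measurable_lebesgue_integral) measurable
qed

text \<open>Measurability in z is not visible from an abstract functional; it is inherited from the
  truncations, which are parameter integrals.\<close>

lemma shift_eval_measurable [measurable]:
  "\<psi> \<in> schwartz_space \<Longrightarrow> shift_eval \<psi> \<in> borel_measurable borel"
  by (rule borel_measurable_LIMSEQ_metric[OF cutoff_eval_measurable shift_eval_tendsto]) auto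

text \<open>Translating by z inflates the weight of the continuity seminorm by at most (1 + |z|)^k,
  hence polynomial growth, again uniformly over the truncations.\<close>

lemma shift_eval_bound:
  assumes \<psi>: "\<psi> \<in> schwartz_space"
  shows "\<exists>C\<ge>0. \<exists>k. \<forall>z. norm (shift_eval \<psi> z) \<le> C * (1 + norm z) ^ k \<and>
    (\<forall>j. norm (LINT x|lborel. f x * (ccutoff (real (Suc j)) x * \<psi> (x - z))) \<le> C * (1 + norm z) ^ k)"
proof -
  obtain C k m where C: "C \<ge> 0" "\<forall>\<phi>\<in>schwartz_space. norm (u \<phi>) \<le> C * schwartz_seminorm k m \<phi> \<and>
     (\<forall>j. norm (LINT x|lborel. f x * (ccutoff (real (Suc j)) x * \<phi> x)) \<le> C * schwartz_seminorm k m \<phi>)"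
    using u_cutoff_bound by blast
  define D where "D = C * schwartz_seminorm k m \<psi>"
  have "C * schwartz_seminorm k m (\<lambda>x. \<psi> (x - z)) \<le> D * (1 + norm z) ^ k" for z
    using mult_left_mono[OF schwartz_seminorm_translate[OF \<psi>, of k m z] C(1)] by (simp add: D_def mult_ac)
  then have "\<forall>z. norm (shift_eval \<psi> z) \<le> D * (1 + norm z) ^ k \<and>
    (\<forall>j. norm (LINT x|lborel. f x * (ccutoff (real (Suc j)) x * \<psi> (x - z))) \<le> D * (1 + norm z) ^ k)"
    using C(2)[rule_format, OF schwartz_translate[OF \<psi>]] order_trans unfolding shift_eval_def by meson
  moreover have "D \<ge> 0" using C schwartz_seminorm_nonneg[OF \<psi>] by (simp add: D_def)
  ultimately show ?thesis by blast
qed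

text \<open>Cut off by \<open>ccutoff\<close>, \<open>u\<close> is integration against \<open>f\<close>, so it passes under the integral by
  Fubini; the cutoff is removed by dominated convergence, with the majorant from the seminorm
  bound of \<open>u\<close>. No integration theory in the Schwartz space is needed.\<close>

lemma u_conv:
  assumes w: "moment_density w" and \<psi>: "\<psi> \<in> schwartz_space"
  shows "integrable lborel (\<lambda>z. w z * shift_eval \<psi> z)" "u (conv w \<psi>) = (LINT z|lborel. w z * shift_eval \<psi> z)"
proof -
  obtain C k where C: "C \<ge> 0" "\<And>z. norm (shift_eval \<psi> z) \<le> C * (1 + norm z) ^ k"
    "\<And>z j. norm (LINT x|lborel. f x * (ccutoff (real (Suc j)) x * \<psi> (x - z))) \<le> C * (1 + norm z) ^ k"
    using shift_eval_bound[OF \<psi>] by blast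
  have [measurable]: "w \<in> borel_measurable borel" "\<psi> \<in> borel_measurable borel" "shift_eval \<psi> \<in> borel_measurable borel"
    using w \<psi> by (auto simp: moment_density_def schwartz_measurable shift_eval_measurable)
  have W: "integrable lborel (\<lambda>z. C * ((1 + norm z) ^ k * norm (w z)))"
    using w by (intro integrable_mult_right) (simp add: moment_density_def)
  have w1: "integrable lborel (\<lambda>z. norm (w z))"
    using w by (auto simp: moment_density_def dest: spec[of _ 0])
  obtain B where B: "B \<ge> 0" "\<And>x. norm (\<psi> x) \<le> B" using schwartz_bound[OF \<psi>, of 0 "[]"] by auto
  define F where "F j z = (LINT x|lborel. f x * (ccutoff (real (Suc j)) x * \<psi> (x - z)))" for j z
  have Fm [measurable]: "F j \<in> borel_measurable borel" for j
    unfolding F_def by (rule cutoff_eval_measurable[OF \<psi>])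
  have ptw: "AE z in lborel. (\<lambda>j. w z * F j z) \<longlonglongrightarrow> w z * shift_eval \<psi> z"
    unfolding F_def by (intro AE_I2 tendsto_mult tendsto_const shift_eval_tendsto \<psi>)
  have dom: "AE z in lborel. norm (w z * F j z) \<le> C * ((1 + norm z) ^ k * norm (w z))" for j
    unfolding F_def using mult_left_mono[OF C(3) norm_ge_zero] by (intro AE_I2) (simp add: norm_mult mult_ac)
  have lim: "(\<lambda>j. LINT z|lborel. w z * F j z) \<longlonglongrightarrow> (LINT z|lborel. w z * shift_eval \<psi> z)"
    by (rule integral_dominated_convergence[OF _ _ W ptw dom]) measurable
  have int: "integrable lborel (\<lambda>z. w z * shift_eval \<psi> z)"
    by (rule integrable_dominated_convergence[OF _ _ W ptw dom]) measurable
  show "integrable lborel (\<lambda>z. w z * shift_eval \<psi> z)" by (rule int)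
  have eq: "(LINT z|lborel. w z * F j z) = (LINT x|lborel. f x * (ccutoff (real (Suc j)) x * conv w \<psi> x))" for j
  proof -
    let ?c = "ccutoff (real (Suc j)) :: real^'n \<Rightarrow> complex"
    have fc: "integrable lborel (\<lambda>x. norm (f x * ?c x) * B)"
      by (intro integrable_mult_left integrable_norm f_test_integrable cutoff_test0) simp
    have "(LINT z|lborel. w z * F j z) = (LINT z|lborel. (LINT x|lborel. w z * (f x * (?c x * \<psi> (x - z)))))"
      unfolding F_def by (simp only: integral_mult_right_zero)
    also have "\<dots> = (LINT x|lborel. (LINT z|lborel. w z * (f x * (?c x * \<psi> (x - z)))))"
    proof (rule fubini_product_bound(1)[OF _ w1 fc])
      show "(\<lambda>(z, x). w z * (f x * (?c x * \<psi> (x - z)))) \<in> borel_measurable (lborel \<Otimes>\<^sub>M lborel)" by measurable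
      show "norm (w z * (f x * (?c x * \<psi> (x - z)))) \<le> norm (w z) * (norm (f x * ?c x) * B)" for z x
        using mult_left_mono[OF B(2)[of "x - z"], of "norm (w z) * norm (f x * ?c x)"] by (simp add: norm_mult mult_ac)
    qed
    also have "\<dots> = (LINT x|lborel. (LINT z|lborel. (f x * ?c x) * (w z * \<psi> (x - z))))"
      by (simp only: mult_ac)
    also have "\<dots> = (LINT x|lborel. f x * (?c x * conv w \<psi> x))"
      unfolding conv_def integral_mult_right_zero by (simp only: mult.assoc)
    finally show ?thesis .
  qed
  have "(\<lambda>j. LINT z|lborel. w z * F j z) \<longlonglongrightarrow> u (conv w \<psi>)"
    unfolding eq by (rule u_cutoff_tendsto[OF conv_schwartz[OF w \<psi>]])
  then show "u (conv w \<psi>) = (LINT z|lborel. w z * shift_eval \<psi> z)"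
    using lim LIMSEQ_unique by blast
qed

lemma shift_eval_conv:
  assumes w: "w \<in> schwartz_space" and \<psi>: "\<psi> \<in> schwartz_space"
  shows "shift_eval (conv w \<psi>) y = (LINT z|lborel. w (z - y) * shift_eval \<psi> z)"
proof -
  have [measurable]: "w \<in> borel_measurable borel" "\<psi> \<in> borel_measurable borel"
    using w \<psi> by (auto simp: schwartz_measurable)
  have "conv w \<psi> (x - y) = conv (\<lambda>z. w (z - y)) \<psi> x" for x
  proof -
    have "conv w \<psi> (x - y) = (LINT z|lborel. (\<lambda>v. w v * \<psi> (x - y - v)) (z - y))"
      unfolding conv_def by (rule integral_translate[symmetric]) measurable
    then show ?thesis by (simp add: conv_def)
  qed
  then show ?thesis
    unfolding shift_eval_def[of "conv w \<psi>"]
    using u_conv(2)[OF schwartz_moment_density[OF schwartz_translate[OF w]] \<psi>] by simp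
qed

text \<open>\<open>heat_lap_eval k t\<close> is \<open>(-\<Delta>)\<^sup>k h\<^sub>t * u\<close>.\<close>

definition heat_lap_eval :: "nat \<Rightarrow> real \<Rightarrow> real^'n \<Rightarrow> complex" where
  "heat_lap_eval k t = shift_eval (heat_lap k t)"

lemma heat_conv_eq: "heat_conv t u = heat_lap_eval 0 t"
  unfolding heat_conv_def heat_lap_eval_def shift_eval_def heat_lap_def
  by (subst heat_kernel_minus) simp

text \<open>Time is split so that the derivatives sit on a Schwartz kernel while \<open>u\<close>
  enters only through \<open>heat_conv\<close>, the quantity that the Besov norm controls.\<close>

lemma heat_lap_eval_semigroup:
  assumes "a > 0" "b > 0"
  shows "heat_lap_eval k (a + b) y = (LINT z|lborel. heat_lap k b (z - y) * heat_conv a u z)"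
proof -
  have "conv (heat a) (heat_lap k b) = conv (heat_lap k b) (heat a)"
    by (intro conv_commute schwartz_measurable heat_schwartz heat_lap_schwartz assms)
  then have eq: "heat_lap k (a + b) = conv (heat_lap k b) (heat a)"
    using heat_lap_semigroup[OF assms, of k] by (metis ext)
  show ?thesis unfolding heat_lap_eval_def eq heat_conv_eq
    by (subst shift_eval_conv[OF heat_lap_schwartz heat_schwartz]) (simp_all add: assms heat_lap_def)
qed

text \<open>The scaling identity is available for t > 0 only; the indicator discards the times at
  which the kernel has no meaning.\<close>

lemma heat_lap_measurable2 [measurable]:
  "(\<lambda>(t, x :: real^'n). complex_of_real (indicator {0<..} t) * heat_lap k t x) \<in> borel_measurable (borel \<Otimes>\<^sub>M borel)"
proof -
  have [measurable]: "(heat_lap k 1 :: real^'n \<Rightarrow> complex) \<in> borel_measurable borel"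
    by (intro schwartz_measurable heat_lap_schwartz) simp
  have sc: "heat_lap k t x = complex_of_real (t powr (- real CARD('n) / 2 - real k)) * heat_lap k 1 ((1 / sqrt t) *\<^sub>R x + 0)"
    if "t > 0" for t and x :: "real^'n"
    by (rule fun_cong[OF heat_lap_scale[OF that]])
  have "(\<lambda>(t, x :: real^'n). complex_of_real (indicator {0<..} t) * heat_lap k t x) =
    (\<lambda>(t, x). complex_of_real (indicator {0<..} t) * (complex_of_real (t powr (- real CARD('n) / 2 - real k)) * heat_lap k 1 ((1 / sqrt t) *\<^sub>R x + 0)))"
    (is "?L = ?R")
  proof
    fix p :: "real \<times> (real^'n)"
    obtain t x where p: "p = (t, x)" by (cases p)
    show "?L p = ?R p" using sc[of t x] unfolding p by (cases "t > 0") simp_all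
  qed
  also have "\<dots> \<in> borel_measurable (borel \<Otimes>\<^sub>M borel)" by measurable
  finally show ?thesis .
qed

lemma heat_lap_eval_measurable2 [measurable]:
  "(\<lambda>(t, y). complex_of_real (indicator {0<..} t) * heat_lap_eval k t y) \<in> borel_measurable (borel \<Otimes>\<^sub>M borel)"
proof (rule borel_measurable_LIMSEQ_metric)
  let ?H = "\<lambda>t x. complex_of_real (indicator {0<..} t) * heat_lap k t (x :: real^'n)"
  have [measurable]: "(\<lambda>(t, x). ?H t x) \<in> borel_measurable (borel \<Otimes>\<^sub>M borel)" by (rule heat_lap_measurable2)
  have m: "(\<lambda>(p, x). ?H (fst p) (x - snd p)) \<in> borel_measurable ((borel \<Otimes>\<^sub>M borel) \<Otimes>\<^sub>M lborel)"
    using measurable_compose[of "\<lambda>(p, x). (fst p, x - snd p)" "(borel \<Otimes>\<^sub>M borel) \<Otimes>\<^sub>M lborel" "borel \<Otimes>\<^sub>M borel" "\<lambda>(t, x). ?H t x" borel]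
    by (simp add: split_beta')
  show "(\<lambda>p. LINT x|lborel. f x * (ccutoff (real (Suc j)) x * ?H (fst p) (x - snd p))) \<in> borel_measurable (borel \<Otimes>\<^sub>M borel)" for j
    by (rule lborel.borel_measurable_lebesgue_integral) (use m in measurable)
  fix p :: "real \<times> (real^'n)"
  obtain t y where p: "p = (t, y)" by (cases p)
  show "(\<lambda>j. LINT x|lborel. f x * (ccutoff (real (Suc j)) x * ?H (fst p) (x - snd p))) \<longlonglongrightarrow> (case p of (t, y) \<Rightarrow> complex_of_real (indicator {0<..} t) * heat_lap_eval k t y)"
    unfolding p heat_lap_eval_def using shift_eval_tendsto[OF heat_lap_schwartz[of t k], of y]
    by (cases "t > 0") simp_all
qed

end

subsection \<open>Powers on the half-line\<close>

text \<open>The truncated power t_+^a, zero for t \<le> 0. Integrals over the half-line thereby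
  become integrals over the line, on which translation and convolution are simple.\<close>

definition half_powr :: "real \<Rightarrow> real \<Rightarrow> real" where
  "half_powr a t = indicator {0<..} t * t powr a"

lemma half_powr_measurable [measurable]: "half_powr a \<in> borel_measurable borel"
  unfolding half_powr_def[abs_def] by measurable

lemma half_powr_nonneg: "0 \<le> half_powr a t"
  by (simp add: half_powr_def)

lemma half_powr_pos: "t > 0 \<Longrightarrow> half_powr a t = t powr a"
  by (simp add: half_powr_def)

lemma half_powr_neg: "t \<le> 0 \<Longrightarrow> half_powr a t = 0"
  by (simp add: half_powr_def)

lemma nn_integral_half_powr_small:
  assumes "a > -1" "T \<ge> 0"
  shows "(\<integral>\<^sup>+t. ennreal (half_powr a t * indicator {..T} t) \<partial>lborel) = ennreal (T powr (a + 1) / (a + 1))"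
proof -
  have "(\<integral>\<^sup>+t. ennreal (indicator {0..T} t * t powr a) \<partial>lborel) = ennreal (T powr (a + 1) / (a + 1))"
    by (rule nn_integral_has_integral_lebesgue[OF _ has_integral_powr_from_0[OF assms]]) simp
  moreover have "indicator {0..T} t * t powr a = half_powr a t * indicator {..T} t" for t
    by (cases "t = 0") (auto simp: half_powr_def indicator_def)
  ultimately show ?thesis by (simp only:)
qed

lemma nn_integral_half_powr_large:
  assumes "a < -1" "T > 0"
  shows "(\<integral>\<^sup>+t. ennreal (half_powr a t * indicator {T..} t) \<partial>lborel) = ennreal (- (T powr (a + 1)) / (a + 1))"
proof -
  have "(\<integral>\<^sup>+t. ennreal (indicator {T..} t * t powr a) \<partial>lborel) = ennreal (- (T powr (a + 1)) / (a + 1))"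
    by (rule nn_integral_has_integral_lebesgue[OF _ has_integral_powr_to_inf[OF assms]]) simp
  moreover have "indicator {T..} t * t powr a = half_powr a t * indicator {T..} t" for t
    using assms by (auto simp: half_powr_def indicator_def)
  ultimately show ?thesis by (simp only:)
qed

lemma integrable_half_powr_small:
  assumes "a > -1" "T \<ge> 0"
  shows "integrable lborel (\<lambda>t. half_powr a t * indicator {..T} t)"
  by (rule integrableI_nn_integral_finite[OF _ _ nn_integral_half_powr_small[OF assms]])
     (use assms in \<open>auto simp: half_powr_nonneg\<close>)

lemma integrable_half_powr_large:
  assumes "a < -1" "T > 0"
  shows "integrable lborel (\<lambda>t. half_powr a t * indicator {T..} t)"
  by (rule integrableI_nn_integral_finite[OF _ _ nn_integral_half_powr_large[OF assms]])
     (use assms in \<open>auto simp: half_powr_nonneg divide_nonpos_neg\<close>)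

text \<open>Euler's Gamma integral after scaling t by a. Computing in \<open>ennreal\<close> first
  gives integrability and the value at one stroke.\<close>

lemma
  fixes \<sigma> a :: real
  assumes \<sigma>: "\<sigma> > 0" and a: "a > 0"
  shows integrable_gamma_scaled: "integrable lborel (\<lambda>t. half_powr (\<sigma> - 1) t * exp (- (a * t)))"
    and integral_gamma_scaled: "(LINT t|lborel. half_powr (\<sigma> - 1) t * exp (- (a * t))) = Gamma \<sigma> * a powr (- \<sigma>)"
proof -
  let ?I = "\<integral>\<^sup>+t. ennreal (half_powr (\<sigma> - 1) t * exp (- (a * t))) \<partial>lborel"
  have "ennreal (Gamma \<sigma>) = (\<integral>\<^sup>+t. ennreal (indicator {0..} t * t powr (\<sigma> - 1) / exp t) \<partial>lborel)"
    by (rule Gamma_conv_nn_integral_real[OF \<sigma>])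
  also have "\<dots> = ennreal \<bar>a\<bar> * (\<integral>\<^sup>+t. ennreal (indicator {0..} (0 + a * t) * (0 + a * t) powr (\<sigma> - 1) / exp (0 + a * t)) \<partial>lborel)"
    by (rule nn_integral_real_affine) (use a in auto)
  also have "(\<lambda>t. ennreal (indicator {0..} (0 + a * t) * (0 + a * t) powr (\<sigma> - 1) / exp (0 + a * t))) =
     (\<lambda>t. ennreal (a powr (\<sigma> - 1)) * ennreal (half_powr (\<sigma> - 1) t * exp (- (a * t))))"
  proof
    fix t
    show "ennreal (indicator {0..} (0 + a * t) * (0 + a * t) powr (\<sigma> - 1) / exp (0 + a * t)) =
      ennreal (a powr (\<sigma> - 1)) * ennreal (half_powr (\<sigma> - 1) t * exp (- (a * t)))"
    proof (cases "t > 0")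
      case True
      then show ?thesis using a by (subst ennreal_mult'[symmetric]) (auto simp: half_powr_def powr_mult exp_minus divide_inverse mult_ac)
    next
      case False
      then show ?thesis using a by (cases "t = 0") (auto simp: half_powr_def indicator_def zero_le_mult_iff)
    qed
  qed
  also have "ennreal \<bar>a\<bar> * (\<integral>\<^sup>+t. ennreal (a powr (\<sigma> - 1)) * ennreal (half_powr (\<sigma> - 1) t * exp (- (a * t))) \<partial>lborel) = ennreal (a powr \<sigma>) * ?I"
  proof -
    have "a * a powr (\<sigma> - 1) = a powr \<sigma>" using a by (simp add: powr_diff)
    then show ?thesis using a by (subst nn_integral_cmult) (auto simp flip: mult.assoc ennreal_mult')
  qed
  finally have "ennreal (a powr (- \<sigma>)) * ennreal (Gamma \<sigma>) = ennreal (a powr (- \<sigma>)) * ennreal (a powr \<sigma>) * ?I"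
    by (simp add: mult.assoc)
  also have "ennreal (a powr (- \<sigma>)) * ennreal (a powr \<sigma>) = 1"
    using a by (simp flip: ennreal_mult powr_add)
  finally have I: "?I = ennreal (Gamma \<sigma> * a powr (- \<sigma>))"
    using \<sigma> a by (simp add: ennreal_mult' mult.commute Gamma_real_pos less_imp_le)
  show i: "integrable lborel (\<lambda>t. half_powr (\<sigma> - 1) t * exp (- (a * t)))"
    by (rule integrableI_nn_integral_finite[OF _ _ I]) (use \<sigma> in \<open>auto simp: half_powr_nonneg\<close>)
  show "(LINT t|lborel. half_powr (\<sigma> - 1) t * exp (- (a * t))) = Gamma \<sigma> * a powr (- \<sigma>)"
    using I nn_integral_eq_integral[OF i] \<sigma> half_powr_nonneg
    by (subst ennreal_inj[symmetric]) (auto intro!: integral_nonneg_AE simp: Gamma_real_pos less_imp_le)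
qed

subsection \<open>The multiplier as a superposition of heat kernels\<close>

text \<open>Convolving a character with \<psi> gives the character times the integral in question.
  Differentiating at 0, once on the character and once on \<psi>, yields the rule without
  integration by parts.\<close>

lemma character_integral_partial:
  fixes \<psi> :: "real^'n::finite \<Rightarrow> complex"
  assumes \<psi>: "\<psi> \<in> schwartz_space"
  shows "(LINT y|lborel. cis (\<xi> \<bullet> y) * partial_deriv i \<psi> y) = - (\<i> * complex_of_real (\<xi> $ i)) * (LINT y|lborel. cis (\<xi> \<bullet> y) * \<psi> y)"
proof -
  let ?w = "\<lambda>z. cis (- (\<xi> \<bullet> z))"
  have m [measurable]: "?w \<in> borel_measurable borel" by (intro borel_measurable_continuous_onI continuous_intros)
  have m' [measurable]: "(\<lambda>z. cis (\<xi> \<bullet> z)) \<in> borel_measurable borel" by (intro borel_measurable_continuous_onI continuous_intros)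
  have w: "tempered_density ?w" by (rule bounded_tempered_density[where B = 1]) auto
  have conv: "conv ?w \<phi> x = cis (- (\<xi> \<bullet> x)) * (LINT y|lborel. cis (\<xi> \<bullet> y) * \<phi> y)" if \<phi>: "\<phi> \<in> schwartz_space" for \<phi> x
  proof -
    have [measurable]: "\<phi> \<in> borel_measurable borel" by (rule schwartz_measurable[OF \<phi>])
    have "conv ?w \<phi> x = (LINT z|lborel. (\<lambda>y. (?w x * cis (\<xi> \<bullet> y)) * \<phi> y) (x - z))"
      unfolding conv_def by (simp add: cis_mult inner_diff_right)
    also have "\<dots> = (LINT y|lborel. (?w x * cis (\<xi> \<bullet> y)) * \<phi> y)" by (rule integral_reflect) measurable
    finally show ?thesis by (simp add: mult.assoc)
  qed
  let ?I = "LINT y|lborel. cis (\<xi> \<bullet> y) * \<psi> y"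
  have "((\<lambda>x. cis (- (\<xi> \<bullet> x))) has_derivative (\<lambda>h. (- (\<xi> \<bullet> h)) *\<^sub>R (\<i> * cis (- (\<xi> \<bullet> 0))))) (at 0)"
    by (rule has_derivative_cis) (auto intro!: derivative_eq_intros)
  from has_derivative_mult_left[OF this, of ?I]
  have "(conv ?w \<psi> has_derivative (\<lambda>h. (- (\<xi> \<bullet> h)) *\<^sub>R (\<i> * cis (- (\<xi> \<bullet> 0))) * ?I)) (at 0)"
    by (simp add: conv[OF \<psi>, abs_def] ext[OF conv[OF \<psi>]])
  then have "partial_deriv i (conv ?w \<psi>) 0 = (- (\<xi> \<bullet> axis i 1)) *\<^sub>R (\<i> * cis (- (\<xi> \<bullet> 0))) * ?I"
    by (rule partial_deriv_eqI)
  then show ?thesis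
    unfolding partial_deriv_conv[OF w \<psi>] conv[OF schwartz_partial_deriv[OF \<psi>]]
    by (simp add: inner_axis scaleR_conv_of_real mult_ac)
qed

section \<open>The inverse Fourier transform turns -\<Delta> into multiplication by
  |\<xi>|^2\<close>

lemma inverse_fourier_altdef:
  "inverse_fourier \<psi> \<xi> = complex_of_real ((2 * pi) powr (- real CARD('n::finite))) * (LINT y|lborel. cis (\<xi> \<bullet> y) * \<psi> (y :: real^'n))"
  by (simp add: inverse_fourier_def)

lemma character_integrable:
  fixes \<psi> :: "real^'n::finite \<Rightarrow> complex"
  assumes "\<psi> \<in> schwartz_space"
  shows "integrable lborel (\<lambda>y. cis (\<xi> \<bullet> y) * \<psi> y)"
proof -
  have [measurable]: "(\<lambda>z. cis (\<xi> \<bullet> z)) \<in> borel_measurable borel" by (intro borel_measurable_continuous_onI continuous_intros)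
  have [measurable]: "\<psi> \<in> borel_measurable borel" by (rule schwartz_measurable[OF assms])
  show ?thesis
    by (rule Bochner_Integration.integrable_bound[OF schwartz_integrable[OF assms]]) (auto simp: norm_mult)
qed

lemma inverse_fourier_nlap:
  fixes \<psi> :: "real^'n::finite \<Rightarrow> complex"
  assumes \<psi>: "\<psi> \<in> schwartz_space"
  shows "inverse_fourier (nlap \<psi>) \<xi> = complex_of_real ((norm \<xi>)\<^sup>2) * inverse_fourier \<psi> \<xi>"
proof -
  let ?G = "\<lambda>\<phi>. LINT y|lborel. cis (\<xi> \<bullet> y) * \<phi> y"
  have i: "integrable lborel (\<lambda>y. cis (\<xi> \<bullet> y) * (- iterated_partial [j, j] \<psi> y))" for j
    using character_integrable[OF schwartz_cmult[OF schwartz_iterated_partial[OF \<psi>, of "[j, j]"], of "-1"], of \<xi>] by simp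
  have "?G (nlap \<psi>) = (LINT y|lborel. (\<Sum>j\<in>UNIV. cis (\<xi> \<bullet> y) * (- iterated_partial [j, j] \<psi> y)))"
    unfolding nlap_def sum_distrib_left ..
  also have "\<dots> = (\<Sum>j\<in>UNIV. (LINT y|lborel. cis (\<xi> \<bullet> y) * (- iterated_partial [j, j] \<psi> y)))"
    by (rule Bochner_Integration.integral_sum) (rule i)
  also have "\<dots> = (\<Sum>j\<in>UNIV. complex_of_real ((\<xi> $ j)\<^sup>2) * ?G \<psi>)"
  proof (rule sum.cong[OF refl])
    fix j
    have "(LINT y|lborel. cis (\<xi> \<bullet> y) * (- iterated_partial [j, j] \<psi> y)) = - (LINT y|lborel. cis (\<xi> \<bullet> y) * partial_deriv j (partial_deriv j \<psi>) y)"
      by simp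
    also have "\<dots> = complex_of_real ((\<xi> $ j)\<^sup>2) * ?G \<psi>"
      unfolding character_integral_partial[OF schwartz_partial_deriv[OF \<psi>]] character_integral_partial[OF \<psi>]
      by (simp add: power2_eq_square algebra_simps)
    finally show "(LINT y|lborel. cis (\<xi> \<bullet> y) * (- iterated_partial [j, j] \<psi> y)) = complex_of_real ((\<xi> $ j)\<^sup>2) * ?G \<psi>" .
  qed
  also have "\<dots> = complex_of_real ((norm \<xi>)\<^sup>2) * ?G \<psi>"
    by (simp add: norm_square_sum sum_distrib_right)
  finally show ?thesis by (simp add: inverse_fourier_altdef)
qed

lemma inverse_fourier_nlap_pow:
  assumes "\<psi> \<in> schwartz_space"
  shows "inverse_fourier ((nlap ^^ k) \<psi>) \<xi> = complex_of_real ((norm \<xi>)\<^sup>2 ^ k) * inverse_fourier \<psi> \<xi>"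
  by (induction k) (simp_all add: inverse_fourier_nlap nlap_pow_schwartz assms mult.assoc)

lemma inverse_fourier_sum:
  fixes \<psi> :: "'i \<Rightarrow> real^'n::finite \<Rightarrow> complex"
  assumes "\<And>j. j \<in> J \<Longrightarrow> \<psi> j \<in> schwartz_space"
  shows "inverse_fourier (\<lambda>x. \<Sum>j\<in>J. c j * \<psi> j x) \<xi> = (\<Sum>j\<in>J. c j * inverse_fourier (\<psi> j) \<xi>)"
proof -
  have "(LINT y|lborel. cis (\<xi> \<bullet> y) * (\<Sum>j\<in>J. c j * \<psi> j y)) = (LINT y|lborel. (\<Sum>j\<in>J. c j * (cis (\<xi> \<bullet> y) * \<psi> j y)))"
    by (simp add: sum_distrib_left mult.left_commute)
  also have "\<dots> = (\<Sum>j\<in>J. c j * (LINT y|lborel. cis (\<xi> \<bullet> y) * \<psi> j y))"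
    by (subst Bochner_Integration.integral_sum) (auto intro!: integrable_mult_right character_integrable assms)
  finally show ?thesis by (simp add: inverse_fourier_altdef sum_distrib_left mult.left_commute)
qed

text \<open>The differential operator \<open>(\<epsilon>\<^sup>2 - \<Delta>)\<^sup>k\<close>, expanded by the binomial theorem.\<close>

definition shifted_nlap :: "real \<Rightarrow> nat \<Rightarrow> (real^'n::finite \<Rightarrow> complex) \<Rightarrow> real^'n \<Rightarrow> complex" where
  "shifted_nlap \<epsilon> k \<phi> x = (\<Sum>j\<le>k. complex_of_real (real (k choose j) * (\<epsilon>\<^sup>2) ^ j) * (nlap ^^ (k - j)) \<phi> x)"

lemma shifted_nlap_schwartz: "\<phi> \<in> schwartz_space \<Longrightarrow> shifted_nlap \<epsilon> k \<phi> \<in> schwartz_space"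
  unfolding shifted_nlap_def[abs_def] by (intro schwartz_sum schwartz_cmult nlap_pow_schwartz)

lemma inverse_fourier_shifted_nlap:
  assumes "\<phi> \<in> schwartz_space"
  shows "inverse_fourier (shifted_nlap \<epsilon> k \<phi>) \<xi> = complex_of_real (((norm \<xi>)\<^sup>2 + \<epsilon>\<^sup>2) ^ k) * inverse_fourier \<phi> \<xi>"
proof -
  have "inverse_fourier (shifted_nlap \<epsilon> k \<phi>) \<xi> = (\<Sum>j\<le>k. complex_of_real (real (k choose j) * (\<epsilon>\<^sup>2) ^ j) * inverse_fourier ((nlap ^^ (k - j)) \<phi>) \<xi>)"
    unfolding shifted_nlap_def[abs_def] by (rule inverse_fourier_sum) (rule nlap_pow_schwartz[OF assms])
  also have "\<dots> = (\<Sum>j\<le>k. complex_of_real (real (k choose j) * (\<epsilon>\<^sup>2) ^ j * ((norm \<xi>)\<^sup>2) ^ (k - j))) * inverse_fourier \<phi> \<xi>"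
    by (simp add: inverse_fourier_nlap_pow assms sum_distrib_right mult.assoc)
  also have "(\<Sum>j\<le>k. complex_of_real (real (k choose j) * (\<epsilon>\<^sup>2) ^ j * ((norm \<xi>)\<^sup>2) ^ (k - j))) = complex_of_real ((\<epsilon>\<^sup>2 + (norm \<xi>)\<^sup>2) ^ k)"
    unfolding binomial_ring by simp
  finally show ?thesis by (simp add: add.commute)
qed

lemma cis_inner_measurable [measurable]: "(\<lambda>\<xi>. cis (- (x \<bullet> \<xi>))) \<in> borel_measurable borel"
  by (intro borel_measurable_continuous_onI continuous_intros)

text \<open>This takes the place of Fourier inversion: the Gaussian makes the double integral
  absolutely convergent, and after Fubini the inner integral is a heat kernel.\<close>

lemma fourier_gauss_inverse_fourier:
  fixes \<psi> :: "real^'n::finite \<Rightarrow> complex"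
  assumes t: "t > 0" and \<psi>: "\<psi> \<in> schwartz_space"
  shows "(LINT \<xi>|lborel. cis (- (x \<bullet> \<xi>)) * complex_of_real (exp (- (t * (norm \<xi>)\<^sup>2))) * inverse_fourier \<psi> \<xi>) = conv (heat t) \<psi> x"
proof -
  let ?c = "complex_of_real ((2 * pi) powr (- real CARD('n)))"
  let ?e = "\<lambda>\<xi>::real^'n. complex_of_real (exp (- (t * (norm \<xi>)\<^sup>2)))"
  let ?F = "\<lambda>\<xi> y. ?c * (cis (- (x \<bullet> \<xi>)) * ?e \<xi> * (cis (\<xi> \<bullet> y) * \<psi> y))"
  have [measurable]: "\<psi> \<in> borel_measurable borel" by (rule schwartz_measurable[OF \<psi>])
  have [measurable]: "(\<lambda>(\<xi>, y). cis (\<xi> \<bullet> (y::real^'n))) \<in> borel_measurable (borel \<Otimes>\<^sub>M borel)"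
    unfolding borel_prod split_beta' by (intro borel_measurable_continuous_onI continuous_intros)
  have g: "integrable lborel (\<lambda>\<xi>. norm ?c * norm (?e \<xi>))"
    using gauss_fourier(1)[OF t, of "0 :: real^'n"] by (intro integrable_mult_right integrable_norm) simp
  have "(LINT \<xi>|lborel. cis (- (x \<bullet> \<xi>)) * ?e \<xi> * inverse_fourier \<psi> \<xi>) = (LINT \<xi>|lborel. (LINT y|lborel. ?F \<xi> y))"
  proof (rule Bochner_Integration.integral_cong[OF refl])
    fix \<xi>
    have "(LINT y|lborel. ?F \<xi> y) = ?c * (cis (- (x \<bullet> \<xi>)) * ?e \<xi> * (LINT y|lborel. cis (\<xi> \<bullet> y) * \<psi> y))"
      by (simp only: integral_mult_right_zero)
    then show "cis (- (x \<bullet> \<xi>)) * ?e \<xi> * inverse_fourier \<psi> \<xi> = (LINT y|lborel. ?F \<xi> y)"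
      unfolding inverse_fourier_altdef by (simp only: mult_ac)
  qed
  also have "\<dots> = (LINT y|lborel. (LINT \<xi>|lborel. ?F \<xi> y))"
  proof (rule fubini_product_bound(1)[OF _ g integrable_norm[OF schwartz_integrable[OF \<psi>]]])
    show "(\<lambda>(\<xi>, y). ?F \<xi> y) \<in> borel_measurable (lborel \<Otimes>\<^sub>M lborel)" by measurable
    show "norm (?F \<xi> y) \<le> norm ?c * norm (?e \<xi>) * norm (\<psi> y)" for \<xi> y by (simp add: norm_mult mult_ac)
  qed
  also have "\<dots> = (LINT y|lborel. \<psi> y * heat t (x - y))"
  proof (rule Bochner_Integration.integral_cong[OF refl])
    fix y
    have "(LINT \<xi>|lborel. ?F \<xi> y) = (LINT \<xi>|lborel. (?c * \<psi> y) * (cis (- ((x - y) \<bullet> \<xi>)) * ?e \<xi>))"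
    proof (intro Bochner_Integration.integral_cong refl)
      fix \<xi>
      have "cis (- ((x - y) \<bullet> \<xi>)) = cis (- (x \<bullet> \<xi>)) * cis (\<xi> \<bullet> y)"
        by (simp add: cis_mult inner_diff_left) (simp add: inner_commute)
      then show "?F \<xi> y = (?c * \<psi> y) * (cis (- ((x - y) \<bullet> \<xi>)) * ?e \<xi>)" by (simp only: mult_ac)
    qed
    also have "\<dots> = (?c * \<psi> y) * complex_of_real ((2 * pi) powr real CARD('n) * heat_kernel t (x - y))"
      by (simp only: integral_mult_right_zero gauss_fourier(2)[OF t])
    also have "\<dots> = \<psi> y * heat t (x - y)"
    proof -
      have "(2 * pi) powr (- real CARD('n)) * (2 * pi) powr real CARD('n) = 1" by (simp flip: powr_add)
      then show ?thesis by (simp flip: of_real_mult mult.assoc)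
    qed
    finally show "(LINT \<xi>|lborel. ?F \<xi> y) = \<psi> y * heat t (x - y)" .
  qed
  also have "\<dots> = conv \<psi> (heat t) x" by (simp add: conv_def)
  also have "\<dots> = conv (heat t) \<psi> x"
    using conv_commute[OF schwartz_measurable[OF \<psi>] schwartz_measurable[OF heat_schwartz[OF t]]] by simp
  finally show ?thesis .
qed

text \<open>The symbol is at least c (1 + |\<xi>|)^2, so \<sigma> \<ge> n gives decay of order 2n,
  the exponent of \<open>integrable_one_plus_norm\<close>.\<close>

lemma integrable_bessel_symbol:
  assumes "\<epsilon> > 0" "\<sigma> \<ge> real CARD('n::finite)"
  shows "integrable lborel (\<lambda>\<xi>::real^'n. ((norm \<xi>)\<^sup>2 + \<epsilon>\<^sup>2) powr (- \<sigma>))"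
proof -
  \<comment> \<open>The half comes from (1 + |\<xi>|)^2 \<le> 2 (1 + |\<xi>|^2), the minimum from
    bounding |\<xi>|^2 and \<epsilon>^2 separately.\<close>
  define c where "c = min (\<epsilon>\<^sup>2) 1 / 2"
  have c: "c > 0" using assms by (simp add: c_def)
  have "integrable lborel (\<lambda>\<xi>::real^'n. c powr (- \<sigma>) * (1 / (1 + norm \<xi>) ^ (2 * CARD('n))))"
    by (intro integrable_mult_right integrable_one_plus_norm) simp
  then show ?thesis
  proof (rule Bochner_Integration.integrable_bound)
    show "AE \<xi>::real^'n in lborel. norm (((norm \<xi>)\<^sup>2 + \<epsilon>\<^sup>2) powr (- \<sigma>)) \<le> norm (c powr (- \<sigma>) * (1 / (1 + norm \<xi>) ^ (2 * CARD('n))))"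
    proof (rule AE_I2)
      fix \<xi> :: "real^'n"
      have r1: "1 + norm \<xi> \<ge> 1" and r0: "0 < 1 + norm \<xi>" using norm_ge_zero[of \<xi>] by linarith+
      have "(1 + norm \<xi>)\<^sup>2 \<le> 2 * ((norm \<xi>)\<^sup>2 + 1)"
        using zero_le_power2[of "norm \<xi> - 1"] by (simp add: power2_eq_square algebra_simps)
      then have "c * (1 + norm \<xi>)\<^sup>2 \<le> c * (2 * ((norm \<xi>)\<^sup>2 + 1))" using c by (intro mult_left_mono) auto
      also have "\<dots> = min (\<epsilon>\<^sup>2) 1 * (norm \<xi>)\<^sup>2 + min (\<epsilon>\<^sup>2) 1" by (simp add: c_def algebra_simps)
      also have "\<dots> \<le> 1 * (norm \<xi>)\<^sup>2 + \<epsilon>\<^sup>2" by (intro add_mono mult_right_mono) auto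
      finally have "((norm \<xi>)\<^sup>2 + \<epsilon>\<^sup>2) powr (- \<sigma>) \<le> (c * (1 + norm \<xi>)\<^sup>2) powr (- \<sigma>)"
        using c assms r1 by (intro powr_mono2') (auto intro!: mult_pos_pos zero_less_power r0)
      also have "\<dots> = c powr (- \<sigma>) * ((1 + norm \<xi>) powr (- (2 * \<sigma>)))"
        using c r1 by (simp add: powr_mult powr_powr flip: powr_numeral)
      also have "\<dots> \<le> c powr (- \<sigma>) * (1 + norm \<xi>) powr (- real (2 * CARD('n)))"
        using assms r1 by (intro mult_left_mono powr_mono) auto
      also have "(1 + norm \<xi>) powr (- real (2 * CARD('n))) = 1 / (1 + norm \<xi>) ^ (2 * CARD('n))"
        by (simp only: powr_minus powr_realpow[OF r0] inverse_eq_divide)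
      finally show "norm (((norm \<xi>)\<^sup>2 + \<epsilon>\<^sup>2) powr (- \<sigma>)) \<le> norm (c powr (- \<sigma>) * (1 / (1 + norm \<xi>) ^ (2 * CARD('n))))"
        by (simp add: mult_left_mono abs_mult)
    qed
  qed measurable
qed

lemma inverse_fourier_bound:
  fixes \<psi> :: "real^'n::finite \<Rightarrow> complex"
  assumes \<psi>: "\<psi> \<in> schwartz_space"
  shows "\<exists>B\<ge>0. \<forall>\<xi>. norm (inverse_fourier \<psi> \<xi>) \<le> B" "inverse_fourier \<psi> \<in> borel_measurable borel"
proof -
  have [measurable]: "\<psi> \<in> borel_measurable borel" by (rule schwartz_measurable[OF \<psi>])
  let ?I = "LINT y|lborel. norm (\<psi> y)"
  have "norm (LINT y|lborel. cis (\<xi> \<bullet> y) * \<psi> y) \<le> ?I" for \<xi>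
    by (rule norm_integral_le_AE[OF integrable_norm[OF schwartz_integrable[OF \<psi>]]]) (simp add: norm_mult)
  then have "norm (inverse_fourier \<psi> \<xi>) \<le> (2 * pi) powr (- real CARD('n)) * ?I" for \<xi>
    unfolding inverse_fourier_altdef norm_mult by (intro mult_mono) auto
  then show "\<exists>B\<ge>0. \<forall>\<xi>. norm (inverse_fourier \<psi> \<xi>) \<le> B"
    by (intro exI[of _ "(2 * pi) powr (- real CARD('n)) * ?I"]) auto
  have [measurable]: "(\<lambda>(\<xi>, y). cis (\<xi> \<bullet> (y::real^'n))) \<in> borel_measurable (borel \<Otimes>\<^sub>M borel)"
    unfolding borel_prod split_beta' by (intro borel_measurable_continuous_onI continuous_intros)
  show "inverse_fourier \<psi> \<in> borel_measurable borel"
    unfolding inverse_fourier_altdef[abs_def] by measurable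
qed

text \<open>With a = |\<xi>|^2 + \<epsilon>^2, the factor a^k is absorbed into the function as
  \<open>shifted_nlap\<close>, and a^(-\<sigma>) is a Gamma integral in t. Exchanging t and \<xi> is
  legitimate because a^(-\<sigma>) is integrable and the inverse transform is bounded.\<close>

lemma fourier_multiplier_heat:
  fixes \<phi> :: "real^'n::finite \<Rightarrow> complex"
  assumes \<phi>: "\<phi> \<in> schwartz_space" and \<epsilon>: "\<epsilon> > 0" and \<sigma>: "\<sigma> \<ge> real CARD('n)" "\<sigma> = real k - s / 2"
  shows "fourier (\<lambda>\<xi>. complex_of_real (((norm \<xi>)\<^sup>2 + \<epsilon>\<^sup>2) powr (s / 2)) * inverse_fourier \<phi> \<xi>) x =
    complex_of_real (1 / Gamma \<sigma>) * (LINT t|lborel. complex_of_real (half_powr (\<sigma> - 1) t * exp (- (\<epsilon>\<^sup>2 * t))) * conv (heat t) (shifted_nlap \<epsilon> k \<phi>) x)"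
proof -
  define \<psi> where "\<psi> = shifted_nlap \<epsilon> k \<phi>"
  have \<psi>: "\<psi> \<in> schwartz_space" unfolding \<psi>_def by (rule shifted_nlap_schwartz[OF \<phi>])
  obtain B where B: "B \<ge> 0" "\<And>\<xi>. norm (inverse_fourier \<psi> \<xi>) \<le> B" using inverse_fourier_bound(1)[OF \<psi>] by blast
  note [measurable] = inverse_fourier_bound(2)[OF \<psi>]
  have \<sigma>0: "\<sigma> > 0" using \<sigma>(1) zero_less_card_finite[where 'a = 'n] by linarith
  then have G: "Gamma \<sigma> > 0" by (rule Gamma_real_pos)
  define a where "a \<xi> = (norm \<xi>)\<^sup>2 + \<epsilon>\<^sup>2" for \<xi> :: "real^'n"
  have a: "a \<xi> > 0" for \<xi> using \<epsilon> by (simp add: a_def add_nonneg_pos)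
  have [measurable]: "a \<in> borel_measurable borel" unfolding a_def[abs_def] by measurable
  let ?F = "\<lambda>\<xi> t. cis (- (x \<bullet> \<xi>)) * complex_of_real (half_powr (\<sigma> - 1) t * exp (- (a \<xi> * t))) * inverse_fourier \<psi> \<xi>"
  have pt: "cis (- (\<xi> \<bullet> x)) * (complex_of_real (a \<xi> powr (s / 2)) * inverse_fourier \<phi> \<xi>) = (1 / Gamma \<sigma>) * (LINT t|lborel. ?F \<xi> t)" for \<xi>
  proof -
    have "a \<xi> powr (s / 2) = a \<xi> powr (- \<sigma>) * a \<xi> ^ k"
      using a[of \<xi>] \<sigma>(2) by (simp flip: powr_realpow powr_add)
    then have "cis (- (\<xi> \<bullet> x)) * (complex_of_real (a \<xi> powr (s / 2)) * inverse_fourier \<phi> \<xi>) = cis (- (x \<bullet> \<xi>)) * (complex_of_real (a \<xi> powr (- \<sigma>)) * inverse_fourier \<psi> \<xi>)"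
      unfolding \<psi>_def inverse_fourier_shifted_nlap[OF \<phi>] a_def by (simp add: inner_commute)
    also have "complex_of_real (a \<xi> powr (- \<sigma>)) = (1 / Gamma \<sigma>) * (LINT t|lborel. complex_of_real (half_powr (\<sigma> - 1) t * exp (- (a \<xi> * t))))"
      unfolding integral_complex_of_real integral_gamma_scaled[OF \<sigma>0 a] using G by simp
    finally show ?thesis
      by (simp only: integral_mult_left_zero integral_mult_right_zero mult_ac)
  qed
  have "fourier (\<lambda>\<xi>. complex_of_real (((norm \<xi>)\<^sup>2 + \<epsilon>\<^sup>2) powr (s / 2)) * inverse_fourier \<phi> \<xi>) x = (1 / Gamma \<sigma>) * (LINT \<xi>|lborel. (LINT t|lborel. ?F \<xi> t))"
    unfolding fourier_def a_def[symmetric] pt by (rule integral_mult_right_zero)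
  also have "(LINT \<xi>|lborel. (LINT t|lborel. ?F \<xi> t)) = (LINT t|lborel. (LINT \<xi>|lborel. ?F \<xi> t))"
  proof (rule fubini_swap(1))
    show "(\<lambda>(\<xi>, t). ?F \<xi> t) \<in> borel_measurable (lborel \<Otimes>\<^sub>M lborel)" by measurable
    show "AE \<xi> in lborel. integrable lborel (?F \<xi>)"
      by (intro AE_I2 integrable_mult_left integrable_mult_right integrable_of_real integrable_gamma_scaled \<sigma>0 a)
    have n: "(LINT t|lborel. norm (?F \<xi> t)) = Gamma \<sigma> * a \<xi> powr (- \<sigma>) * norm (inverse_fourier \<psi> \<xi>)" for \<xi>
      by (simp add: norm_mult abs_mult half_powr_nonneg integral_gamma_scaled[OF \<sigma>0 a])
    have "integrable lborel (\<lambda>\<xi>::real^'n. a \<xi> powr (- \<sigma>) * (Gamma \<sigma> * B))"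
      unfolding a_def by (intro integrable_mult_left integrable_bessel_symbol \<epsilon> \<sigma>(1))
    then show "integrable lborel (\<lambda>\<xi>. LINT t|lborel. norm (?F \<xi> t))"
      unfolding n
    proof (rule Bochner_Integration.integrable_bound)
      show "AE \<xi> in lborel. norm (Gamma \<sigma> * a \<xi> powr (- \<sigma>) * norm (inverse_fourier \<psi> \<xi>)) \<le> norm (a \<xi> powr (- \<sigma>) * (Gamma \<sigma> * B))"
        using B G by (intro AE_I2) (auto simp: abs_mult intro!: mult_left_mono)
    qed measurable
  qed
  also have "\<dots> = (LINT t|lborel. complex_of_real (half_powr (\<sigma> - 1) t * exp (- (\<epsilon>\<^sup>2 * t))) * conv (heat t) \<psi> x)"
  proof (rule Bochner_Integration.integral_cong[OF refl])
    fix t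
    show "(LINT \<xi>|lborel. ?F \<xi> t) = complex_of_real (half_powr (\<sigma> - 1) t * exp (- (\<epsilon>\<^sup>2 * t))) * conv (heat t) \<psi> x"
    proof (cases "t > 0")
      case True
      have e: "exp (- (a \<xi> * t)) = exp (- (\<epsilon>\<^sup>2 * t)) * exp (- (t * (norm \<xi>)\<^sup>2))" for \<xi>
        by (simp add: a_def algebra_simps flip: exp_add)
      show ?thesis unfolding fourier_gauss_inverse_fourier[OF True \<psi>, symmetric] integral_mult_right_zero[symmetric] e
        by (simp add: mult_ac)
    qed (simp add: half_powr_def)
  qed
  finally show ?thesis unfolding \<psi>_def .
qed

text \<open>Up to a factor \<open>\<Gamma>(\<sigma>)\<close> the kernel of \<open>(\<epsilon>\<^sup>2 - \<Delta>)\<^bsup>-\<sigma>\<^esup>\<close>.\<close>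

definition bessel_kernel :: "real \<Rightarrow> real \<Rightarrow> real^'n::finite \<Rightarrow> complex" where
  "bessel_kernel \<sigma> \<epsilon> z = (LINT t|lborel. complex_of_real (half_powr (\<sigma> - 1) t * exp (- (\<epsilon>\<^sup>2 * t)) * heat_kernel t z))"

section \<open>Moments of the Bessel kernel\<close>

lemma heat_kernel_pair_measurable [measurable]:
  "(\<lambda>(t, z :: real^'n::finite). heat_kernel t z) \<in> borel_measurable (borel \<Otimes>\<^sub>M borel)"
  unfolding heat_kernel_def by measurable

text \<open>Scaling to time 1 replaces |z| by sqrt t |z|, and 1 + sqrt t |z| \<le> (1 + sqrt t) (1 +
  |z|).\<close>

lemma heat_kernel_moment:
  assumes t: "t > 0"
  shows "integrable lborel (\<lambda>z::real^'n::finite. (1 + norm z) ^ m * heat_kernel t z)"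
    "(LINT z|lborel. (1 + norm (z::real^'n)) ^ m * heat_kernel t z) \<le> (1 + sqrt t) ^ m * (LINT z|lborel. (1 + norm (z::real^'n)) ^ m * heat_kernel 1 z)"
proof -
  have i: "integrable lborel (\<lambda>z::real^'n. (1 + norm z) ^ m * heat_kernel t z)" if "t > 0" for t
    using schwartz_integrable_weighted[OF heat_schwartz[OF that], of m] by (simp add: heat_kernel_nonneg)
  then show "integrable lborel (\<lambda>z::real^'n::finite. (1 + norm z) ^ m * heat_kernel t z)" using t by blast
  let ?f = "\<lambda>z::real^'n. (1 + norm z) ^ m * heat_kernel t z"
  have p: "t powr (- real CARD('n) / 2) * sqrt t ^ CARD('n) = 1"
    using t by (simp add: powr_half_sqrt[symmetric] powr_realpow[symmetric] powr_powr flip: powr_add)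
  have "(LINT z|lborel. ?f (0 + sqrt t *\<^sub>R z)) = (1 / \<bar>sqrt t\<bar> ^ DIM(real^'n)) *\<^sub>R (LINT z|lborel. ?f z)"
    by (rule integral_affine) (use t in auto)
  then have "(LINT z|lborel. ?f z) = sqrt t ^ CARD('n) * (LINT z|lborel. ?f (sqrt t *\<^sub>R z))" using t by simp
  also have "\<dots> = (LINT z|lborel. (1 + sqrt t * norm z) ^ m * heat_kernel 1 (z :: real^'n))"
  proof -
    have "sqrt t ^ CARD('n) * ?f (sqrt t *\<^sub>R z) = (1 + sqrt t * norm z) ^ m * heat_kernel 1 z" for z
    proof -
      have "heat_kernel t (sqrt t *\<^sub>R z) = t powr (- real CARD('n) / 2) * heat_kernel 1 z"
        using t by (subst heat_kernel_scale) auto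
      then have "sqrt t ^ CARD('n) * ?f (sqrt t *\<^sub>R z) = (t powr (- real CARD('n) / 2) * sqrt t ^ CARD('n)) * ((1 + norm (sqrt t *\<^sub>R z)) ^ m * heat_kernel 1 z)"
        by (simp only: mult_ac)
      then show ?thesis using t unfolding p by simp
    qed
    then show ?thesis unfolding integral_mult_right_zero[symmetric] by (simp only:)
  qed
  also have "\<dots> \<le> (LINT z|lborel. (1 + sqrt t) ^ m * ((1 + norm z) ^ m * heat_kernel 1 (z :: real^'n)))"
  proof (rule integral_mono_AE')
    show "integrable lborel (\<lambda>z. (1 + sqrt t) ^ m * ((1 + norm z) ^ m * heat_kernel 1 (z :: real^'n)))"
      by (intro integrable_mult_right i) simp
    have "(1 + sqrt t * norm z) ^ m \<le> ((1 + sqrt t) * (1 + norm z)) ^ m" for z :: "real^'n"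
      using t by (intro power_mono) (auto simp: algebra_simps)
    then show "AE z in lborel. (1 + sqrt t * norm z) ^ m * heat_kernel 1 z \<le> (1 + sqrt t) ^ m * ((1 + norm z) ^ m * heat_kernel 1 (z :: real^'n))"
      by (intro AE_I2) (auto simp: power_mult_distrib heat_kernel_nonneg mult_right_mono simp flip: mult.assoc)
  qed (use t in \<open>auto simp: heat_kernel_nonneg\<close>)
  finally show "(LINT z|lborel. ?f z) \<le> (1 + sqrt t) ^ m * (LINT z|lborel. (1 + norm (z::real^'n)) ^ m * heat_kernel 1 z)"
    by simp
qed

lemma integrable_gamma_poly:
  assumes \<sigma>: "\<sigma> > 0" and \<epsilon>: "\<epsilon> > 0"
  shows "integrable lborel (\<lambda>t. half_powr (\<sigma> - 1) t * exp (- (\<epsilon>\<^sup>2 * t)) * (1 + sqrt t) ^ m)"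
proof -
  \<comment> \<open>Half of the exponential rate is spent on absorbing the polynomial factor; the
    other half keeps the Gamma integral convergent.\<close>
  define a where "a = \<epsilon>\<^sup>2 / 2"
  have a: "a > 0" using \<epsilon> by (simp add: a_def)
  define C where "C = (2 / a) ^ m * real m ^ m * exp a"
  have "integrable lborel (\<lambda>t. C * (half_powr (\<sigma> - 1) t * exp (- (a * t))))"
    by (intro integrable_mult_right integrable_gamma_scaled \<sigma> a)
  then show ?thesis
  proof (rule Bochner_Integration.integrable_bound)
    show "AE t in lborel. norm (half_powr (\<sigma> - 1) t * exp (- (\<epsilon>\<^sup>2 * t)) * (1 + sqrt t) ^ m) \<le> norm (C * (half_powr (\<sigma> - 1) t * exp (- (a * t))))"
    proof (rule AE_I2)
      fix t :: real
      show "norm (half_powr (\<sigma> - 1) t * exp (- (\<epsilon>\<^sup>2 * t)) * (1 + sqrt t) ^ m) \<le> norm (C * (half_powr (\<sigma> - 1) t * exp (- (a * t))))"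
      proof (cases "t > 0")
        case True
        have "1 + sqrt t \<le> 2 * (1 + t)"
        proof -
          have "sqrt t \<le> sqrt ((1 + t)\<^sup>2)" using True by (intro real_sqrt_le_mono) (simp add: power2_eq_square algebra_simps)
          then show ?thesis using True by simp
        qed
        then have "(1 + sqrt t) ^ m \<le> (2 * (1 + t)) ^ m" using True by (intro power_mono) auto
        also have "\<dots> = (2 / a) ^ m * (a * (1 + t)) ^ m" using a by (simp flip: power_mult_distrib)
        also have "\<dots> \<le> (2 / a) ^ m * (real m ^ m * exp (a * (1 + t)))"
          using a True by (intro mult_left_mono power_le_exp) auto
        also have "\<dots> = C * exp (a * t)" by (simp add: C_def exp_add algebra_simps)
        finally have "exp (- (\<epsilon>\<^sup>2 * t)) * (1 + sqrt t) ^ m \<le> exp (- (\<epsilon>\<^sup>2 * t)) * (C * exp (a * t))" by (rule mult_left_mono) simp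
        also have "\<dots> = C * exp (- (a * t))" by (simp add: a_def field_simps flip: exp_add)
        finally have "half_powr (\<sigma> - 1) t * (exp (- (\<epsilon>\<^sup>2 * t)) * (1 + sqrt t) ^ m) \<le> half_powr (\<sigma> - 1) t * (C * exp (- (a * t)))"
          by (rule mult_left_mono) (rule half_powr_nonneg)
        then show ?thesis using True by (simp add: abs_mult half_powr_nonneg mult_ac C_def a less_imp_le)
      qed (simp add: half_powr_def)
    qed
  qed measurable
qed

text \<open>Integrating in z first costs a factor (1 + sqrt t)^m, which the exponential in t
  absorbs. Three choices of A are made later: weights (for moments), a translated Schwartz function
  (for convolution) and \<open>shift_eval\<close> (for the pairing with \<open>u\<close>).\<close>

lemma bessel_fubini:
  fixes A :: "real^'n::finite \<Rightarrow> complex"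
  assumes \<sigma>: "\<sigma> > 0" and \<epsilon>: "\<epsilon> > 0" and A[measurable]: "A \<in> borel_measurable borel" and C: "\<And>z. norm (A z) \<le> C * (1 + norm z) ^ m"
  shows "integrable lborel (\<lambda>z. bessel_kernel \<sigma> \<epsilon> z * A z)"
    "(LINT z|lborel. bessel_kernel \<sigma> \<epsilon> z * A z) = (LINT t|lborel. complex_of_real (half_powr (\<sigma> - 1) t * exp (- (\<epsilon>\<^sup>2 * t))) * (LINT z|lborel. heat t z * A z))"
proof -
  let ?g = "\<lambda>t. half_powr (\<sigma> - 1) t * exp (- (\<epsilon>\<^sup>2 * t))"
  let ?F = "\<lambda>t z. complex_of_real (?g t) * (heat t z * A z)"
  have C0: "C \<ge> 0" using order_trans[OF norm_ge_zero C[of 0]] by simp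
  have eq1: "bessel_kernel \<sigma> \<epsilon> z * A z = (LINT t|lborel. ?F t z)" for z
    unfolding bessel_kernel_def integral_mult_left_zero[symmetric] by (simp add: mult.assoc)
  have eq2: "complex_of_real (?g t) * (LINT z|lborel. heat t z * A z) = (LINT z|lborel. ?F t z)" for t
    by (simp only: integral_mult_right_zero)
  have m: "(\<lambda>(t, z). ?F t z) \<in> borel_measurable (lborel \<Otimes>\<^sub>M lborel)" by measurable
  have bnd: "norm (heat t z * A z) \<le> C * ((1 + norm z) ^ m * heat_kernel t z)" for t z
    using mult_left_mono[OF C[of z], of "heat_kernel t z"] by (simp add: norm_mult heat_kernel_nonneg mult_ac)
  have i: "integrable lborel (\<lambda>z. heat t z * A z)" if "t > 0" for t
  proof (rule Bochner_Integration.integrable_bound[OF integrable_mult_right[OF heat_kernel_moment(1)[OF that], of C m]])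
    show "AE z in lborel. norm (heat t z * A z) \<le> norm (C * ((1 + norm z) ^ m * heat_kernel t z))"
      unfolding real_norm_def by (intro AE_I2) (rule order_trans[OF bnd abs_ge_self])
  qed measurable
  have 1: "AE t in lborel. integrable lborel (?F t)"
  proof (rule AE_I2)
    fix t show "integrable lborel (?F t)" using i[of t] by (cases "t > 0") (auto simp: half_powr_def)
  qed
  define M where "M = (LINT z|lborel. (1 + norm (z::real^'n)) ^ m * heat_kernel 1 z)"
  have "integrable lborel (\<lambda>t. C * M * (?g t * (1 + sqrt t) ^ m))"
    by (intro integrable_mult_right integrable_gamma_poly \<sigma> \<epsilon>)
  then have 2: "integrable lborel (\<lambda>t. LINT z|lborel. norm (?F t z))"
  proof (rule Bochner_Integration.integrable_bound)
    show "AE t in lborel. norm (LINT z|lborel. norm (?F t z)) \<le> norm (C * M * (?g t * (1 + sqrt t) ^ m))"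
    proof (rule AE_I2)
      fix t
      show "norm (LINT z|lborel. norm (?F t z)) \<le> norm (C * M * (?g t * (1 + sqrt t) ^ m))"
      proof (cases "t > 0")
        case True
        have "(LINT z|lborel. norm (heat t z * A z)) \<le> (LINT z|lborel. C * ((1 + norm z) ^ m * heat_kernel t (z :: real^'n)))"
          by (rule integral_mono_AE'[OF integrable_mult_right[OF heat_kernel_moment(1)[OF True]]]) (use bnd C0 in \<open>auto simp: heat_kernel_nonneg\<close>)
        also have "\<dots> = C * (LINT z|lborel. (1 + norm z) ^ m * heat_kernel t (z :: real^'n))" by (rule integral_mult_right_zero)
        also have "\<dots> \<le> C * ((1 + sqrt t) ^ m * M)" unfolding M_def
          by (intro mult_left_mono heat_kernel_moment True C0)
        finally have *: "(LINT z|lborel. norm (heat t z * A z)) \<le> C * ((1 + sqrt t) ^ m * M)" .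
        have "norm (LINT z|lborel. norm (?F t z)) = ?g t * (LINT z|lborel. norm (heat t z * A z))"
        proof -
          have "norm (?F t z) = ?g t * norm (heat t z * A z)" for z
            by (simp add: norm_mult abs_mult half_powr_nonneg)
          then show ?thesis
            by (simp only: integral_mult_right_zero) (simp add: abs_mult half_powr_nonneg)
        qed
        also have "\<dots> \<le> ?g t * (C * ((1 + sqrt t) ^ m * M))"
          using * by (rule mult_left_mono) (simp add: half_powr_nonneg)
        also have "\<dots> \<le> norm (C * M * (?g t * (1 + sqrt t) ^ m))" by (simp add: mult_ac abs_ge_self)
        finally show ?thesis .
      qed (simp add: half_powr_def)
    qed
  qed measurable
  show "integrable lborel (\<lambda>z. bessel_kernel \<sigma> \<epsilon> z * A z)"
    unfolding eq1 by (rule fubini_swap(3)[OF m 1 2])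
  show "(LINT z|lborel. bessel_kernel \<sigma> \<epsilon> z * A z) = (LINT t|lborel. complex_of_real (?g t) * (LINT z|lborel. heat t z * A z))"
    unfolding eq1 eq2 by (rule fubini_swap(1)[OF m 1 2, symmetric])
qed

lemma bessel_kernel_moment_density:
  assumes "\<sigma> > 0" "\<epsilon> > 0"
  shows "moment_density (bessel_kernel \<sigma> \<epsilon> :: real^'n::finite \<Rightarrow> complex)"
  unfolding moment_density_def
proof (intro conjI allI)
  show [measurable]: "(bessel_kernel \<sigma> \<epsilon> :: real^'n \<Rightarrow> complex) \<in> borel_measurable borel"
    unfolding bessel_kernel_def[abs_def] by measurable
  fix k
  have "integrable lborel (\<lambda>z::real^'n. bessel_kernel \<sigma> \<epsilon> z * complex_of_real ((1 + norm z) ^ k))"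
    by (rule bessel_fubini(1)[where C = 1 and m = k]) (use assms in \<open>auto simp del: of_real_power of_real_add\<close>)
  from integrable_norm[OF this] show "integrable lborel (\<lambda>z::real^'n. (1 + norm z) ^ k * norm (bessel_kernel \<sigma> \<epsilon> z))"
    by (simp add: norm_mult mult.commute del: of_real_power of_real_add)
qed

text \<open>The superposition of heat flows is collapsed into a single convolution, because
  convolutions are what \<open>u_conv\<close> can pull out of \<open>u\<close>.\<close>

lemma fourier_multiplier_conv:
  fixes \<phi> :: "real^'n::finite \<Rightarrow> complex"
  assumes \<phi>: "\<phi> \<in> schwartz_space" and \<epsilon>: "\<epsilon> > 0" and \<sigma>: "\<sigma> \<ge> real CARD('n)" "\<sigma> = real k - s / 2"
  shows "fourier (\<lambda>\<xi>. complex_of_real (((norm \<xi>)\<^sup>2 + \<epsilon>\<^sup>2) powr (s / 2)) * inverse_fourier \<phi> \<xi>) =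
    (\<lambda>x. complex_of_real (1 / Gamma \<sigma>) * conv (bessel_kernel \<sigma> \<epsilon>) (shifted_nlap \<epsilon> k \<phi>) x)"
proof
  fix x
  let ?\<psi> = "shifted_nlap \<epsilon> k \<phi>"
  have \<psi>: "?\<psi> \<in> schwartz_space" by (rule shifted_nlap_schwartz[OF \<phi>])
  have [measurable]: "?\<psi> \<in> borel_measurable borel" by (rule schwartz_measurable[OF \<psi>])
  have \<sigma>0: "\<sigma> > 0" using \<sigma>(1) zero_less_card_finite[where 'a = 'n] by linarith
  obtain B where B: "\<And>x. norm (?\<psi> x) \<le> B" using schwartz_bound[OF \<psi>, of 0 "[]"] by auto
  have "conv (bessel_kernel \<sigma> \<epsilon>) ?\<psi> x = (LINT t|lborel. complex_of_real (half_powr (\<sigma> - 1) t * exp (- (\<epsilon>\<^sup>2 * t))) * conv (heat t) ?\<psi> x)"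
    unfolding conv_def by (rule bessel_fubini(2)[where C = B and m = 0]) (use \<sigma>0 \<epsilon> B in auto)
  then show "fourier (\<lambda>\<xi>. complex_of_real (((norm \<xi>)\<^sup>2 + \<epsilon>\<^sup>2) powr (s / 2)) * inverse_fourier \<phi> \<xi>) x =
    complex_of_real (1 / Gamma \<sigma>) * conv (bessel_kernel \<sigma> \<epsilon>) ?\<psi> x"
    using fourier_multiplier_heat[OF assms] by (simp only:)
qed

subsection \<open>The fractional Laplacian as an integral over the heat flow\<close>

text \<open>The type token carries the dimension. The constant depends on no distribution, so it may
  enter the final C.\<close>

definition heat_lap_norm :: "'n::finite itself \<Rightarrow> nat \<Rightarrow> real" where
  "heat_lap_norm _ k = (LINT x|lborel. norm (heat_lap k 1 (x :: real^'n)))"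

lemma heat_lap_norm_nonneg: "0 \<le> heat_lap_norm TYPE('n::finite) k"
  by (simp add: heat_lap_norm_def)

lemma conv_sum:
  assumes w: "tempered_density w" and \<psi>: "\<And>j. j \<in> J \<Longrightarrow> \<psi> j \<in> schwartz_space"
  shows "conv w (\<lambda>x. \<Sum>j\<in>J. c j * \<psi> j x) = (\<lambda>x. \<Sum>j\<in>J. c j * conv w (\<psi> j) x)"
proof
  fix x
  have "conv w (\<lambda>x. \<Sum>j\<in>J. c j * \<psi> j x) x = (LINT z|lborel. (\<Sum>j\<in>J. c j * (w z * \<psi> j (x - z))))"
    by (simp add: conv_def sum_distrib_left mult.left_commute)
  also have "\<dots> = (\<Sum>j\<in>J. c j * conv w (\<psi> j) x)"
    unfolding conv_def by (subst Bochner_Integration.integral_sum) (auto intro!: integrable_mult_right conv_integrable w \<psi>)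
  finally show "conv w (\<lambda>x. \<Sum>j\<in>J. c j * \<psi> j x) x = (\<Sum>j\<in>J. c j * conv w (\<psi> j) x)" .
qed

context smooth_tempered
begin

lemma u_sum:
  assumes "finite J" "\<And>j. j \<in> J \<Longrightarrow> \<psi> j \<in> schwartz_space"
  shows "u (\<lambda>x. \<Sum>j\<in>J. c j * \<psi> j x) = (\<Sum>j\<in>J. c j * u (\<psi> j))"
  using assms
proof (induction J rule: finite_induct)
  case empty
  show ?case using u_cmult[OF schwartz_zero, of 0] by simp
next
  case (insert j J)
  have "u (\<lambda>x. c j * \<psi> j x + (\<Sum>j\<in>J. c j * \<psi> j x)) = u (\<lambda>x. c j * \<psi> j x) + u (\<lambda>x. \<Sum>j\<in>J. c j * \<psi> j x)"
    using insert by (intro u_add schwartz_cmult schwartz_sum) auto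
  then show ?case using insert by (simp add: u_cmult)
qed

text \<open>\<open>lap_pair i \<phi> t\<close> is the pairing of \<open>(-\<Delta>)\<^sup>i h\<^sub>t * u\<close> with \<open>\<phi>\<close>.\<close>

definition lap_pair :: "nat \<Rightarrow> (real^'n \<Rightarrow> complex) \<Rightarrow> real \<Rightarrow> complex" where
  "lap_pair i \<phi> t = u (conv (heat t) ((nlap ^^ i) \<phi>))"

lemma heat_conv_measurable: "t > 0 \<Longrightarrow> heat_conv t u \<in> borel_measurable borel"
  unfolding heat_conv_eq heat_lap_eval_def by (rule shift_eval_measurable[OF heat_lap_schwartz])

lemma heat_lap_eval_measurable: "t > 0 \<Longrightarrow> heat_lap_eval k t \<in> borel_measurable borel"
  unfolding heat_lap_eval_def by (rule shift_eval_measurable[OF heat_lap_schwartz])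

text \<open>One of two forms of the same pairing. With the derivatives on \<phi> only t^(-\<beta>/2)
  is lost, which suits small t; \<open>lap_pair_heat_lap\<close> puts them on the kernel and gains
  t^(-i), which suits large t.\<close>

lemma lap_pair_heat_conv:
  assumes t: "t > 0" and \<phi>: "\<phi> \<in> schwartz_space"
  shows "lap_pair i \<phi> t = (LINT y|lborel. (nlap ^^ i) \<phi> y * heat_conv t u y)"
proof -
  note n = nlap_pow_schwartz[OF \<phi>, of i]
  have "conv (heat t) ((nlap ^^ i) \<phi>) = conv ((nlap ^^ i) \<phi>) (heat t)"
    by (intro conv_commute schwartz_measurable heat_schwartz n t)
  then show ?thesis
    unfolding lap_pair_def heat_conv_eq heat_lap_eval_def
    using u_conv(2)[OF schwartz_moment_density[OF n] heat_schwartz[OF t]] by (simp add: heat_lap_def)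
qed

lemma lap_pair_heat_lap:
  assumes t: "t > 0" and \<phi>: "\<phi> \<in> schwartz_space"
  shows "lap_pair i \<phi> t = (LINT y|lborel. \<phi> y * heat_lap_eval i t y)"
  unfolding lap_pair_def conv_heat_nlap[OF t \<phi>] heat_lap_eval_def
  by (rule u_conv(2)[OF schwartz_moment_density[OF \<phi>] heat_lap_schwartz[OF t]])

lemma lap_pair_measurable:
  assumes \<phi>: "\<phi> \<in> schwartz_space"
  shows "(\<lambda>t. complex_of_real (indicator {0<..} t) * lap_pair i \<phi> t) \<in> borel_measurable borel"
proof -
  have [measurable]: "\<phi> \<in> borel_measurable borel" by (rule schwartz_measurable[OF \<phi>])
  have "(\<lambda>t. complex_of_real (indicator {0<..} t) * lap_pair i \<phi> t) =
    (\<lambda>t. LINT y|lborel. \<phi> y * (complex_of_real (indicator {0<..} t) * heat_lap_eval i t y))"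
  proof
    fix t
    show "complex_of_real (indicator {0<..} t) * lap_pair i \<phi> t = (LINT y|lborel. \<phi> y * (complex_of_real (indicator {0<..} t) * heat_lap_eval i t y))"
      by (cases "t > 0") (simp_all add: lap_pair_heat_lap \<phi>)
  qed
  also have "\<dots> \<in> borel_measurable borel"
    by (rule lborel.borel_measurable_lebesgue_integral) measurable
  finally show ?thesis .
qed

lemma half_powr_lap_pair_measurable:
  assumes \<phi>: "\<phi> \<in> schwartz_space"
  shows "(\<lambda>t. complex_of_real (half_powr a t) * lap_pair i \<phi> t) \<in> borel_measurable borel"
proof -
  note [measurable] = lap_pair_measurable[OF \<phi>]
  have "(\<lambda>t. complex_of_real (half_powr a t) * lap_pair i \<phi> t) = (\<lambda>t. complex_of_real (t powr a) * (complex_of_real (indicator {0<..} t) * lap_pair i \<phi> t))"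
    by (simp add: half_powr_def mult_ac)
  also have "\<dots> \<in> borel_measurable borel" by measurable
  finally show ?thesis .
qed

end

locale besov_fun = smooth_tempered u f for u :: "'n::finite distribution" and f +
  fixes \<beta> :: real
  assumes \<beta>: "0 < \<beta>" and besov: "u \<in> besov_space \<beta>"
begin

abbreviation "B \<equiv> besov_norm \<beta> u"

lemma B_nonneg: "0 \<le> B"
  by (simp add: besov_norm_def)

lemma heat_conv_AE:
  assumes t: "t > 0"
  shows "AE y in lborel. norm (heat_conv t u y) \<le> t powr (- \<beta> / 2) * B"
proof -
  have E: "besov_enorm \<beta> u = ennreal B"
    using besov by (simp add: besov_space_def besov_norm_def)
  have "ennreal (t powr (\<beta> / 2)) * esssup lborel (\<lambda>x. ennreal (norm (heat_conv t u x))) \<le> besov_enorm \<beta> u"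
    unfolding besov_enorm_def by (rule SUP_upper) (use t in simp)
  then have le: "ennreal (t powr (\<beta> / 2)) * esssup lborel (\<lambda>x. ennreal (norm (heat_conv t u x))) \<le> ennreal B"
    unfolding E .
  have "AE y in lborel. ennreal (norm (heat_conv t u y)) \<le> esssup lborel (\<lambda>x. ennreal (norm (heat_conv t u x)))"
    by (rule esssup_AE)
  then show ?thesis
  proof eventually_elim
    case (elim y)
    have "ennreal (t powr (\<beta> / 2) * norm (heat_conv t u y)) = ennreal (t powr (\<beta> / 2)) * ennreal (norm (heat_conv t u y))"
      by (simp add: ennreal_mult)
    also have "\<dots> \<le> ennreal B" by (rule order_trans[OF mult_left_mono[OF elim] le]) simp
    finally have "t powr (\<beta> / 2) * norm (heat_conv t u y) \<le> B"
      by (simp add: ennreal_le_iff B_nonneg)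
    then have "t powr (- \<beta> / 2) * (t powr (\<beta> / 2) * norm (heat_conv t u y)) \<le> t powr (- \<beta> / 2) * B"
      by (rule mult_left_mono) simp
    moreover have "t powr (- \<beta> / 2) * t powr (\<beta> / 2) = 1" using t by (simp flip: powr_add)
    ultimately show ?case by (simp flip: mult.assoc)
  qed
qed

definition lap_const :: "nat \<Rightarrow> real" where
  "lap_const k = heat_lap_norm TYPE('n) k * 2 powr (real k + \<beta> / 2)"

lemma lap_const_nonneg: "0 \<le> lap_const k"
  by (simp add: lap_const_def heat_lap_norm_nonneg)

text \<open>The semigroup law at t/2 + t/2: one half carries the derivatives, with L1 norm of order
  t^(-k), the other the Besov bound t^(-\<beta>/2). The halving produces the power of 2 in
  \<open>lap_const\<close>. The Besov bound is used under an integral, so an almost everywhere bound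
  becomes one at every y.\<close>

lemma heat_lap_eval_bound:
  assumes t: "t > 0"
  shows "norm (heat_lap_eval k t y) \<le> lap_const k * B * t powr (- real k - \<beta> / 2)"
proof -
  define a where "a = t / 2"
  have a: "a > 0" "t = a + a" using t by (simp_all add: a_def)
  note S = heat_lap_schwartz[OF a(1), of k]
  have i: "integrable lborel (\<lambda>z. norm (heat_lap k a (z - y)))"
    by (intro integrable_norm schwartz_integrable schwartz_translate S)
  have "norm (heat_lap_eval k t y) = norm (LINT z|lborel. heat_lap k a (z - y) * heat_conv a u z)"
    unfolding a(2) heat_lap_eval_semigroup[OF a(1) a(1)] ..
  also have "\<dots> \<le> (LINT z|lborel. norm (heat_lap k a (z - y)) * (a powr (- \<beta> / 2) * B))"
  proof (rule norm_integral_le_AE[OF integrable_mult_left[OF i]])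
    show "AE z in lborel. norm (heat_lap k a (z - y) * heat_conv a u z) \<le> norm (heat_lap k a (z - y)) * (a powr (- \<beta> / 2) * B)"
      using heat_conv_AE[OF a(1)] by eventually_elim (simp add: norm_mult mult_left_mono)
  qed
  also have "\<dots> = (LINT z|lborel. norm (heat_lap k a (z - y))) * (a powr (- \<beta> / 2) * B)"
    by (rule integral_mult_left_zero)
  also have "(LINT z|lborel. norm (heat_lap k a (z - y))) = (LINT z|lborel. norm (heat_lap k a (z :: real^'n)))"
    by (rule integral_translate) (use schwartz_measurable[OF S] in measurable)
  also have "\<dots> = a powr (- real k) * heat_lap_norm TYPE('n) k"
    unfolding heat_lap_norm_def by (rule heat_lap_L1[OF a(1)])
  also have "a powr (- real k) * heat_lap_norm TYPE('n) k * (a powr (- \<beta> / 2) * B) = heat_lap_norm TYPE('n) k * a powr (- real k - \<beta> / 2) * B"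
  proof -
    have "a powr (- real k - \<beta> / 2) = a powr (- real k) * a powr (- \<beta> / 2)" by (simp flip: powr_add)
    then show ?thesis by (simp only: mult_ac)
  qed
  also have "a powr (- real k - \<beta> / 2) = 2 powr (real k + \<beta> / 2) * t powr (- real k - \<beta> / 2)"
  proof -
    have "a powr (- (real k + \<beta> / 2)) = t powr (- (real k + \<beta> / 2)) / 2 powr (- (real k + \<beta> / 2))"
      unfolding a_def using t by (simp only: powr_divide)
    also have "\<dots> = 2 powr (real k + \<beta> / 2) * t powr (- (real k + \<beta> / 2))"
      by (simp only: powr_minus divide_inverse inverse_inverse_eq mult.commute)
    finally show ?thesis by (simp only: minus_add_distrib diff_conv_add_uminus)
  qed
  finally show ?thesis by (simp add: lap_const_def mult_ac)
qed

lemma lap_pair_bound_small: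
  assumes t: "t > 0" and \<phi>: "\<phi> \<in> schwartz_space"
  shows "norm (lap_pair i \<phi> t) \<le> (LINT y|lborel. norm ((nlap ^^ i) \<phi> y)) * B * t powr (- \<beta> / 2)"
proof -
  have "norm (lap_pair i \<phi> t) \<le> (LINT y|lborel. norm ((nlap ^^ i) \<phi> y) * (t powr (- \<beta> / 2) * B))"
    unfolding lap_pair_heat_conv[OF t \<phi>]
  proof (rule norm_integral_le_AE)
    show "AE y in lborel. norm ((nlap ^^ i) \<phi> y * heat_conv t u y) \<le> norm ((nlap ^^ i) \<phi> y) * (t powr (- \<beta> / 2) * B)"
      using heat_conv_AE[OF t] by eventually_elim (simp add: norm_mult mult_left_mono)
  qed (intro integrable_mult_left integrable_norm schwartz_integrable nlap_pow_schwartz \<phi>)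
  then show ?thesis by (simp add: mult_ac)
qed

lemma lap_pair_bound_large:
  assumes t: "t > 0" and \<phi>: "\<phi> \<in> schwartz_space"
  shows "norm (lap_pair i \<phi> t) \<le> (LINT y|lborel. norm (\<phi> y)) * (lap_const i * B) * t powr (- real i - \<beta> / 2)"
proof -
  have "norm (lap_pair i \<phi> t) \<le> (LINT y|lborel. norm (\<phi> y) * (lap_const i * B * t powr (- real i - \<beta> / 2)))"
    unfolding lap_pair_heat_lap[OF t \<phi>]
    by (rule norm_integral_le_AE, intro integrable_mult_left integrable_norm schwartz_integrable \<phi>)
       (auto simp: norm_mult intro!: mult_left_mono heat_lap_eval_bound t)
  then show ?thesis by (simp add: mult_ac)
qed

text \<open>\<open>\<sigma> \<ge> n\<close> makes \<open>(\<bar>\<xi>\<bar>\<^sup>2 + \<epsilon>\<^sup>2)\<^bsup>-\<sigma>\<^esup>\<close> integrable, and \<open>\<sigma> > \<beta>/2\<close> makes \<open>t\<^bsup>\<sigma>-1-\<beta>/2\<^esup>\<close> integrable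
  at \<open>0\<close>.\<close>

context
  fixes s \<sigma> :: real and k :: nat
  assumes s: "s > 0" and \<sigma>: "\<sigma> = real k - s / 2" "\<sigma> \<ge> real CARD('n)" "\<sigma> > \<beta> / 2"
begin

lemma \<sigma>_pos: "\<sigma> > 0"
  using \<sigma>(3) \<beta> by linarith

text \<open>Independent of \<epsilon> and split at t = 1. For large t the term with \<epsilon>^(2j)
  has only k - j Laplacians, but exp (-\<epsilon>^2 t) \<epsilon>^(2j) \<le> j^j t^(-j) restores the
  missing decay; hence the same exponent \<sigma> - 1 - k - \<beta>/2 = -s/2 - \<beta>/2 - 1 for all
  j.\<close>

definition majorant :: "nat \<Rightarrow> (real^'n \<Rightarrow> complex) \<Rightarrow> real \<Rightarrow> real" where
  "majorant j \<phi> t = ((LINT y|lborel. norm ((nlap ^^ (k - j)) \<phi> y)) * B) * (half_powr (\<sigma> - 1 - \<beta> / 2) t * indicator {..1} t) +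
     (real j ^ j * ((LINT y|lborel. norm (\<phi> y)) * (lap_const (k - j) * B))) * (half_powr (- s / 2 - \<beta> / 2 - 1) t * indicator {1..} t)"

lemma majorant_integrable: "integrable lborel (majorant j \<phi>)"
  unfolding majorant_def[abs_def]
  by (intro Bochner_Integration.integrable_add integrable_mult_right integrable_half_powr_small integrable_half_powr_large)
     (use s \<sigma> \<beta> in auto)

lemma majorant_bound:
  assumes \<phi>: "\<phi> \<in> schwartz_space" and \<epsilon>: "0 \<le> \<epsilon>" "\<epsilon> < 1" and j: "j \<le> k"
  shows "norm (complex_of_real (exp (- (\<epsilon>\<^sup>2 * t)) * (\<epsilon>\<^sup>2) ^ j) * (complex_of_real (half_powr (\<sigma> - 1) t) * lap_pair (k - j) \<phi> t)) \<le> majorant j \<phi> t"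
proof (cases "t > 0")
  case True
  let ?L = "norm (lap_pair (k - j) \<phi> t)"
  let ?a = "(LINT y|lborel. norm ((nlap ^^ (k - j)) \<phi> y)) * B"
  let ?b = "(LINT y|lborel. norm (\<phi> y)) * (lap_const (k - j) * B)"
  have ab: "?a \<ge> 0" "?b \<ge> 0" using B_nonneg lap_const_nonneg by auto
  have eq: "norm (complex_of_real (exp (- (\<epsilon>\<^sup>2 * t)) * (\<epsilon>\<^sup>2) ^ j) * (complex_of_real (half_powr (\<sigma> - 1) t) * lap_pair (k - j) \<phi> t))
     = (exp (- (\<epsilon>\<^sup>2 * t)) * (\<epsilon>\<^sup>2) ^ j) * (t powr (\<sigma> - 1) * ?L)"
    using True by (simp add: norm_mult norm_power half_powr_pos abs_mult)
  show ?thesis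
  proof (cases "t < 1")
    case t1: True
    have "(exp (- (\<epsilon>\<^sup>2 * t)) * (\<epsilon>\<^sup>2) ^ j) * (t powr (\<sigma> - 1) * ?L) \<le> (1 * 1) * (t powr (\<sigma> - 1) * (?a * t powr (- \<beta> / 2)))"
      using True \<epsilon> ab lap_pair_bound_small[OF True \<phi>, of "k - j"]
      by (intro mult_mono mult_left_mono power_le_one) (auto simp: power_le_one abs_square_le_1)
    also have "\<dots> = ?a * half_powr (\<sigma> - 1 - \<beta> / 2) t"
    proof -
      have "half_powr (\<sigma> - 1 - \<beta> / 2) t = t powr (\<sigma> - 1) * t powr (- \<beta> / 2)"
        unfolding half_powr_pos[OF True] powr_add[symmetric] by simp
      then show ?thesis by (simp only: mult_ac mult_1_left)
    qed
    finally show ?thesis unfolding eq majorant_def using t1 by simp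
  next
    case False
    then have t1: "t \<ge> 1" by simp
    have "(\<epsilon>\<^sup>2 * t) ^ j \<le> real j ^ j * exp (\<epsilon>\<^sup>2 * t)" using True by (intro power_le_exp) auto
    then have "exp (- (\<epsilon>\<^sup>2 * t)) * ((\<epsilon>\<^sup>2) ^ j * t ^ j) \<le> exp (- (\<epsilon>\<^sup>2 * t)) * (real j ^ j * exp (\<epsilon>\<^sup>2 * t))"
      unfolding power_mult_distrib[symmetric] by (rule mult_left_mono) simp
    also have "\<dots> = real j ^ j" by (simp add: exp_minus)
    finally have e: "exp (- (\<epsilon>\<^sup>2 * t)) * (\<epsilon>\<^sup>2) ^ j \<le> real j ^ j * t powr (- real j)"
      using True by (simp add: powr_minus powr_realpow divide_simps mult_ac)
    have "(exp (- (\<epsilon>\<^sup>2 * t)) * (\<epsilon>\<^sup>2) ^ j) * (t powr (\<sigma> - 1) * ?L) \<le> (real j ^ j * t powr (- real j)) * (t powr (\<sigma> - 1) * (?b * t powr (- real (k - j) - \<beta> / 2)))"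
      using True ab lap_pair_bound_large[OF True \<phi>, of "k - j"]
      by (intro mult_mono mult_left_mono e) auto
    also have "\<dots> = (real j ^ j * ?b) * (t powr (- real j) * t powr (\<sigma> - 1) * t powr (- real (k - j) - \<beta> / 2))"
      by (simp only: mult_ac)
    also have "t powr (- real j) * t powr (\<sigma> - 1) * t powr (- real (k - j) - \<beta> / 2) = half_powr (- s / 2 - \<beta> / 2 - 1) t"
      unfolding half_powr_pos[OF True] powr_add[symmetric]
      by (rule arg_cong[where f = "\<lambda>p. t powr p"]) (use j in \<open>simp add: \<sigma>(1) of_nat_diff algebra_simps\<close>)
    also have "(real j ^ j * ?b) * half_powr (- s / 2 - \<beta> / 2 - 1) t \<le> majorant j \<phi> t"
      unfolding majorant_def using t1 ab by (simp add: half_powr_nonneg)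
    finally show ?thesis unfolding eq .
  qed
qed (simp add: half_powr_def majorant_def)

text \<open>\<open>u\<close> is first pulled through the convolution with the Bessel kernel, and
  only then is the kernel unfolded into heat kernels; this is allowed because
  \<open>shift_eval\<close> has polynomial growth. The binomial expansion isolates the dependence on
  \<epsilon>.\<close>

lemma regularised_eq:
  assumes \<phi>: "\<phi> \<in> schwartz_space" and \<epsilon>: "0 < \<epsilon>" "\<epsilon> < 1"
  shows "u (fourier (\<lambda>\<xi>. complex_of_real (((norm \<xi>)\<^sup>2 + \<epsilon>\<^sup>2) powr (s / 2)) * inverse_fourier \<phi> \<xi>)) =
    complex_of_real (1 / Gamma \<sigma>) * (\<Sum>j\<le>k. complex_of_real (real (k choose j)) *
      (LINT t|lborel. complex_of_real (exp (- (\<epsilon>\<^sup>2 * t)) * (\<epsilon>\<^sup>2) ^ j) * (complex_of_real (half_powr (\<sigma> - 1) t) * lap_pair (k - j) \<phi> t)))"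
proof -
  let ?\<psi> = "shifted_nlap \<epsilon> k \<phi>"
  note \<psi> = shifted_nlap_schwartz[OF \<phi>, of \<epsilon> k]
  note md = bessel_kernel_moment_density[OF \<sigma>_pos \<epsilon>(1)]
  let ?c = "\<lambda>j. complex_of_real (real (k choose j) * (\<epsilon>\<^sup>2) ^ j)"
  let ?F = "\<lambda>j t. complex_of_real (exp (- (\<epsilon>\<^sup>2 * t)) * (\<epsilon>\<^sup>2) ^ j) * (complex_of_real (half_powr (\<sigma> - 1) t) * lap_pair (k - j) \<phi> t)"
  have conv: "u (conv (heat t) ?\<psi>) = (\<Sum>j\<le>k. ?c j * lap_pair (k - j) \<phi> t)" if t: "t > 0" for t
  proof -
    note h = schwartz_moment_density[OF heat_schwartz[OF t]]
    have "conv (heat t) ?\<psi> = (\<lambda>x. \<Sum>j\<le>k. ?c j * conv (heat t) ((nlap ^^ (k - j)) \<phi>) x)"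
      unfolding shifted_nlap_def[abs_def] by (intro conv_sum moment_density_tempered h nlap_pow_schwartz \<phi>)
    then show ?thesis unfolding lap_pair_def
      using u_sum[of "{..k}" "\<lambda>j. conv (heat t) ((nlap ^^ (k - j)) \<phi>)" ?c] conv_schwartz[OF h nlap_pow_schwartz[OF \<phi>]] by simp
  qed
  obtain C m where C: "\<And>z. norm (shift_eval ?\<psi> z) \<le> C * (1 + norm z) ^ m" using shift_eval_bound[OF \<psi>] by blast
  have "u (fourier (\<lambda>\<xi>. complex_of_real (((norm \<xi>)\<^sup>2 + \<epsilon>\<^sup>2) powr (s / 2)) * inverse_fourier \<phi> \<xi>)) =
     complex_of_real (1 / Gamma \<sigma>) * u (conv (bessel_kernel \<sigma> \<epsilon>) ?\<psi>)"
    unfolding fourier_multiplier_conv[OF \<phi> \<epsilon>(1) \<sigma>(2,1)] by (rule u_cmult[OF conv_schwartz[OF md \<psi>]])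
  also have "u (conv (bessel_kernel \<sigma> \<epsilon>) ?\<psi>) = (LINT z|lborel. bessel_kernel \<sigma> \<epsilon> z * shift_eval ?\<psi> z)"
    by (rule u_conv(2)[OF md \<psi>])
  also have "\<dots> = (LINT t|lborel. complex_of_real (half_powr (\<sigma> - 1) t * exp (- (\<epsilon>\<^sup>2 * t))) * (LINT z|lborel. heat t z * shift_eval ?\<psi> z))"
    by (rule bessel_fubini(2)[OF \<sigma>_pos \<epsilon>(1) shift_eval_measurable[OF \<psi>] C])
  also have "\<dots> = (LINT t|lborel. (\<Sum>j\<le>k. complex_of_real (real (k choose j)) * ?F j t))"
  proof (rule Bochner_Integration.integral_cong[OF refl])
    fix t
    show "complex_of_real (half_powr (\<sigma> - 1) t * exp (- (\<epsilon>\<^sup>2 * t))) * (LINT z|lborel. heat t z * shift_eval ?\<psi> z) = (\<Sum>j\<le>k. complex_of_real (real (k choose j)) * ?F j t)"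
    proof (cases "t > 0")
      case True
      have "(LINT z|lborel. heat t z * shift_eval ?\<psi> z) = u (conv (heat t) ?\<psi>)"
        by (rule u_conv(2)[OF schwartz_moment_density[OF heat_schwartz[OF True]] \<psi>, symmetric])
      then show ?thesis unfolding conv[OF True] by (simp only: sum_distrib_left) (intro sum.cong refl, simp add: mult_ac)
    qed (simp add: half_powr_def)
  qed
  also have "\<dots> = (\<Sum>j\<le>k. complex_of_real (real (k choose j)) * (LINT t|lborel. ?F j t))"
  proof (subst Bochner_Integration.integral_sum)
    fix j assume j: "j \<in> {..k}"
    note [measurable] = half_powr_lap_pair_measurable[OF \<phi>, of "\<sigma> - 1" "k - j"]
    show "integrable lborel (\<lambda>t. complex_of_real (real (k choose j)) * ?F j t)"
    proof (intro integrable_mult_right Bochner_Integration.integrable_bound[OF majorant_integrable[of j \<phi>]])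
      show "?F j \<in> borel_measurable lborel" by measurable
      show "AE t in lborel. norm (?F j t) \<le> norm (majorant j \<phi> t)"
        unfolding real_norm_def using \<epsilon> j by (intro AE_I2 order_trans[OF majorant_bound[OF \<phi>] abs_ge_self]) auto
    qed
  qed (simp only: integral_mult_right_zero)
  finally show ?thesis .
qed

lemma frac_laplacian_eq:
  assumes \<phi>: "\<phi> \<in> schwartz_space"
  shows "frac_laplacian s u \<phi> = complex_of_real (1 / Gamma \<sigma>) * (LINT t|lborel. complex_of_real (half_powr (\<sigma> - 1) t) * lap_pair k \<phi> t)"
proof -
  \<comment> \<open>The expected termwise limits: (\<epsilon>^2)^j tends to 0 for j > 0 and is
    identically 1 for j = 0, so only the full power k of -\<Delta> survives.\<close>
  let ?L = "\<lambda>j. LINT t|lborel. (if j = 0 then 1 else 0) * (complex_of_real (half_powr (\<sigma> - 1) t) * lap_pair (k - j) \<phi> t)"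
  let ?X = "\<lambda>\<epsilon>. u (fourier (\<lambda>\<xi>. complex_of_real (((norm \<xi>)\<^sup>2 + \<epsilon>\<^sup>2) powr (s / 2)) * inverse_fourier \<phi> \<xi>))"
  have "(?X \<longlongrightarrow> complex_of_real (1 / Gamma \<sigma>) * (\<Sum>j\<le>k. complex_of_real (real (k choose j)) * ?L j)) (at_right 0)"
  \<comment> \<open>Dominated convergence speaks of sequences; the bound b = 1 keeps \<epsilon> in
    the range covered by \<open>majorant_bound\<close>.\<close>
  proof (rule tendsto_at_right_sequentially[where b = 1])
    fix S :: "nat \<Rightarrow> real"
    assume S: "\<And>n. 0 < S n" "\<And>n. S n < 1" "S \<longlonglongrightarrow> 0"
    have S2: "(\<lambda>n. (S n)\<^sup>2) \<longlonglongrightarrow> 0" using tendsto_power[OF S(3), of 2] by simp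
    show "(\<lambda>n. ?X (S n)) \<longlonglongrightarrow> complex_of_real (1 / Gamma \<sigma>) * (\<Sum>j\<le>k. complex_of_real (real (k choose j)) * ?L j)"
      unfolding regularised_eq[OF \<phi> S(1,2)]
    proof (intro tendsto_mult_left tendsto_sum)
      fix j assume j: "j \<in> {..k}"
      note [measurable] = half_powr_lap_pair_measurable[OF \<phi>, of "\<sigma> - 1" "k - j"]
      let ?H = "\<lambda>t. complex_of_real (half_powr (\<sigma> - 1) t) * lap_pair (k - j) \<phi> t"
      show "(\<lambda>n. LINT t|lborel. complex_of_real (exp (- ((S n)\<^sup>2 * t)) * ((S n)\<^sup>2) ^ j) * ?H t) \<longlonglongrightarrow> ?L j"
      proof (rule integral_dominated_convergence[OF _ _ majorant_integrable[of j \<phi>]])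
        show "AE t in lborel. norm (complex_of_real (exp (- ((S n)\<^sup>2 * t)) * ((S n)\<^sup>2) ^ j) * ?H t) \<le> majorant j \<phi> t" for n
          using j S(1,2)[of n] by (intro AE_I2 majorant_bound \<phi>) auto
        show "AE t in lborel. (\<lambda>n. complex_of_real (exp (- ((S n)\<^sup>2 * t)) * ((S n)\<^sup>2) ^ j) * ?H t) \<longlonglongrightarrow> (if j = 0 then 1 else 0) * ?H t"
        proof (rule AE_I2)
          fix t
          have "(\<lambda>n. exp (- ((S n)\<^sup>2 * t)) * ((S n)\<^sup>2) ^ j) \<longlonglongrightarrow> exp (- (0 * t)) * 0 ^ j"
            by (intro tendsto_intros S2)
          then have "(\<lambda>n. complex_of_real (exp (- ((S n)\<^sup>2 * t)) * ((S n)\<^sup>2) ^ j)) \<longlonglongrightarrow> complex_of_real (if j = 0 then 1 else 0)"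
            by (intro tendsto_of_real) (simp add: power_0_left)
          from tendsto_mult_right[OF this, of "?H t"]
          show "(\<lambda>n. complex_of_real (exp (- ((S n)\<^sup>2 * t)) * ((S n)\<^sup>2) ^ j) * ?H t) \<longlonglongrightarrow> (if j = 0 then 1 else 0) * ?H t"
            by (cases "j = 0") simp_all
        qed
      qed measurable
    qed
  qed simp
  then have "Lim (at_right 0) ?X = complex_of_real (1 / Gamma \<sigma>) * (\<Sum>j\<le>k. complex_of_real (real (k choose j)) * ?L j)"
    by (intro tendsto_Lim) simp_all
  also have "(\<Sum>j\<le>k. complex_of_real (real (k choose j)) * ?L j) = (\<Sum>j\<le>k. if j = 0 then (LINT t|lborel. complex_of_real (half_powr (\<sigma> - 1) t) * lap_pair k \<phi> t) else 0)"
    by (intro sum.cong) auto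
  also have "\<dots> = (LINT t|lborel. complex_of_real (half_powr (\<sigma> - 1) t) * lap_pair k \<phi> t)"
    by (simp add: sum.delta)
  finally show ?thesis
    by (simp add: frac_laplacian_def inverse_fourier_dist_def times_norm_powr_def fourier_dist_def)
qed

end

end

subsection \<open>The continuous representative\<close>

text \<open>With q = 1 / sqrt t \<ge> 1, scaling produces powers of q that blow up as t tends to 0.
  At distance at least 1 from the origin q \<le> 1 + |q z|, so the Schwartz decay of the kernel at
  time 1 absorbs them.\<close>

lemma heat_lap_far_bound:
  "\<exists>E\<ge>0. \<forall>t z. \<forall>js :: 'n::finite list. 0 < t \<longrightarrow> t \<le> 1 \<longrightarrow> 1 \<le> norm z \<longrightarrow> length js \<le> m \<longrightarrow>
     (1 + norm z) ^ K * norm (iterated_partial js (heat_lap k t :: real^'n \<Rightarrow> complex) z) \<le> E"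
proof -
  let ?H = "heat_lap k 1 :: real^'n \<Rightarrow> complex"
  define M where "M = CARD('n) + 2 * k + m"
  have H: "?H \<in> schwartz_space" by (rule heat_lap_schwartz) simp
  define p where "p = schwartz_seminorm (M + K) m ?H"
  have p: "p \<ge> 0" unfolding p_def by (rule schwartz_seminorm_nonneg[OF H])
  have "(1 + norm z) ^ K * norm (iterated_partial js (heat_lap k t :: real^'n \<Rightarrow> complex) z) \<le> p"
    if t: "0 < t" "t \<le> 1" and z: "1 \<le> norm z" and l: "length js \<le> m" for t z and js :: "'n list"
  proof -
    define q where "q = 1 / sqrt t"
    have q: "q \<ge> 1" using t by (simp add: q_def)
    have tq: "t powr (- real CARD('n) / 2 - real k) = q ^ (CARD('n) + 2 * k)"
    proof -
      have "q = t powr (- 1 / 2)" using t by (simp add: q_def powr_minus powr_half_sqrt inverse_eq_divide)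
      then have "q ^ (CARD('n) + 2 * k) = (t powr (- 1 / 2)) powr real (CARD('n) + 2 * k)"
        using t by (simp only: powr_realpow[symmetric] powr_gt_zero)
      also have "\<dots> = t powr (- real CARD('n) / 2 - real k)"
        unfolding powr_powr by (rule arg_cong[where f = "\<lambda>p. t powr p"]) (simp add: field_simps)
      finally show ?thesis ..
    qed
    have "iterated_partial js (heat_lap k t) z = complex_of_real (q ^ (CARD('n) + 2 * k)) * (q ^ length js *\<^sub>R iterated_partial js ?H (q *\<^sub>R z + 0))"
      unfolding heat_lap_scale[OF t(1), of k] tq q_def[symmetric]
      by (simp only: iterated_partial_bounded_linear[OF bounded_linear_mult_right smooth_affine[OF schwartz_smooth[OF H]]]
        iterated_partial_affine[OF schwartz_smooth[OF H]])
    then have n: "norm (iterated_partial js (heat_lap k t) z) = q ^ (CARD('n) + 2 * k + length js) * norm (iterated_partial js ?H (q *\<^sub>R z))"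
      using q by (simp add: norm_mult norm_power power_add)
    have r: "1 + norm z \<le> 1 + norm (q *\<^sub>R z)" "q \<le> 1 + norm (q *\<^sub>R z)"
    proof -
      have "1 * norm z \<le> q * norm z" "q * 1 \<le> q * norm z"
        using q z by (intro mult_right_mono mult_left_mono; simp)+
      moreover have "norm (q *\<^sub>R z) = q * norm z" using q by simp
      ultimately show "1 + norm z \<le> 1 + norm (q *\<^sub>R z)" "q \<le> 1 + norm (q *\<^sub>R z)" by linarith+
    qed
    have "(1 + norm z) ^ K * norm (iterated_partial js (heat_lap k t) z) \<le> (1 + norm (q *\<^sub>R z)) ^ K * ((1 + norm (q *\<^sub>R z)) ^ M * norm (iterated_partial js ?H (q *\<^sub>R z)))"
    proof -
      have "q ^ (CARD('n) + 2 * k + length js) \<le> q ^ M" using q l by (intro power_increasing) (auto simp: M_def)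
      also have "\<dots> \<le> (1 + norm (q *\<^sub>R z)) ^ M" using r q by (intro power_mono) auto
      finally show ?thesis unfolding n using r q by (intro mult_mono power_mono) (auto intro!: mult_nonneg_nonneg zero_le_power)
    qed
    also have "\<dots> = (1 + norm (q *\<^sub>R z)) ^ (M + K) * norm (iterated_partial js ?H (q *\<^sub>R z))"
      by (simp add: power_add mult_ac)
    also have "\<dots> \<le> p" unfolding p_def by (rule schwartz_seminorm_upper[OF H l])
    finally show ?thesis .
  qed
  then show ?thesis using p by blast
qed

context smooth_tempered
begin

text \<open>The pseudo-local property: near \<open>y\<close> the smoothness of \<open>f\<close> controls \<open>(-\<Delta>)\<^sup>k h\<^sub>t * u\<close>
  as \<open>t \<rightarrow> 0\<close>, while far from \<open>y\<close> the kernel is uniformly small.\<close>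

lemma heat_lap_eval_local_bound:
  assumes R: "R \<ge> 0"
  shows "\<exists>C\<ge>0. \<forall>t y. 0 < t \<longrightarrow> t \<le> 1 \<longrightarrow> norm y \<le> R \<longrightarrow> norm (heat_lap_eval k t y) \<le> C"
proof -
  \<comment> \<open>If |y| \<le> R and |x| \<ge> R + 1 then |x - y| \<ge> 1, as the far bound
    requires.\<close>
  define r where "r = R + 1"
  have r: "r \<ge> 1" "r > 0" using R by (simp_all add: r_def)
  define \<phi> where "\<phi> x = f x * ccutoff r x" for x
  have \<phi>t: "\<phi> \<in> test_functions" unfolding \<phi>_def[abs_def] by (intro test_function_mult smooth_f cutoff_test0 r)
  then have \<phi>: "\<phi> \<in> schwartz_space" using test_functions_schwartz by blast
  obtain D where D: "D \<ge> 0" "\<And>x. norm ((nlap ^^ k) \<phi> x) \<le> D"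
    using schwartz_bound[OF nlap_pow_schwartz[OF \<phi>], of 0 "[]" k] by auto
  obtain C K m where C: "C \<ge> 0" "\<forall>\<phi>\<in>schwartz_space. norm (u \<phi>) \<le> C * schwartz_seminorm K m \<phi>" using u_bound by blast
  obtain A where A: "A \<ge> 0" "\<forall>r\<ge>1. \<forall>is x. length is \<le> m \<longrightarrow> norm (iterated_partial is (\<lambda>x :: real^'n. 1 - ccutoff r x) x) \<le> A"
    using cocutoff_deriv_bound by blast
  obtain E where E: "E \<ge> 0" "\<And>t z js. 0 < t \<Longrightarrow> t \<le> 1 \<Longrightarrow> 1 \<le> norm z \<Longrightarrow> length js \<le> m \<Longrightarrow>
     (1 + norm z) ^ K * norm (iterated_partial js (heat_lap k t :: real^'n \<Rightarrow> complex) z) \<le> E"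
    using heat_lap_far_bound[where 'n = 'n, of m K k] by blast
  define F where "F = 2 ^ m * A * (1 + R) ^ K * E"
  have F: "F \<ge> 0" using A E R by (simp add: F_def)
  have "norm (heat_lap_eval k t y) \<le> D + C * F" if t: "0 < t" "t \<le> 1" and y: "norm y \<le> R" for t y
  proof -
    let ?\<Psi> = "\<lambda>x. heat_lap k t (x - y)"
    have S: "?\<Psi> \<in> schwartz_space" by (intro schwartz_translate heat_lap_schwartz t)
    \<comment> \<open>Near part: \<open>f\<close> times the cutoff is a test function, the
      Laplacians move onto it, and averaging with the heat kernel of mass 1 preserves its sup
      bound.\<close>
    have 1: "norm (u (\<lambda>x. ccutoff r x * ?\<Psi> x)) \<le> D"
    proof -
      have "u (\<lambda>x. ccutoff r x * ?\<Psi> x) = (LINT x|lborel. f x * (ccutoff r x * ?\<Psi> x))"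
        by (rule u_test[OF schwartz_cutoff_mult[OF S r(2)]])
      also have "\<dots> = conv \<phi> (heat_lap k t) y"
        unfolding conv_def \<phi>_def by (simp add: heat_lap_even[OF t(1), of k _ y] mult.assoc)
      also have "\<dots> = conv (heat t) ((nlap ^^ k) \<phi>) y" by (simp only: conv_heat_nlap[OF t(1) \<phi>])
      also have "norm \<dots> \<le> (LINT z|lborel. heat_kernel t (z :: real^'n) * D)"
        unfolding conv_def
      proof (rule norm_integral_le_AE)
        show "integrable lborel (\<lambda>z :: real^'n. heat_kernel t z * D)"
          by (intro integrable_mult_left heat_kernel_integrable t)
        show "AE z in lborel. norm (heat t z * (nlap ^^ k) \<phi> (y - z)) \<le> heat_kernel t z * D"
          using D by (intro AE_I2) (auto simp: norm_mult heat_kernel_nonneg intro!: mult_left_mono)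
      qed
      also have "\<dots> = D" by (simp add: heat_kernel_integral[OF t(1)])
      finally show ?thesis .
    qed
    \<comment> \<open>Far part: inside radius r the complementary cutoff vanishes with all
      derivatives; outside, the kernel is small, and moving the weight from x to x - y costs (1 +
      R)^K.\<close>
    have "schwartz_seminorm K m (\<lambda>x. (1 - ccutoff r x) * ?\<Psi> x) \<le> F"
    proof (rule schwartz_seminorm_least)
      fix js :: "'n list" and x :: "real^'n" assume l: "length js \<le> m"
      show "(1 + norm x) ^ K * norm (iterated_partial js (\<lambda>x. (1 - ccutoff r x) * ?\<Psi> x) x) \<le> F"
      proof (cases "norm x < r")
        case True
        have "norm (iterated_partial js (\<lambda>x. (1 - ccutoff r x) * ?\<Psi> x) x) \<le> 2 ^ length js * (0 * schwartz_seminorm 0 m ?\<Psi>)"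
        proof (rule iterated_partial_mult_bound[OF cocutoff_smooth schwartz_smooth[OF S]])
          show "norm (iterated_partial ks (\<lambda>x. 1 - ccutoff r x) x) \<le> 0" for ks
            by (simp add: cocutoff_deriv_zero[OF r(2) True])
          show "norm (iterated_partial ks ?\<Psi> x) \<le> schwartz_seminorm 0 m ?\<Psi>" if "length ks \<le> length js" for ks
            using schwartz_seminorm_upper[OF S, of ks m x 0] that l by simp
        qed
        then show ?thesis using F by simp
      next
        case False
        have "norm x \<le> norm y + norm (x - y)" using norm_triangle_ineq[of y "x - y"] by simp
        then have far: "1 \<le> norm (x - y)" using False y by (simp add: r_def)
        have pos: "(1 + norm (x - y)) ^ K > 0" by (simp add: add_pos_nonneg)
        have "norm (iterated_partial js (\<lambda>x. (1 - ccutoff r x) * ?\<Psi> x) x) \<le> 2 ^ length js * (A * (E / (1 + norm (x - y)) ^ K))"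
        proof (rule iterated_partial_mult_bound[OF cocutoff_smooth schwartz_smooth[OF S]])
          show "norm (iterated_partial ks (\<lambda>x. 1 - ccutoff r x) x) \<le> A" if "length ks \<le> length js" for ks
            using A r that l by simp
          show "norm (iterated_partial ks ?\<Psi> x) \<le> E / (1 + norm (x - y)) ^ K" if "length ks \<le> length js" for ks
          proof -
            have "iterated_partial ks ?\<Psi> x = iterated_partial ks (heat_lap k t) (x - y)"
              using iterated_partial_affine[OF schwartz_smooth[OF heat_lap_schwartz[OF t(1)]], of ks k 1 "- y"] by simp
            then show ?thesis using E(2)[OF t far, of ks] that l pos by (simp add: pos_le_divide_eq mult.commute)
          qed
        qed
        also have "\<dots> \<le> 2 ^ m * (A * (E / (1 + norm (x - y)) ^ K))"
          using l A E pos by (intro mult_right_mono power_increasing) (auto intro!: mult_nonneg_nonneg divide_nonneg_pos)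
        finally have "(1 + norm x) ^ K * norm (iterated_partial js (\<lambda>x. (1 - ccutoff r x) * ?\<Psi> x) x) \<le>
            ((1 + R) * (1 + norm (x - y))) ^ K * (2 ^ m * (A * (E / (1 + norm (x - y)) ^ K)))"
        proof (rule mult_mono[rotated])
          have "1 + norm x \<le> (1 + norm y) * (1 + norm (x - y))" by (rule one_norm_translate)
          also have "\<dots> \<le> (1 + R) * (1 + norm (x - y))" using y by (intro mult_right_mono) auto
          finally show "(1 + norm x) ^ K \<le> ((1 + R) * (1 + norm (x - y))) ^ K" by (rule power_mono) simp
        qed (use R in auto)
        also have "\<dots> = F"
        proof -
          have "1 + norm (x - y) \<noteq> 0" using norm_ge_zero[of "x - y"] by linarith
          then show ?thesis by (simp add: F_def power_mult_distrib)
        qed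
        finally show ?thesis .
      qed
    qed
    then have "norm (u (\<lambda>x. (1 - ccutoff r x) * ?\<Psi> x)) \<le> C * F"
      using C cutoff_split(1)[OF S r(1)] mult_left_mono order_trans by meson
    then show ?thesis
      using 1 unfolding heat_lap_eval_def shift_eval_def cutoff_split(2)[OF S r(1)]
      by (intro norm_triangle_le) linarith
  qed
  then show ?thesis using D C F by (intro exI[of _ "D + C * F"]) auto
qed

lemma half_powr_heat_lap_measurable2:
  "(\<lambda>(t, y). complex_of_real (half_powr a t) * heat_lap_eval k t y) \<in> borel_measurable (borel \<Otimes>\<^sub>M borel)"
proof -
  have "(\<lambda>(t, y). complex_of_real (half_powr a t) * heat_lap_eval k t y) =
      (\<lambda>p. complex_of_real (fst p powr a) * (case p of (t, y) \<Rightarrow> complex_of_real (indicator {0<..} t) * heat_lap_eval k t y))"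
    by (simp add: half_powr_def mult_ac split_beta')
  also have "\<dots> \<in> borel_measurable (borel \<Otimes>\<^sub>M borel)" by measurable
  finally show ?thesis .
qed

lemma half_powr_heat_lap_measurable:
  "(\<lambda>t. complex_of_real (half_powr a t) * heat_lap_eval k t y) \<in> borel_measurable borel"
  using measurable_compose[of "\<lambda>t. (t, y)" borel "borel \<Otimes>\<^sub>M borel", OF _ half_powr_heat_lap_measurable2[of a k]] by simp

end

section \<open>Uniqueness of the continuous representative\<close>

lemma test_function_support:
  assumes "\<phi> \<in> test_functions"
  shows "\<exists>R\<ge>0. \<forall>x. R < norm x \<longrightarrow> \<phi> x = 0"
proof -
  have "bounded {x. \<phi> x \<noteq> 0}"
    using assms compact_imp_bounded bounded_subset[OF _ closure_subset] by (auto simp: test_functions_def)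
  then obtain R where R: "\<forall>x\<in>{x. \<phi> x \<noteq> 0}. norm x \<le> R" unfolding bounded_iff by blast
  then have "\<forall>x. max R 0 < norm x \<longrightarrow> \<phi> x = 0" by force
  then show ?thesis by (intro exI[of _ "max R 0"]) simp
qed

lemma continuous_test_integrable:
  fixes d :: "real^'n::finite \<Rightarrow> complex"
  assumes d: "continuous_on UNIV d" and \<phi>: "\<phi> \<in> test_functions"
  shows "integrable lborel (\<lambda>x. d x * \<phi> x)"
proof -
  obtain R where R: "\<forall>x. R < norm x \<longrightarrow> \<phi> x = 0" using test_function_support[OF \<phi>] by blast
  have "bounded (d ` cball 0 R)"
    using d by (intro compact_imp_bounded compact_continuous_image) (auto intro: continuous_on_subset)
  then obtain M where M: "\<forall>y\<in>d ` cball 0 R. norm y \<le> M" unfolding bounded_iff by blast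
  have s: "\<phi> \<in> schwartz_space" using \<phi> test_functions_schwartz by blast
  have [measurable]: "d \<in> borel_measurable borel" "\<phi> \<in> borel_measurable borel"
    using d schwartz_measurable[OF s] by (auto intro: borel_measurable_continuous_onI)
  show ?thesis
  proof (rule Bochner_Integration.integrable_bound[OF integrable_mult_right[OF schwartz_integrable[OF s], of "complex_of_real M"]])
    show "AE x in lborel. norm (d x * \<phi> x) \<le> norm (complex_of_real M * \<phi> x)"
    proof (rule AE_I2)
      fix x
      show "norm (d x * \<phi> x) \<le> norm (complex_of_real M * \<phi> x)"
      proof (cases "norm x \<le> R")
        case True
        then have "norm (d x) \<le> \<bar>M\<bar>" using M by (metis abs_ge_self dist_0_norm image_eqI mem_cball order_trans)
        then show ?thesis by (simp add: norm_mult mult_right_mono)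
      qed (use R in simp)
    qed
  qed measurable
qed

text \<open>This makes the definite description usable: the difference of two continuous
  representatives integrates to 0 against every test function and hence vanishes.\<close>

lemma continuous_representative_eq:
  assumes g: "continuous_on UNIV g" "represents v g"
  shows "continuous_representative v = g"
  unfolding continuous_representative_def
proof (rule the_equality)
  show "continuous_on UNIV g \<and> represents v g" using g by blast
  fix g' assume g': "continuous_on UNIV g' \<and> represents v g'"
  have "g' x - g x = 0" for x
  proof (rule test_integral_zero_imp_zero[where d = "\<lambda>x. g' x - g x"])
    show "continuous_on UNIV (\<lambda>x. g' x - g x)" using g g' by (intro continuous_intros) auto
    fix \<phi> :: "real^'a \<Rightarrow> complex" assume \<phi>: "\<phi> \<in> test_functions"
    note i = continuous_test_integrable[OF _ \<phi>]
    have ii: "integrable lborel (\<lambda>x. g' x * \<phi> x)" "integrable lborel (\<lambda>x. g x * \<phi> x)"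
      using i g g' by blast+
    show "integrable lborel (\<lambda>x. (g' x - g x) * \<phi> x)"
      unfolding left_diff_distrib by (rule Bochner_Integration.integrable_diff[OF ii])
    have "(LINT x|lborel. g' x * \<phi> x) = (LINT x|lborel. g x * \<phi> x)"
      using g(2) g' \<phi> unfolding represents_def by metis
    then show "(LINT x|lborel. (g' x - g x) * \<phi> x) = 0"
      unfolding left_diff_distrib by (simp add: Bochner_Integration.integral_diff[OF ii])
  qed
  then show "g' = g" by (intro ext) simp
qed

section \<open>The heat integral is continuous and represents the fractional Laplacian\<close>

context besov_fun
begin

text \<open>Half of the time makes \<open>u\<close> an essentially bounded function, the other half
  convolves it with a Schwartz kernel, so the result is even smooth.\<close>

lemma heat_lap_eval_continuous:
  assumes t: "t > 0"
  shows "continuous_on UNIV (heat_lap_eval k t)"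
proof -
  define a where "a = t / 2"
  have a: "a > 0" "t = a + a" using t by (simp_all add: a_def)
  have w: "tempered_density (heat_conv a u)"
    by (rule bounded_tempered_density[OF heat_conv_measurable heat_conv_AE]) (rule a)+
  have "heat_lap_eval k t = conv (heat_conv a u) (heat_lap k a)"
    unfolding a(2) heat_lap_eval_semigroup[OF a(1) a(1), abs_def] conv_def
    by (rule ext) (simp add: heat_lap_eval_semigroup[OF a(1) a(1)] heat_lap_even[OF a(1), of k] mult.commute)
  then show ?thesis using smooth_continuous[OF smooth_conv[OF w heat_lap_schwartz[OF a(1)]]] by simp
qed

text \<open>For \<open>\<sigma> = k - s/2\<close> this will be the continuous representative of \<open>(-\<Delta>)\<^bsup>s/2\<^esup> u\<close>.\<close>

definition lap_repr :: "nat \<Rightarrow> real \<Rightarrow> real^'n \<Rightarrow> complex" where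
  "lap_repr k \<sigma> y = complex_of_real (1 / Gamma \<sigma>) * (LINT t|lborel. complex_of_real (half_powr (\<sigma> - 1) t) * heat_lap_eval k t y)"

context
  fixes s \<sigma> :: real and k :: nat
  assumes s: "s > 0" and \<sigma>: "\<sigma> = real k - s / 2" "\<sigma> \<ge> real CARD('n)" "\<sigma> > \<beta> / 2"
begin

text \<open>Near t = 0 the Besov rate would give t^(-s/2 - \<beta>/2 - 1), which is not integrable;
  the local bound from smoothness of \<open>f\<close> replaces it. The price is that D depends on
  the ball.\<close>

lemma lap_repr_majorant:
  assumes "R \<ge> 0"
  shows "\<exists>D. integrable lborel D \<and> (\<forall>t y. norm y \<le> R \<longrightarrow> norm (complex_of_real (half_powr (\<sigma> - 1) t) * heat_lap_eval k t y) \<le> D t)"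
proof -
  obtain C where C: "C \<ge> 0" "\<forall>t y. 0 < t \<longrightarrow> t \<le> 1 \<longrightarrow> norm y \<le> R \<longrightarrow> norm (heat_lap_eval k t y) \<le> C"
    using heat_lap_eval_local_bound[OF assms] by blast
  define D where "D t = C * (half_powr (\<sigma> - 1) t * indicator {..1} t) + (lap_const k * B) * (half_powr (- s / 2 - \<beta> / 2 - 1) t * indicator {1..} t)" for t
  have "integrable lborel D" unfolding D_def[abs_def]
    by (intro Bochner_Integration.integrable_add integrable_mult_right integrable_half_powr_small integrable_half_powr_large)
       (use s \<sigma> \<beta> in auto)
  moreover have "norm (complex_of_real (half_powr (\<sigma> - 1) t) * heat_lap_eval k t y) \<le> D t" if y: "norm y \<le> R" for t y
  proof (cases "t > 0")
    case t: True
    have nn: "0 \<le> lap_const k * B" using lap_const_nonneg B_nonneg by simp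
    have eq: "norm (complex_of_real (half_powr (\<sigma> - 1) t) * heat_lap_eval k t y) = half_powr (\<sigma> - 1) t * norm (heat_lap_eval k t y)"
      by (simp add: norm_mult half_powr_nonneg)
    show ?thesis
    proof (cases "t < 1")
      case True
      then have "half_powr (\<sigma> - 1) t * norm (heat_lap_eval k t y) \<le> half_powr (\<sigma> - 1) t * C"
        using C t y by (intro mult_left_mono half_powr_nonneg) auto
      then show ?thesis unfolding eq D_def using True by (simp add: mult.commute)
    next
      case False
      have "half_powr (\<sigma> - 1) t * norm (heat_lap_eval k t y) \<le> half_powr (\<sigma> - 1) t * (lap_const k * B * t powr (- real k - \<beta> / 2))"
        by (intro mult_left_mono half_powr_nonneg heat_lap_eval_bound t)
      also have "\<dots> = (lap_const k * B) * (t powr (\<sigma> - 1) * t powr (- real k - \<beta> / 2))"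
        unfolding half_powr_pos[OF t] by (simp only: mult_ac)
      also have "t powr (\<sigma> - 1) * t powr (- real k - \<beta> / 2) = half_powr (- s / 2 - \<beta> / 2 - 1) t"
        unfolding half_powr_pos[OF t] powr_add[symmetric]
        by (rule arg_cong[where f = "\<lambda>p. t powr p"]) (simp add: \<sigma>(1))
      finally have "half_powr (\<sigma> - 1) t * norm (heat_lap_eval k t y) \<le> (lap_const k * B) * half_powr (- s / 2 - \<beta> / 2 - 1) t" .
      then show ?thesis unfolding eq D_def using False C(1) by (simp add: half_powr_nonneg add_increasing)
    qed
  qed (simp add: half_powr_def D_def)
  ultimately show ?thesis by blast
qed

lemma lap_repr_integrable: "integrable lborel (\<lambda>t. complex_of_real (half_powr (\<sigma> - 1) t) * heat_lap_eval k t y)"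
proof -
  obtain D where D: "integrable lborel D" "\<forall>t z. norm z \<le> norm y \<longrightarrow> norm (complex_of_real (half_powr (\<sigma> - 1) t) * heat_lap_eval k t z) \<le> D t"
    using lap_repr_majorant[of "norm y"] by auto
  show ?thesis
  proof (rule Bochner_Integration.integrable_bound[OF D(1)])
    show "AE t in lborel. norm (complex_of_real (half_powr (\<sigma> - 1) t) * heat_lap_eval k t y) \<le> norm (D t)"
      unfolding real_norm_def using D(2) by (intro AE_I2) (auto intro: order_trans[OF _ abs_ge_self])
  qed (simp add: half_powr_heat_lap_measurable)
qed

text \<open>A convergent sequence stays in one ball, so a single local majorant serves for dominated
  convergence.\<close>

lemma lap_repr_continuous: "continuous_on UNIV (lap_repr k \<sigma>)"
proof (intro continuous_at_imp_continuous_on ballI)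
  fix y0 :: "real^'n"
  show "isCont (lap_repr k \<sigma>) y0"
    unfolding continuous_at_sequentially
  proof (intro allI impI)
    fix Y assume Y: "Y \<longlonglongrightarrow> y0"
    have "bounded (range Y)" using Y convergent_imp_bounded by (auto simp: convergent_def)
    then obtain R where R: "\<forall>y\<in>range Y. norm y \<le> R" unfolding bounded_iff by blast
    then have R': "\<And>n. norm (Y n) \<le> max R 0" by (auto simp: le_max_iff_disj)
    obtain D where D: "integrable lborel D" "\<forall>t z. norm z \<le> max R 0 \<longrightarrow> norm (complex_of_real (half_powr (\<sigma> - 1) t) * heat_lap_eval k t z) \<le> D t"
      using lap_repr_majorant[of "max R 0"] by auto
    have "(\<lambda>n. LINT t|lborel. complex_of_real (half_powr (\<sigma> - 1) t) * heat_lap_eval k t (Y n)) \<longlonglongrightarrow>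
        (LINT t|lborel. complex_of_real (half_powr (\<sigma> - 1) t) * heat_lap_eval k t y0)"
    proof (rule integral_dominated_convergence[OF _ _ D(1)])
      show "AE t in lborel. (\<lambda>n. complex_of_real (half_powr (\<sigma> - 1) t) * heat_lap_eval k t (Y n)) \<longlonglongrightarrow> complex_of_real (half_powr (\<sigma> - 1) t) * heat_lap_eval k t y0"
      proof (rule AE_I2)
        fix t
        show "(\<lambda>n. complex_of_real (half_powr (\<sigma> - 1) t) * heat_lap_eval k t (Y n)) \<longlonglongrightarrow> complex_of_real (half_powr (\<sigma> - 1) t) * heat_lap_eval k t y0"
        proof (cases "t > 0")
          case True
          have "isCont (heat_lap_eval k t) y0"
            using heat_lap_eval_continuous[OF True, of k] continuous_on_eq_continuous_at[OF open_UNIV] by blast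
          from isCont_tendsto_compose[OF this Y] show ?thesis by (intro tendsto_mult_left)
        qed (simp add: half_powr_def)
      qed
      show "AE t in lborel. norm (complex_of_real (half_powr (\<sigma> - 1) t) * heat_lap_eval k t (Y n)) \<le> D t" for n
        using D(2) R' by (intro AE_I2) blast
    qed (simp_all add: half_powr_heat_lap_measurable)
    then show "(lap_repr k \<sigma> \<circ> Y) \<longlonglongrightarrow> lap_repr k \<sigma> y0"
      unfolding lap_repr_def comp_def by (intro tendsto_mult_left)
  qed
qed

text \<open>Compact support of the test function confines y to a ball, where the local majorant
  justifies exchanging t and y.\<close>

lemma frac_laplacian_represents: "represents (frac_laplacian s u) (lap_repr k \<sigma>)"
  unfolding represents_def
proof
  fix \<phi> :: "real^'n \<Rightarrow> complex" assume \<phi>t: "\<phi> \<in> test_functions"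
  then have \<phi>: "\<phi> \<in> schwartz_space" using test_functions_schwartz by blast
  have [measurable]: "\<phi> \<in> borel_measurable borel" by (rule schwartz_measurable[OF \<phi>])
  note [measurable] = half_powr_heat_lap_measurable2[of "\<sigma> - 1" k]
  let ?V = "\<lambda>t y. complex_of_real (half_powr (\<sigma> - 1) t) * heat_lap_eval k t y"
  obtain R where R: "R \<ge> 0" "\<forall>x. R < norm x \<longrightarrow> \<phi> x = 0" using test_function_support[OF \<phi>t] by blast
  obtain D where D: "integrable lborel D" "\<forall>t z. norm z \<le> R \<longrightarrow> norm (?V t z) \<le> D t"
    using lap_repr_majorant[OF R(1)] by auto
  have "(LINT t|lborel. complex_of_real (half_powr (\<sigma> - 1) t) * lap_pair k \<phi> t) = (LINT t|lborel. (LINT y|lborel. \<phi> y * ?V t y))"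
  proof (rule Bochner_Integration.integral_cong[OF refl])
    fix t
    show "complex_of_real (half_powr (\<sigma> - 1) t) * lap_pair k \<phi> t = (LINT y|lborel. \<phi> y * ?V t y)"
    proof (cases "t > 0")
      case True
      have "(LINT y|lborel. \<phi> y * ?V t y) = (LINT y|lborel. complex_of_real (half_powr (\<sigma> - 1) t) * (\<phi> y * heat_lap_eval k t y))"
        by (simp only: mult_ac)
      then show ?thesis unfolding lap_pair_heat_lap[OF True \<phi>] by (simp only: integral_mult_right_zero)
    qed (simp add: half_powr_def)
  qed
  also have "\<dots> = (LINT y|lborel. (LINT t|lborel. \<phi> y * ?V t y))"
  proof (rule fubini_product_bound(1)[OF _ D(1) integrable_norm[OF schwartz_integrable[OF \<phi>]]])
    show "(\<lambda>(t, y). \<phi> y * ?V t y) \<in> borel_measurable (lborel \<Otimes>\<^sub>M lborel)" by measurable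
    show "norm (\<phi> y * ?V t y) \<le> D t * norm (\<phi> y)" for t y
    proof (cases "norm y \<le> R")
      case True
      then show ?thesis using mult_right_mono[OF D(2)[rule_format, OF True, of t], of "norm (\<phi> y)"] by (simp add: norm_mult mult.commute)
    qed (use R in simp)
  qed
  also have "\<dots> = (LINT y|lborel. \<phi> y * (LINT t|lborel. ?V t y))" by (simp only: integral_mult_right_zero)
  finally have "frac_laplacian s u \<phi> = complex_of_real (1 / Gamma \<sigma>) * (LINT y|lborel. \<phi> y * (LINT t|lborel. ?V t y))"
    unfolding frac_laplacian_eq[OF s \<sigma> \<phi>] by (rule arg_cong)
  moreover have "lap_repr k \<sigma> y * \<phi> y = complex_of_real (1 / Gamma \<sigma>) * (\<phi> y * (LINT t|lborel. ?V t y))" for y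
    by (simp only: lap_repr_def mult_ac)
  ultimately show "frac_laplacian s u \<phi> = (LINT y|lborel. lap_repr k \<sigma> y * \<phi> y)"
    by (simp only: integral_mult_right_zero)
qed

lemma continuous_representative_frac_laplacian:
  "continuous_representative (frac_laplacian s u) = lap_repr k \<sigma>"
  by (rule continuous_representative_eq[OF lap_repr_continuous frac_laplacian_represents])

end

end

subsection \<open>The heat flow is dominated by the maximal function\<close>

text \<open>The layer-cake formula writes \<open>h\<^sub>t\<close> as a superposition of indicators of balls, which is why
  the heat flow is dominated by the maximal function with constant \<open>1\<close>.\<close>

lemma nn_integral_gauss_layer:
  assumes t: "t > 0" and a: "a \<ge> 0"
  shows "(\<integral>\<^sup>+\<rho>. ennreal (\<rho> / (2 * t) * exp (- \<rho>\<^sup>2 / (4 * t))) * indicator {a<..} \<rho> \<partial>lborel) = ennreal (exp (- a\<^sup>2 / (4 * t)))"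
proof -
  let ?F = "\<lambda>\<rho>. - exp (- \<rho>\<^sup>2 / (4 * t))"
  have "(\<integral>\<^sup>+\<rho>. ennreal (\<rho> / (2 * t) * exp (- \<rho>\<^sup>2 / (4 * t))) * indicator {a..} \<rho> \<partial>lborel) = ennreal (0 - ?F a)"
  proof (rule nn_integral_FTC_atLeast)
    show "(?F has_real_derivative \<rho> / (2 * t) * exp (- \<rho>\<^sup>2 / (4 * t))) (at \<rho>)" for \<rho>
      using t by (auto intro!: derivative_eq_intros simp: field_simps)
    have "((\<lambda>\<rho>. exp (- \<rho>\<^sup>2 / (4 * t))) \<longlongrightarrow> 0) at_top"
      using t by real_asymp
    then show "(?F \<longlongrightarrow> 0) at_top" using tendsto_minus by fastforce
  qed (use t a in auto)
  moreover have "AE \<rho> in lborel. ennreal (\<rho> / (2 * t) * exp (- \<rho>\<^sup>2 / (4 * t))) * indicator {a..} \<rho> = ennreal (\<rho> / (2 * t) * exp (- \<rho>\<^sup>2 / (4 * t))) * indicator {a<..} \<rho>"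
    using AE_lborel_singleton[of a] by eventually_elim (auto simp: indicator_def)
  ultimately show ?thesis using nn_integral_cong_AE by fastforce
qed

text \<open>Stated for an arbitrary nonnegative density because it is used twice: with the modulus
  of g, and with the constant 1 to recover the total mass.\<close>

lemma heat_layer_fubini:
  fixes q :: "real^'n::finite \<Rightarrow> ennreal"
  assumes t: "t > 0" and q[measurable]: "q \<in> borel_measurable borel"
  shows "(\<integral>\<^sup>+y. q y * ennreal (heat_kernel t (y - x)) \<partial>lborel) =
    (\<integral>\<^sup>+\<rho>. ennreal ((4 * pi * t) powr (- real CARD('n) / 2)) * ennreal (\<rho> / (2 * t) * exp (- \<rho>\<^sup>2 / (4 * t))) * indicator {0<..} \<rho> * (\<integral>\<^sup>+y. q y * indicator (ball x \<rho>) y \<partial>lborel) \<partial>lborel)"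
proof -
  let ?c = "ennreal ((4 * pi * t) powr (- real CARD('n) / 2))"
  let ?k = "\<lambda>\<rho>. ennreal (\<rho> / (2 * t) * exp (- \<rho>\<^sup>2 / (4 * t)))"
  have "ennreal (heat_kernel t (y - x)) = ?c * (\<integral>\<^sup>+\<rho>. ?k \<rho> * indicator {norm (y - x)<..} \<rho> \<partial>lborel)" for y
    unfolding nn_integral_gauss_layer[OF t norm_ge_zero] heat_kernel_def by (rule ennreal_mult') simp
  then have "(\<integral>\<^sup>+y. q y * ennreal (heat_kernel t (y - x)) \<partial>lborel) = (\<integral>\<^sup>+y. (\<integral>\<^sup>+\<rho>. q y * (?c * (?k \<rho> * (if norm (y - x) < \<rho> then 1 else 0))) \<partial>lborel) \<partial>lborel)"
    by (simp add: nn_integral_cmult indicator_def of_bool_def)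
  also have "\<dots> = (\<integral>\<^sup>+\<rho>. (\<integral>\<^sup>+y. q y * (?c * (?k \<rho> * (if norm (y - x) < \<rho> then 1 else 0))) \<partial>lborel) \<partial>lborel)"
    by (rule lborel_pair.Fubini'[symmetric]) measurable
  also have "\<dots> = (\<integral>\<^sup>+\<rho>. (\<integral>\<^sup>+y. (?c * ?k \<rho> * indicator {0<..} \<rho>) * (q y * indicator (ball x \<rho>) y) \<partial>lborel) \<partial>lborel)"
  proof (intro nn_integral_cong)
    fix \<rho> and y :: "real^'n"
    have "0 < \<rho>" if "norm (y - x) < \<rho>" using norm_ge_zero[of "y - x"] that by linarith
    then show "q y * (?c * (?k \<rho> * (if norm (y - x) < \<rho> then 1 else 0))) = (?c * ?k \<rho> * indicator {0<..} \<rho>) * (q y * indicator (ball x \<rho>) y)"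
      by (auto simp: indicator_def dist_norm norm_minus_commute mult_ac)
  qed
  also have "\<dots> = (\<integral>\<^sup>+\<rho>. (?c * ?k \<rho> * indicator {0<..} \<rho>) * (\<integral>\<^sup>+y. q y * indicator (ball x \<rho>) y \<partial>lborel) \<partial>lborel)"
    by (intro nn_integral_cong nn_integral_cmult borel_measurable_times_ennreal borel_measurable_indicator) simp_all
  finally show ?thesis .
qed

lemma ball_integral_le_maximal:
  fixes g :: "real^'n::finite \<Rightarrow> complex"
  assumes r: "r > 0"
  shows "(\<integral>\<^sup>+y. ennreal (norm (g y)) * indicator (ball x r) y \<partial>lborel) \<le> maximal_function g x * emeasure lborel (ball x r)"
proof -
  let ?I = "\<integral>\<^sup>+y. ennreal (norm (g y)) * indicator (ball x r) y \<partial>lborel" and ?m = "emeasure lborel (ball x r)"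
  have m: "?m > 0" "?m < top" using r emeasure_ball_pos[OF r, of x] by (simp_all add: emeasure_ball)
  have "?I / ?m \<le> maximal_function g x"
    unfolding maximal_function_def by (rule SUP_upper2[where i = "(x, r)"]) (use r in auto)
  then have "?I / ?m * ?m \<le> maximal_function g x * ?m" by (rule mult_right_mono) simp
  moreover have "?I / ?m * ?m = ?I" using m by (simp add: ennreal_divide_times)
  ultimately show ?thesis by simp
qed

lemma heat_le_maximal:
  fixes g :: "real^'n::finite \<Rightarrow> complex"
  assumes t: "t > 0" and [measurable]: "g \<in> borel_measurable borel"
  shows "(\<integral>\<^sup>+y. ennreal (norm (g y)) * ennreal (heat_kernel t (y - x)) \<partial>lborel) \<le> maximal_function g x"
proof -
  let ?w = "\<lambda>\<rho>. ennreal ((4 * pi * t) powr (- real CARD('n) / 2)) * ennreal (\<rho> / (2 * t) * exp (- \<rho>\<^sup>2 / (4 * t))) * indicator {0<..} \<rho>"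
  have [measurable]: "(\<lambda>\<rho>. \<integral>\<^sup>+y. (1::ennreal) * indicator (ball x \<rho>) (y :: real^'n) \<partial>lborel) \<in> borel_measurable borel"
  proof -
    have "(\<lambda>\<rho>. \<integral>\<^sup>+y. (1::ennreal) * indicator (ball x \<rho>) (y :: real^'n) \<partial>lborel) = (\<lambda>\<rho>. \<integral>\<^sup>+y. (if dist x y < \<rho> then 1 else 0) \<partial>lborel)"
      by (simp add: indicator_def of_bool_def)
    also have "\<dots> \<in> borel_measurable borel" by measurable
    finally show ?thesis .
  qed
  have "(\<integral>\<^sup>+y. ennreal (norm (g y)) * ennreal (heat_kernel t (y - x)) \<partial>lborel) = (\<integral>\<^sup>+\<rho>. ?w \<rho> * (\<integral>\<^sup>+y. ennreal (norm (g y)) * indicator (ball x \<rho>) y \<partial>lborel) \<partial>lborel)"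
    by (rule heat_layer_fubini[OF t]) measurable
  also have "\<dots> \<le> (\<integral>\<^sup>+\<rho>. maximal_function g x * (?w \<rho> * (\<integral>\<^sup>+y. 1 * indicator (ball x \<rho>) y \<partial>lborel)) \<partial>lborel)"
  proof (rule nn_integral_mono)
    fix \<rho>
    show "?w \<rho> * (\<integral>\<^sup>+y. ennreal (norm (g y)) * indicator (ball x \<rho>) y \<partial>lborel) \<le> maximal_function g x * (?w \<rho> * (\<integral>\<^sup>+y. 1 * indicator (ball x \<rho>) y \<partial>lborel))"
    proof (cases "\<rho> > 0")
      case True
      have "?w \<rho> * (\<integral>\<^sup>+y. ennreal (norm (g y)) * indicator (ball x \<rho>) y \<partial>lborel) \<le> ?w \<rho> * (maximal_function g x * emeasure lborel (ball x \<rho>))"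
        by (intro mult_left_mono ball_integral_le_maximal True) simp
      then show ?thesis by (simp add: mult_ac)
    qed simp
  qed
  also have "\<dots> = maximal_function g x * (\<integral>\<^sup>+\<rho>. ?w \<rho> * (\<integral>\<^sup>+y. 1 * indicator (ball x \<rho>) y \<partial>lborel) \<partial>lborel)"
    by (rule nn_integral_cmult) measurable
  \<comment> \<open>The layer formula is read backwards with constant density: weights times ball
    volumes add up to the mass of the heat kernel, hence constant 1.\<close>
  also have "(\<integral>\<^sup>+\<rho>. ?w \<rho> * (\<integral>\<^sup>+y. 1 * indicator (ball x \<rho>) y \<partial>lborel) \<partial>lborel) = (\<integral>\<^sup>+y. 1 * ennreal (heat_kernel t (y - x)) \<partial>lborel)"
    by (rule heat_layer_fubini[OF t, symmetric]) simp
  also have "\<dots> = ennreal (LINT y|lborel. heat_kernel t (y - x))"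
  proof -
    have "integrable lborel (\<lambda>y. heat_kernel t (y - x))"
      using integrable_affine[of "heat_kernel t" 1 "- x"] heat_kernel_integrable[OF t] by simp
    from nn_integral_eq_integral[OF this] show ?thesis by (simp add: heat_kernel_nonneg)
  qed
  also have "\<dots> = 1" by (subst integral_translate) (simp_all add: heat_kernel_integral[OF t])
  finally show ?thesis by simp
qed

subsection \<open>Composition of Riemann-Liouville integrals\<close>

text \<open>Truncated powers convolve to a truncated power; the substitution t = r v turns the
  integral into Euler's beta integral.\<close>

lemma nn_integral_beta_half_powr:
  assumes a: "a > 0" and b: "b > 0"
  shows "(\<integral>\<^sup>+t. ennreal (half_powr (a - 1) t * half_powr (b - 1) (r - t)) \<partial>lborel) = ennreal (Beta a b * half_powr (a + b - 1) r)"
proof (cases "r > 0")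
  case True
  have "(\<integral>\<^sup>+t. ennreal (half_powr (a - 1) t * half_powr (b - 1) (r - t)) \<partial>lborel) =
      ennreal \<bar>r\<bar> * (\<integral>\<^sup>+v. ennreal (half_powr (a - 1) (0 + r * v) * half_powr (b - 1) (r - (0 + r * v))) \<partial>lborel)"
    by (rule nn_integral_real_affine) (use True in auto)
  also have "(\<lambda>v. ennreal (half_powr (a - 1) (0 + r * v) * half_powr (b - 1) (r - (0 + r * v)))) =
      (\<lambda>v. ennreal (r powr (a - 1) * r powr (b - 1)) * ennreal (indicator {0..1} v * (v powr (a - 1) * (1 - v) powr (b - 1))))"
  proof
    fix v
    have eq: "r - (0 + r * v) = r * (1 - v)" by (simp add: algebra_simps)
    have p1: "half_powr (a - 1) (0 + r * v) = r powr (a - 1) * half_powr (a - 1) v"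
      using True by (simp add: half_powr_def powr_mult indicator_def zero_less_mult_iff)
    have p2: "half_powr (b - 1) (r - (0 + r * v)) = r powr (b - 1) * half_powr (b - 1) (1 - v)"
      unfolding eq using True by (simp add: half_powr_def powr_mult indicator_def zero_less_mult_iff)
    have p3: "half_powr (a - 1) v * half_powr (b - 1) (1 - v) = indicator {0..1} v * (v powr (a - 1) * (1 - v) powr (b - 1))"
      by (cases "v = 0"; cases "v = 1") (auto simp: half_powr_def indicator_def)
    have "half_powr (a - 1) (0 + r * v) * half_powr (b - 1) (r - (0 + r * v)) = (r powr (a - 1) * r powr (b - 1)) * (half_powr (a - 1) v * half_powr (b - 1) (1 - v))"
      unfolding p1 p2 by (simp only: mult_ac)
    then show "ennreal (half_powr (a - 1) (0 + r * v) * half_powr (b - 1) (r - (0 + r * v))) =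
       ennreal (r powr (a - 1) * r powr (b - 1)) * ennreal (indicator {0..1} v * (v powr (a - 1) * (1 - v) powr (b - 1)))"
      unfolding p3 by (simp add: ennreal_mult')
  qed
  also have "(\<integral>\<^sup>+v. ennreal (r powr (a - 1) * r powr (b - 1)) * ennreal (indicator {0..1} v * (v powr (a - 1) * (1 - v) powr (b - 1))) \<partial>lborel) =
      ennreal (r powr (a - 1) * r powr (b - 1)) * ennreal (Beta a b)"
  proof (subst nn_integral_cmult)
    show "ennreal (r powr (a - 1) * r powr (b - 1)) * (\<integral>\<^sup>+v. ennreal (indicator {0..1} v * (v powr (a - 1) * (1 - v) powr (b - 1))) \<partial>lborel) =
      ennreal (r powr (a - 1) * r powr (b - 1)) * ennreal (Beta a b)"
      by (subst nn_integral_has_integral_lebesgue[OF _ has_integral_Beta_real[OF a b]]) auto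
  qed measurable
  also have "ennreal \<bar>r\<bar> * (ennreal (r powr (a - 1) * r powr (b - 1)) * ennreal (Beta a b)) = ennreal (\<bar>r\<bar> * (r powr (a - 1) * r powr (b - 1)) * Beta a b)"
  proof -
    have "Beta a b \<ge> 0" using a b by (simp add: Beta_def Gamma_real_pos less_imp_le)
    then show ?thesis by (simp add: ennreal_mult mult.assoc)
  qed
  also have "\<bar>r\<bar> * (r powr (a - 1) * r powr (b - 1)) = half_powr (a + b - 1) r"
    using True by (simp add: half_powr_def powr_diff powr_add)
  finally show ?thesis by (simp add: mult.commute)
next
  case False
  have z: "half_powr (a - 1) t * half_powr (b - 1) (r - t) = 0" for t
    using False by (cases "t > 0") (auto simp: half_powr_def)
  have "half_powr (a + b - 1) r = 0" using False by (simp add: half_powr_def)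
  then show ?thesis by (simp only: z) simp
qed

text \<open>The unsigned version serves twice: it gives the absolute integrability behind the
  complex version, and it handles the part t > T of the final estimate, where only moduli
  occur.\<close>

lemma beta_half_powr_compose_nn:
  fixes F :: "real \<Rightarrow> ennreal"
  assumes a: "a > 0" and b: "b > 0" and F[measurable]: "F \<in> borel_measurable borel"
  shows "(\<integral>\<^sup>+t. (\<integral>\<^sup>+\<tau>. ennreal (half_powr (a - 1) t * half_powr (b - 1) \<tau>) * F (t + \<tau>) \<partial>lborel) \<partial>lborel) =
    ennreal (Beta a b) * (\<integral>\<^sup>+r. ennreal (half_powr (a + b - 1) r) * F r \<partial>lborel)"
proof -
  have Bp: "Beta a b > 0" using a b by (simp add: Beta_def Gamma_real_pos)
  have "(\<integral>\<^sup>+t. (\<integral>\<^sup>+\<tau>. ennreal (half_powr (a - 1) t * half_powr (b - 1) \<tau>) * F (t + \<tau>) \<partial>lborel) \<partial>lborel) =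
     (\<integral>\<^sup>+t. (\<integral>\<^sup>+r. ennreal (half_powr (a - 1) t * half_powr (b - 1) (r - t)) * F r \<partial>lborel) \<partial>lborel)"
  proof (rule nn_integral_cong)
    fix t
    show "(\<integral>\<^sup>+\<tau>. ennreal (half_powr (a - 1) t * half_powr (b - 1) \<tau>) * F (t + \<tau>) \<partial>lborel) = (\<integral>\<^sup>+r. ennreal (half_powr (a - 1) t * half_powr (b - 1) (r - t)) * F r \<partial>lborel)"
      by (subst nn_integral_real_affine[where c = 1 and t = t and f = "\<lambda>r. ennreal (half_powr (a - 1) t * half_powr (b - 1) (r - t)) * F r"]) simp_all
  qed
  also have "\<dots> = (\<integral>\<^sup>+r. (\<integral>\<^sup>+t. ennreal (half_powr (a - 1) t * half_powr (b - 1) (r - t)) * F r \<partial>lborel) \<partial>lborel)"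
    by (rule lborel_pair.Fubini'[symmetric]) measurable
  also have "\<dots> = (\<integral>\<^sup>+r. ennreal (Beta a b) * (ennreal (half_powr (a + b - 1) r) * F r) \<partial>lborel)"
  proof (rule nn_integral_cong)
    fix r
    have "(\<integral>\<^sup>+t. ennreal (half_powr (a - 1) t * half_powr (b - 1) (r - t)) * F r \<partial>lborel) = ennreal (Beta a b * half_powr (a + b - 1) r) * F r"
      by (subst nn_integral_multc) (simp_all add: nn_integral_beta_half_powr a b)
    also have "ennreal (Beta a b * half_powr (a + b - 1) r) = ennreal (Beta a b) * ennreal (half_powr (a + b - 1) r)"
      by (rule ennreal_mult) (use Bp in \<open>auto simp: half_powr_nonneg\<close>)
    finally show "(\<integral>\<^sup>+t. ennreal (half_powr (a - 1) t * half_powr (b - 1) (r - t)) * F r \<partial>lborel) = ennreal (Beta a b) * (ennreal (half_powr (a + b - 1) r) * F r)"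
      by (simp add: mult.assoc)
  qed
  also have "\<dots> = ennreal (Beta a b) * (\<integral>\<^sup>+r. ennreal (half_powr (a + b - 1) r) * F r \<partial>lborel)"
    by (rule nn_integral_cmult) measurable
  finally show ?thesis .
qed

lemma beta_half_powr_compose:
  fixes F :: "real \<Rightarrow> complex"
  assumes a: "a > 0" and b: "b > 0" and F[measurable]: "F \<in> borel_measurable borel"
    and int: "integrable lborel (\<lambda>r. complex_of_real (half_powr (a + b - 1) r) * F r)"
  shows "(LINT t|lborel. complex_of_real (half_powr (a - 1) t) * (LINT \<tau>|lborel. complex_of_real (half_powr (b - 1) \<tau>) * F (t + \<tau>))) =
    complex_of_real (Beta a b) * (LINT r|lborel. complex_of_real (half_powr (a + b - 1) r) * F r)"
proof -
  have Bp: "Beta a b > 0" using a b by (simp add: Beta_def Gamma_real_pos)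
  let ?G = "\<lambda>t r. complex_of_real (half_powr (a - 1) t * half_powr (b - 1) (r - t)) * F r"
  have m: "(\<lambda>(t, r). ?G t r) \<in> borel_measurable (lborel \<Otimes>\<^sub>M lborel)" by measurable
  have "(\<integral>\<^sup>+r. ennreal (half_powr (a + b - 1) r) * ennreal (norm (F r)) \<partial>lborel) < top"
    using int unfolding integrable_iff_bounded by (simp add: norm_mult half_powr_nonneg ennreal_mult)
  then have fin: "ennreal (Beta a b) * (\<integral>\<^sup>+r. ennreal (half_powr (a + b - 1) r) * ennreal (norm (F r)) \<partial>lborel) < top"
    by (simp add: ennreal_mult_less_top)
  have nnG: "ennreal (norm (?G t r)) = ennreal (half_powr (a - 1) t * half_powr (b - 1) (r - t)) * ennreal (norm (F r))" for t r
    by (simp add: norm_mult half_powr_nonneg ennreal_mult)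
  have "(\<integral>\<^sup>+t. (\<integral>\<^sup>+r. ennreal (norm (?G t r)) \<partial>lborel) \<partial>lborel) = ennreal (Beta a b) * (\<integral>\<^sup>+r. ennreal (half_powr (a + b - 1) r) * ennreal (norm (F r)) \<partial>lborel)"
    unfolding nnG
  proof (subst beta_half_powr_compose_nn[OF a b, symmetric])
    show "(\<integral>\<^sup>+t. (\<integral>\<^sup>+r. ennreal (half_powr (a - 1) t * half_powr (b - 1) (r - t)) * ennreal (norm (F r)) \<partial>lborel) \<partial>lborel) =
      (\<integral>\<^sup>+t. (\<integral>\<^sup>+\<tau>. ennreal (half_powr (a - 1) t * half_powr (b - 1) \<tau>) * ennreal (norm (F (t + \<tau>))) \<partial>lborel) \<partial>lborel)"
    proof (rule nn_integral_cong)
      fix t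
      show "(\<integral>\<^sup>+r. ennreal (half_powr (a - 1) t * half_powr (b - 1) (r - t)) * ennreal (norm (F r)) \<partial>lborel) = (\<integral>\<^sup>+\<tau>. ennreal (half_powr (a - 1) t * half_powr (b - 1) \<tau>) * ennreal (norm (F (t + \<tau>))) \<partial>lborel)"
        by (subst nn_integral_real_affine[where c = 1 and t = t]) simp_all
    qed
  qed measurable
  then have I: "integrable (lborel \<Otimes>\<^sub>M lborel) (\<lambda>(t, r). ?G t r)"
    using m fin unfolding integrable_iff_bounded
    by (simp add: lborel.nn_integral_fst[symmetric] split_beta')
  have "(LINT t|lborel. complex_of_real (half_powr (a - 1) t) * (LINT \<tau>|lborel. complex_of_real (half_powr (b - 1) \<tau>) * F (t + \<tau>))) = (LINT t|lborel. (LINT r|lborel. ?G t r))"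
  proof (rule Bochner_Integration.integral_cong[OF refl])
    fix t
    have "(LINT \<tau>|lborel. complex_of_real (half_powr (b - 1) \<tau>) * F (t + \<tau>)) = (LINT r|lborel. (\<lambda>\<tau>. complex_of_real (half_powr (b - 1) \<tau>) * F (t + \<tau>)) (r - t))"
      by (rule integral_translate[symmetric]) measurable
    also have "\<dots> = (LINT r|lborel. complex_of_real (half_powr (b - 1) (r - t)) * F r)" by simp
    finally show "complex_of_real (half_powr (a - 1) t) * (LINT \<tau>|lborel. complex_of_real (half_powr (b - 1) \<tau>) * F (t + \<tau>)) = (LINT r|lborel. ?G t r)"
      by (simp add: integral_mult_right_zero[symmetric] mult.assoc del: integral_mult_right_zero)
  qed
  also have "\<dots> = (LINT r|lborel. (LINT t|lborel. ?G t r))"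
    by (rule lborel_pair.Fubini_integral[OF I, symmetric])
  also have "\<dots> = (LINT r|lborel. complex_of_real (Beta a b) * (complex_of_real (half_powr (a + b - 1) r) * F r))"
  proof (rule Bochner_Integration.integral_cong[OF refl])
    fix r
    have "(LINT t|lborel. half_powr (a - 1) t * half_powr (b - 1) (r - t)) = Beta a b * half_powr (a + b - 1) r"
      using nn_integral_beta_half_powr[OF a b, of r] Bp
      by (subst integral_eq_nn_integral) (auto simp: half_powr_nonneg)
    moreover have "(LINT t|lborel. ?G t r) = complex_of_real (LINT t|lborel. half_powr (a - 1) t * half_powr (b - 1) (r - t)) * F r"
      by (simp only: integral_mult_left_zero integral_complex_of_real)
    ultimately show "(LINT t|lborel. ?G t r) = complex_of_real (Beta a b) * (complex_of_real (half_powr (a + b - 1) r) * F r)"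
      by (simp only: of_real_mult mult.assoc)
  qed
  also have "\<dots> = complex_of_real (Beta a b) * (LINT r|lborel. complex_of_real (half_powr (a + b - 1) r) * F r)"
    by (rule integral_mult_right_zero)
  finally show ?thesis .
qed

text \<open>The two terms are equal at T = (D / A)^(1 / (\<delta> + \<gamma>)), which gives the
  factor 2. If A or D vanishes no such T exists, and the claim a \<le> 0 is the limit as T tends to
  infinity or to 0.\<close>

lemma interpolation_optimise:
  fixes a A D K \<delta> \<gamma> :: real
  assumes nn: "0 \<le> a" "0 \<le> A" "0 \<le> D" "0 \<le> K" and pos: "0 < \<delta>" "0 < \<gamma>"
    and le: "\<And>T. T > 0 \<Longrightarrow> a \<le> K * (A * T powr \<delta> + D * T powr (- \<gamma>))"
  shows "a \<le> 2 * K * (A powr (\<gamma> / (\<delta> + \<gamma>)) * D powr (\<delta> / (\<delta> + \<gamma>)))"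
proof -
  consider "A = 0" | "D = 0" | "A > 0" "D > 0" using nn by linarith
  then show ?thesis
  proof cases
    case 1
    have "((\<lambda>T. K * (D * T powr (- \<gamma>))) \<longlongrightarrow> K * (D * 0)) at_top"
      by (intro tendsto_intros tendsto_neg_powr filterlim_ident) (use pos in auto)
    moreover have "\<forall>\<^sub>F T in at_top. a \<le> K * (D * T powr (- \<gamma>))"
      using eventually_gt_at_top[of 0] by eventually_elim (use le 1 in simp)
    ultimately have "a \<le> K * (D * 0)" by (intro tendsto_lowerbound[where F = at_top]) auto
    then show ?thesis using 1 by simp
  next
    case 2
    have "((\<lambda>T. K * (A * T powr \<delta>)) \<longlongrightarrow> K * (A * 0 powr \<delta>)) (at_right 0)"
      using pos by (intro tendsto_intros tendsto_powr2) (auto simp: eventually_at_filter)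
    moreover have "\<forall>\<^sub>F T in at_right 0. a \<le> K * (A * T powr \<delta>)"
      unfolding eventually_at_filter by (intro always_eventually) (use le 2 in auto)
    ultimately have "a \<le> K * (A * 0 powr \<delta>)" by (intro tendsto_lowerbound[where F = "at_right 0"]) auto
    then show ?thesis using 2 nn by simp
  next
    case 3
    define T where "T = (D / A) powr (1 / (\<delta> + \<gamma>))"
    have T: "T > 0" using 3 by (simp add: T_def)
    have dg: "\<delta> + \<gamma> > 0" using pos by simp
    have e1: "A * T powr \<delta> = A powr (\<gamma> / (\<delta> + \<gamma>)) * D powr (\<delta> / (\<delta> + \<gamma>))"
    proof -
      have "T powr \<delta> = D powr (\<delta> / (\<delta> + \<gamma>)) * A powr (- (\<delta> / (\<delta> + \<gamma>)))"
      proof -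
        have "T powr \<delta> = (D / A) powr (\<delta> / (\<delta> + \<gamma>))" by (simp add: T_def powr_powr)
        also have "\<dots> = D powr (\<delta> / (\<delta> + \<gamma>)) / A powr (\<delta> / (\<delta> + \<gamma>))" using 3 by (simp only: powr_divide)
        finally show ?thesis by (simp only: powr_minus divide_inverse)
      qed
      moreover have "A * A powr (- (\<delta> / (\<delta> + \<gamma>))) = A powr (1 + - (\<delta> / (\<delta> + \<gamma>)))"
        unfolding powr_add using 3 by simp
      moreover have "1 + - (\<delta> / (\<delta> + \<gamma>)) = \<gamma> / (\<delta> + \<gamma>)" using dg by (simp add: field_simps)
      ultimately show ?thesis by (simp add: mult_ac)
    qed
    have e2: "D * T powr (- \<gamma>) = A powr (\<gamma> / (\<delta> + \<gamma>)) * D powr (\<delta> / (\<delta> + \<gamma>))"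
    proof -
      have "T powr (- \<gamma>) = A powr (\<gamma> / (\<delta> + \<gamma>)) * D powr (- (\<gamma> / (\<delta> + \<gamma>)))"
      proof -
        have "T powr (- \<gamma>) = (D / A) powr (- (\<gamma> / (\<delta> + \<gamma>)))" by (simp add: T_def powr_powr)
        also have "\<dots> = D powr (- (\<gamma> / (\<delta> + \<gamma>))) / A powr (- (\<gamma> / (\<delta> + \<gamma>)))" using 3 by (simp only: powr_divide)
        finally show ?thesis by (simp only: powr_minus divide_inverse inverse_inverse_eq mult.commute)
      qed
      moreover have "D * D powr (- (\<gamma> / (\<delta> + \<gamma>))) = D powr (1 + - (\<gamma> / (\<delta> + \<gamma>)))"
        unfolding powr_add using 3 by simp
      moreover have "1 + - (\<gamma> / (\<delta> + \<gamma>)) = \<delta> / (\<delta> + \<gamma>)" using dg by (simp add: field_simps)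
      ultimately show ?thesis by (simp add: mult_ac)
    qed
    have "a \<le> K * (A * T powr \<delta> + D * T powr (- \<gamma>))" by (rule le[OF T])
    also have "\<dots> = 2 * K * (A powr (\<gamma> / (\<delta> + \<gamma>)) * D powr (\<delta> / (\<delta> + \<gamma>)))"
      unfolding e1 e2 by (simp add: algebra_simps)
    finally show ?thesis .
  qed
qed

subsection \<open>The pointwise interpolation inequality\<close>

text \<open>For small t the derivatives fall on the truncated function, whose L1 bound has to be
  uniform in the truncation; it is, because the cutoff derivatives are.\<close>

lemma nlap_cutoff_L1_bound:
  fixes \<phi> :: "real^'n::finite \<Rightarrow> complex"
  assumes \<phi>: "\<phi> \<in> schwartz_space"
  shows "\<exists>C\<ge>0. \<forall>r\<ge>1. (LINT y|lborel. norm ((nlap ^^ k) (\<lambda>x. ccutoff r x * \<phi> x) y)) \<le> C"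
proof -
  let ?N = "2 * CARD('n)"
  obtain A where A: "A \<ge> 0" "\<forall>r\<ge>1. \<forall>is x. length is \<le> 2 * k \<longrightarrow> norm (iterated_partial is (ccutoff r :: real^'n \<Rightarrow> complex) x) \<le> A"
    using cutoff_deriv_bound by blast
  define p where "p = schwartz_seminorm ?N (2 * k) \<phi>"
  have p: "p \<ge> 0" unfolding p_def by (rule schwartz_seminorm_nonneg[OF \<phi>])
  define D where "D = real CARD('n) ^ k * (2 ^ (2 * k) * (A * p))"
  have D: "D \<ge> 0" using A p by (simp add: D_def)
  have i: "integrable lborel (\<lambda>y::real^'n. D * (1 / (1 + norm y) ^ ?N))"
    by (intro integrable_mult_right integrable_one_plus_norm) simp
  have "(LINT y|lborel. norm ((nlap ^^ k) (\<lambda>x. ccutoff r x * \<phi> x) y)) \<le> (LINT y|lborel. D * (1 / (1 + norm (y :: real^'n)) ^ ?N))" if r: "r \<ge> 1" for r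
  proof (rule integral_mono_AE'[OF i])
    show "AE y in lborel. norm ((nlap ^^ k) (\<lambda>x. ccutoff r x * \<phi> x) y) \<le> D * (1 / (1 + norm y) ^ ?N)"
    proof (rule AE_I2)
      fix y :: "real^'n"
      have pos: "(1 + norm y) ^ ?N > 0" by (simp add: add_pos_nonneg)
      have "norm ((nlap ^^ k) (\<lambda>x. ccutoff r x * \<phi> x) y) \<le> real CARD('n) ^ k * (2 ^ (2 * k) * (A * (p / (1 + norm y) ^ ?N)))"
      proof (rule nlap_pow_bound[OF smooth_mult[OF cutoff_smooth schwartz_smooth[OF \<phi>]]])
        fix js :: "'n list" assume l: "length js \<le> 2 * k"
        have "norm (iterated_partial js (\<lambda>x. ccutoff r x * \<phi> x) y) \<le> 2 ^ length js * (A * (p / (1 + norm y) ^ ?N))"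
        proof (rule iterated_partial_mult_bound[OF cutoff_smooth schwartz_smooth[OF \<phi>]])
          show "norm (iterated_partial ks (ccutoff r) y) \<le> A" if "length ks \<le> length js" for ks
            using A r l that by auto
          show "norm (iterated_partial ks \<phi> y) \<le> p / (1 + norm y) ^ ?N" if "length ks \<le> length js" for ks
            using schwartz_seminorm_upper[OF \<phi>, of ks "2 * k" y ?N] that l pos by (simp add: pos_le_divide_eq p_def mult.commute)
        qed
        also have "\<dots> \<le> 2 ^ (2 * k) * (A * (p / (1 + norm y) ^ ?N))"
          using l A p pos by (intro mult_right_mono power_increasing) (auto intro!: mult_nonneg_nonneg divide_nonneg_pos)
        finally show "norm (iterated_partial js (\<lambda>x. ccutoff r x * \<phi> x) y) \<le> 2 ^ (2 * k) * (A * (p / (1 + norm y) ^ ?N))" .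
      qed
      then show "norm ((nlap ^^ k) (\<lambda>x. ccutoff r x * \<phi> x) y) \<le> D * (1 / (1 + norm y) ^ ?N)"
        by (simp add: D_def)
    qed
  qed (use D in auto)
  moreover have "0 \<le> (LINT y|lborel. D * (1 / (1 + norm (y :: real^'n)) ^ ?N))"
    using D by (intro integral_nonneg_AE) auto
  ultimately show ?thesis by blast
qed

section \<open>Heat averages of the representative and the splitting at time T\<close>

context besov_fun
begin

text \<open>By the semigroup law, averaging V at time \<tau> with a heat kernel at time t centred at
  x gives V at time t + \<tau> and point x.\<close>

lemma lap_pair_heat_translate:
  assumes t: "t > 0" and \<tau>: "\<tau> > 0"
  shows "lap_pair k (\<lambda>y. heat t (y - x)) \<tau> = heat_lap_eval k (t + \<tau>) x"
proof -
  have "(nlap ^^ k) (\<lambda>y. heat t (1 *\<^sub>R y + (- x))) = (\<lambda>y. complex_of_real (1 ^ (2 * k)) * (nlap ^^ k) (heat t) (1 *\<^sub>R y + (- x)))"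
    by (rule nlap_pow_affine[OF schwartz_smooth[OF heat_schwartz[OF t]]])
  then have "(nlap ^^ k) (\<lambda>y. heat t (y - x)) = (\<lambda>y. heat_lap k t (y - x))"
    by (simp add: heat_lap_def)
  moreover have "conv (heat \<tau>) (\<lambda>y. heat_lap k t (y - x)) = (\<lambda>p. conv (heat \<tau>) (heat_lap k t) (p - x))"
    by (simp add: conv_def[abs_def] algebra_simps)
  ultimately show ?thesis
    unfolding lap_pair_def heat_lap_eval_def shift_eval_def
    by (simp only: heat_lap_semigroup[OF \<tau> t] add.commute)
qed

lemma cutoff_tendsto: "(\<lambda>j. ccutoff (real (Suc j)) y) \<longlonglongrightarrow> 1"
proof (rule tendsto_eventually)
  obtain j0 where j0: "norm y \<le> real j0" using real_arch_simple by blast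
  show "\<forall>\<^sub>F j in sequentially. ccutoff (real (Suc j)) y = 1"
    using eventually_ge_at_top[of j0]
  proof eventually_elim
    case (elim j)
    then have "norm y \<le> real (Suc j)" using j0 by simp
    then show ?case by (simp only: cutoff_1 of_nat_0_less_iff zero_less_Suc of_real_1)
  qed
qed

lemma lap_pair_cutoff_tendsto:
  assumes t: "t > 0" and \<phi>: "\<phi> \<in> schwartz_space"
  shows "(\<lambda>j. lap_pair k (\<lambda>x. ccutoff (real (Suc j)) x * \<phi> x) t) \<longlonglongrightarrow> lap_pair k \<phi> t"
proof -
  have c: "(\<lambda>x. ccutoff (real (Suc j)) x * \<phi> x) \<in> schwartz_space" for j
    using schwartz_cutoff_mult[OF \<phi>, of "real (Suc j)"] test_functions_schwartz by auto
  note [measurable] = schwartz_measurable[OF \<phi>] heat_lap_eval_measurable[OF t, of k]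
  let ?K = "lap_const k * B * t powr (- real k - \<beta> / 2)"
  show ?thesis
    unfolding lap_pair_heat_lap[OF t \<phi>] lap_pair_heat_lap[OF t c]
  proof (rule integral_dominated_convergence[OF _ _ integrable_mult_left[OF integrable_norm[OF schwartz_integrable[OF \<phi>]], of ?K]])
    show "AE y in lborel. (\<lambda>j. ccutoff (real (Suc j)) y * \<phi> y * heat_lap_eval k t y) \<longlonglongrightarrow> \<phi> y * heat_lap_eval k t y"
    proof (rule AE_I2)
      fix y
      show "(\<lambda>j. ccutoff (real (Suc j)) y * \<phi> y * heat_lap_eval k t y) \<longlonglongrightarrow> \<phi> y * heat_lap_eval k t y"
        using tendsto_mult_right[OF cutoff_tendsto[of y], of "\<phi> y * heat_lap_eval k t y"] by (simp add: mult.assoc)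
    qed
    show "AE y in lborel. norm (ccutoff (real (Suc j)) y * \<phi> y * heat_lap_eval k t y) \<le> norm (\<phi> y) * ?K" for j
    proof (rule AE_I2)
      fix y
      have "norm (ccutoff (real (Suc j)) y) * (norm (\<phi> y) * norm (heat_lap_eval k t y)) \<le> 1 * (norm (\<phi> y) * ?K)"
        using cutoff_range[of "real (Suc j)" y] lap_const_nonneg[of k] B_nonneg
        by (intro mult_mono mult_left_mono heat_lap_eval_bound[OF t]) auto
      then show "norm (ccutoff (real (Suc j)) y * \<phi> y * heat_lap_eval k t y) \<le> norm (\<phi> y) * ?K"
        by (simp add: norm_mult mult.assoc)
    qed
  qed measurable
qed

context
  fixes s \<sigma> :: real and k :: nat
  assumes s: "s > 0" and \<sigma>: "\<sigma> = real k - s / 2" "\<sigma> \<ge> real CARD('n)" "\<sigma> > \<beta> / 2"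
begin

text \<open>A heat kernel is not a test function, while \<open>represents\<close> speaks of test
  functions only. This limit carries the pairing from truncated kernels to the full one.\<close>

lemma half_powr_lap_pair_cutoff_tendsto:
  assumes \<phi>: "\<phi> \<in> schwartz_space"
  shows "(\<lambda>j. LINT t|lborel. complex_of_real (half_powr (\<sigma> - 1) t) * lap_pair k (\<lambda>x. ccutoff (real (Suc j)) x * \<phi> x) t) \<longlonglongrightarrow>
    (LINT t|lborel. complex_of_real (half_powr (\<sigma> - 1) t) * lap_pair k \<phi> t)"
proof -
  have c: "(\<lambda>x. ccutoff (real (Suc j)) x * \<phi> x) \<in> schwartz_space" for j
    using schwartz_cutoff_mult[OF \<phi>, of "real (Suc j)"] test_functions_schwartz by auto
  obtain C where C: "C \<ge> 0" "\<And>r. r \<ge> 1 \<Longrightarrow> (LINT y|lborel. norm ((nlap ^^ k) (\<lambda>x. ccutoff r x * \<phi> x) y)) \<le> C"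
    using nlap_cutoff_L1_bound[OF \<phi>, of k] by blast
  define D where "D t = (C * B) * (half_powr (\<sigma> - 1 - \<beta> / 2) t * indicator {..1} t) +
     ((LINT y|lborel. norm (\<phi> y)) * (lap_const k * B)) * (half_powr (- s / 2 - \<beta> / 2 - 1) t * indicator {1..} t)" for t
  have D: "integrable lborel D"
    unfolding D_def[abs_def]
    by (intro Bochner_Integration.integrable_add integrable_mult_right integrable_half_powr_small integrable_half_powr_large)
       (use s \<sigma> \<beta> in auto)
  show ?thesis
  proof (rule integral_dominated_convergence[OF _ _ D])
    show "AE t in lborel. (\<lambda>j. complex_of_real (half_powr (\<sigma> - 1) t) * lap_pair k (\<lambda>x. ccutoff (real (Suc j)) x * \<phi> x) t) \<longlonglongrightarrow> complex_of_real (half_powr (\<sigma> - 1) t) * lap_pair k \<phi> t"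
    proof (rule AE_I2)
      fix t
      show "(\<lambda>j. complex_of_real (half_powr (\<sigma> - 1) t) * lap_pair k (\<lambda>x. ccutoff (real (Suc j)) x * \<phi> x) t) \<longlonglongrightarrow> complex_of_real (half_powr (\<sigma> - 1) t) * lap_pair k \<phi> t"
        by (cases "t > 0") (auto intro!: tendsto_mult_left lap_pair_cutoff_tendsto[unfolded of_nat_Suc] \<phi> simp: half_powr_neg)
    qed
    show "AE t in lborel. norm (complex_of_real (half_powr (\<sigma> - 1) t) * lap_pair k (\<lambda>x. ccutoff (real (Suc j)) x * \<phi> x) t) \<le> D t" for j
    proof (rule AE_I2)
      fix t :: real
      let ?\<phi> = "\<lambda>x. ccutoff (real (Suc j)) x * \<phi> x"
      \<comment> \<open>The instance \<epsilon> = 0, j = 0 of the regularised majorant: both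
        prefactors are 1.\<close>
      have "norm (complex_of_real (exp (- (0\<^sup>2 * t)) * (0\<^sup>2) ^ 0) * (complex_of_real (half_powr (\<sigma> - 1) t) * lap_pair (k - 0) ?\<phi> t)) \<le> majorant s \<sigma> k 0 ?\<phi> t"
        by (rule majorant_bound[OF s \<sigma> c]) simp_all
      also have "majorant s \<sigma> k 0 ?\<phi> t \<le> D t"
        unfolding majorant_def[OF s \<sigma>] D_def
      proof (intro add_mono mult_right_mono mult_nonneg_nonneg half_powr_nonneg)
        show "(LINT y|lborel. norm ((nlap ^^ (k - 0)) ?\<phi> y)) \<le> C" using C(2)[of "real (Suc j)"] by simp
        have "(LINT y|lborel. norm (?\<phi> y)) \<le> (LINT y|lborel. norm (\<phi> y))"
        proof (rule integral_mono_AE'[OF integrable_norm[OF schwartz_integrable[OF \<phi>]]])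
          show "AE y in lborel. norm (?\<phi> y) \<le> norm (\<phi> y)"
          proof (rule AE_I2)
            fix y
            show "norm (?\<phi> y) \<le> norm (\<phi> y)"
              using cutoff_range[of "real (Suc j)" y] mult_right_mono[of "cutoff (real (Suc j)) y" 1 "norm (\<phi> y)"]
              by (simp only: norm_mult norm_of_real abs_of_nonneg) simp
          qed
        qed auto
        then show "real 0 ^ 0 * ((LINT y|lborel. norm (?\<phi> y)) * (lap_const (k - 0) * B)) \<le> (LINT y|lborel. norm (\<phi> y)) * (lap_const k * B)"
          using lap_const_nonneg B_nonneg by (simp add: mult_right_mono)
      qed (auto simp: B_nonneg)
      finally show "norm (complex_of_real (half_powr (\<sigma> - 1) t) * lap_pair k ?\<phi> t) \<le> D t" by simp
    qed
  qed (use half_powr_lap_pair_measurable \<phi> c in auto)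
qed

text \<open>The left side is |h_t * g_s (x)| written through V. It is the limit of pairings with
  truncated kernels, each of which is at most the integral of |g_s| against the full kernel, hence
  at most the maximal function.\<close>

lemma heat_average_le_maximal:
  assumes t: "t > 0"
  shows "ennreal (norm (complex_of_real (1 / Gamma \<sigma>) * (LINT \<tau>|lborel. complex_of_real (half_powr (\<sigma> - 1) \<tau>) * heat_lap_eval k (t + \<tau>) x)))
    \<le> maximal_function (lap_repr k \<sigma>) x"
proof -
  define \<phi> where "\<phi> y = heat t (y - x)" for y
  have \<phi>: "\<phi> \<in> schwartz_space" unfolding \<phi>_def[abs_def] by (intro schwartz_translate heat_schwartz t)
  let ?\<phi> = "\<lambda>j x. ccutoff (real (Suc j)) x * \<phi> x"
  have test: "?\<phi> j \<in> test_functions" for j by (rule schwartz_cutoff_mult[OF \<phi>]) simp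
  have [measurable]: "lap_repr k \<sigma> \<in> borel_measurable borel"
    by (rule borel_measurable_continuous_onI[OF lap_repr_continuous[OF s \<sigma>]])
  have "(LINT \<tau>|lborel. complex_of_real (half_powr (\<sigma> - 1) \<tau>) * lap_pair k \<phi> \<tau>) = (LINT \<tau>|lborel. complex_of_real (half_powr (\<sigma> - 1) \<tau>) * heat_lap_eval k (t + \<tau>) x)"
  proof (rule Bochner_Integration.integral_cong[OF refl])
    fix \<tau>
    show "complex_of_real (half_powr (\<sigma> - 1) \<tau>) * lap_pair k \<phi> \<tau> = complex_of_real (half_powr (\<sigma> - 1) \<tau>) * heat_lap_eval k (t + \<tau>) x"
      unfolding \<phi>_def[abs_def] by (cases "\<tau> > 0") (simp_all add: lap_pair_heat_translate t half_powr_neg)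
  qed
  then have "(\<lambda>j. frac_laplacian s u (?\<phi> j)) \<longlonglongrightarrow> complex_of_real (1 / Gamma \<sigma>) * (LINT \<tau>|lborel. complex_of_real (half_powr (\<sigma> - 1) \<tau>) * heat_lap_eval k (t + \<tau>) x)"
    using tendsto_mult_left[OF half_powr_lap_pair_cutoff_tendsto[OF \<phi>], of "complex_of_real (1 / Gamma \<sigma>)"]
    by (simp only: frac_laplacian_eq[OF s \<sigma> subsetD[OF test_functions_schwartz test]])
  then have lim: "(\<lambda>j. ennreal (norm (frac_laplacian s u (?\<phi> j)))) \<longlonglongrightarrow> ennreal (norm (complex_of_real (1 / Gamma \<sigma>) * (LINT \<tau>|lborel. complex_of_real (half_powr (\<sigma> - 1) \<tau>) * heat_lap_eval k (t + \<tau>) x)))"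
    by (intro tendsto_ennrealI tendsto_norm)
  have le: "ennreal (norm (frac_laplacian s u (?\<phi> j))) \<le> maximal_function (lap_repr k \<sigma>) x" for j
  proof -
    have "frac_laplacian s u (?\<phi> j) = (LINT y|lborel. lap_repr k \<sigma> y * ?\<phi> j y)"
      using frac_laplacian_represents[OF s \<sigma>] test[of j] unfolding represents_def by blast
    also have "ennreal (norm \<dots>) \<le> (\<integral>\<^sup>+y. ennreal (norm (lap_repr k \<sigma> y * ?\<phi> j y)) \<partial>lborel)"
      by (rule integral_norm_bound_ennreal[OF continuous_test_integrable[OF lap_repr_continuous[OF s \<sigma>] test]])
    also have "\<dots> \<le> (\<integral>\<^sup>+y. ennreal (norm (lap_repr k \<sigma> y)) * ennreal (heat_kernel t (y - x)) \<partial>lborel)"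
    proof (rule nn_integral_mono)
      fix y
      have "cutoff (real (Suc j)) y * heat_kernel t (y - x) \<le> 1 * heat_kernel t (y - x)"
        by (intro mult_right_mono cutoff_range heat_kernel_nonneg)
      then have "norm (?\<phi> j y) \<le> heat_kernel t (y - x)"
        unfolding \<phi>_def norm_mult norm_of_real using cutoff_range[of "real (Suc j)" y] heat_kernel_nonneg[of t "y - x"]
        by (simp only: abs_of_nonneg mult_1_left)
      then have "norm (lap_repr k \<sigma> y) * norm (?\<phi> j y) \<le> norm (lap_repr k \<sigma> y) * heat_kernel t (y - x)"
        by (rule mult_left_mono) simp
      then show "ennreal (norm (lap_repr k \<sigma> y * ?\<phi> j y)) \<le> ennreal (norm (lap_repr k \<sigma> y)) * ennreal (heat_kernel t (y - x))"
        unfolding norm_mult[of "lap_repr k \<sigma> y"] by (subst ennreal_mult[symmetric]) (auto simp: heat_kernel_nonneg intro: ennreal_leI)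
    qed
    also have "\<dots> \<le> maximal_function (lap_repr k \<sigma>) x" by (rule heat_le_maximal[OF t]) measurable
    finally show ?thesis .
  qed
  show ?thesis by (rule LIMSEQ_le_const2[OF lim]) (use le in auto)
qed

end

text \<open>Needed for the product of infinity and 0, which is 0 in \<open>ennreal\<close>: if B = 0
  the right side of the final inequality vanishes even where the maximal function is
  infinite.\<close>

lemma lap_repr_zero: "B = 0 \<Longrightarrow> lap_repr k \<sigma> x = 0"
proof -
  assume B0: "B = 0"
  have "complex_of_real (half_powr (\<sigma> - 1) t) * heat_lap_eval k t x = 0" for t
    using heat_lap_eval_bound[of t k x] by (cases "t > 0") (simp_all add: B0 half_powr_neg)
  then show ?thesis unfolding lap_repr_def by (simp only: Bochner_Integration.integral_zero mult_zero_right)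
qed

text \<open>Since \<Gamma>(\<sigma> + \<delta>) Beta(\<delta>, \<sigma>) = \<Gamma>(\<delta>)
  \<Gamma>(\<sigma>), the prefactor is the one of the composition formula. The two summands of the
  constant are the contributions of t \<le> T, through the maximal function, and of t > T, through
  the decay of V.\<close>

lemma lap_repr_split_bound:
  assumes s: "0 < s1" "s1 < s" and k: "real k - s / 2 \<ge> real CARD('n)" "real k - s / 2 > \<beta> / 2"
    and A: "maximal_function (lap_repr k (real k - s / 2)) x \<le> ennreal A" "A \<ge> 0" and T: "T > 0"
  defines "\<sigma> \<equiv> real k - s / 2" and "\<delta> \<equiv> (s - s1) / 2" and "\<gamma> \<equiv> (s1 + \<beta>) / 2"
  shows "norm (lap_repr k (\<sigma> + \<delta>) x) \<le>
    (Gamma \<sigma> / \<delta> + Beta \<delta> \<sigma> * lap_const k / \<gamma>) / (Gamma (\<sigma> + \<delta>) * Beta \<delta> \<sigma>) * (A * T powr \<delta> + B * T powr (- \<gamma>))"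
proof -
  have s0: "s > 0" using s by simp
  have \<sigma>s: "\<sigma> = real k - s / 2" "\<sigma> \<ge> real CARD('n)" "\<sigma> > \<beta> / 2" using k by (simp_all add: \<sigma>_def)
  have \<sigma>1s: "\<sigma> + \<delta> = real k - s1 / 2" "\<sigma> + \<delta> \<ge> real CARD('n)" "\<sigma> + \<delta> > \<beta> / 2"
    using k s by (simp_all add: \<sigma>_def \<delta>_def field_simps)
  have \<delta>: "\<delta> > 0" using s by (simp add: \<delta>_def)
  have \<gamma>: "\<gamma> > 0" using s \<beta> by (simp add: \<gamma>_def)
  have \<sigma>0: "\<sigma> > 0" using \<sigma>s(3) \<beta> by linarith
  have G: "Gamma \<sigma> > 0" "Gamma (\<sigma> + \<delta>) > 0" using \<sigma>0 \<delta> by (simp_all add: Gamma_real_pos)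
  have Bp: "Beta \<delta> \<sigma> > 0" using \<sigma>0 \<delta> by (simp add: Beta_def Gamma_real_pos)
  \<comment> \<open>V at the point x, extended by 0 to r \<le> 0, so that it is measurable on the
    whole line as the beta formula demands.\<close>
  define F where "F r = complex_of_real (indicator {0<..} r) * heat_lap_eval k r x" for r
  have [measurable]: "F \<in> borel_measurable borel"
    unfolding F_def[abs_def]
    using measurable_compose[of "\<lambda>t. (t, x)" borel "borel \<Otimes>\<^sub>M borel", OF _ heat_lap_eval_measurable2[of k]] by simp
  have hF: "complex_of_real (half_powr (a - 1) r) * F r = complex_of_real (half_powr (a - 1) r) * heat_lap_eval k r x" for a r
    by (cases "r > 0") (simp_all add: F_def half_powr_neg)
  define I where "I = (LINT r|lborel. complex_of_real (half_powr (\<delta> + \<sigma> - 1) r) * F r)"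
  have int: "integrable lborel (\<lambda>r. complex_of_real (half_powr (\<delta> + \<sigma> - 1) r) * F r)"
    unfolding hF using lap_repr_integrable[OF s(1) \<sigma>1s] by (simp add: add.commute)
  \<comment> \<open>Divided by \<Gamma>(\<sigma>), \<open>W t\<close> is the heat average at time t
    of the representative of order s.\<close>
  define W where "W t = (LINT \<tau>|lborel. complex_of_real (half_powr (\<sigma> - 1) \<tau>) * F (t + \<tau>))" for t
  have W: "(LINT t|lborel. complex_of_real (half_powr (\<delta> - 1) t) * W t) = complex_of_real (Beta \<delta> \<sigma>) * I"
    unfolding W_def I_def by (rule beta_half_powr_compose[OF \<delta> \<sigma>0 _ int]) measurable
  have Wle: "norm (W t) \<le> Gamma \<sigma> * A" if t: "t > 0" for t
  proof -
    have "W t = (LINT \<tau>|lborel. complex_of_real (half_powr (\<sigma> - 1) \<tau>) * heat_lap_eval k (t + \<tau>) x)"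
      unfolding W_def
    proof (rule Bochner_Integration.integral_cong[OF refl])
      fix \<tau>
      show "complex_of_real (half_powr (\<sigma> - 1) \<tau>) * F (t + \<tau>) = complex_of_real (half_powr (\<sigma> - 1) \<tau>) * heat_lap_eval k (t + \<tau>) x"
        using t by (cases "\<tau> > 0") (simp_all add: F_def half_powr_neg)
    qed
    then have "ennreal (norm (complex_of_real (1 / Gamma \<sigma>) * W t)) \<le> ennreal A"
      using order_trans[OF heat_average_le_maximal[OF s0 \<sigma>s t, of x]] A(1) unfolding \<sigma>_def by simp
    then have "norm (complex_of_real (1 / Gamma \<sigma>) * W t) \<le> A" using A(2) by (simp add: ennreal_le_iff)
    then show ?thesis using G by (simp add: norm_mult norm_divide field_simps)
  qed
  have "ennreal (Beta \<delta> \<sigma> * norm I) = ennreal (norm (LINT t|lborel. complex_of_real (half_powr (\<delta> - 1) t) * W t))"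
    unfolding W using Bp by (simp add: norm_mult)
  also have "\<dots> \<le> (\<integral>\<^sup>+t. ennreal (half_powr (\<delta> - 1) t) * ennreal (norm (W t)) \<partial>lborel)"
  proof (cases "integrable lborel (\<lambda>t. complex_of_real (half_powr (\<delta> - 1) t) * W t)")
    case True
    from integral_norm_bound_ennreal[OF True] show ?thesis
      by (simp add: norm_mult half_powr_nonneg ennreal_mult)
  qed (simp add: not_integrable_integral_eq)
  \<comment> \<open>For t > T the condition t + \<tau> \<ge> T holds wherever the integrand is
    nonzero, so the indicator of \<open>{T..}\<close> costs nothing; carrying it lets the second
    integral run over all t, where the beta formula applies.\<close>
  also have "\<dots> \<le> (\<integral>\<^sup>+t. ennreal (half_powr (\<delta> - 1) t * indicator {..T} t) * ennreal (Gamma \<sigma> * A) +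
      (\<integral>\<^sup>+\<tau>. ennreal (half_powr (\<delta> - 1) t * half_powr (\<sigma> - 1) \<tau>) * (ennreal (norm (F (t + \<tau>))) * indicator {T..} (t + \<tau>)) \<partial>lborel) \<partial>lborel)"
  proof (rule nn_integral_mono)
    fix t
    let ?R = "\<integral>\<^sup>+\<tau>. ennreal (half_powr (\<delta> - 1) t * half_powr (\<sigma> - 1) \<tau>) * (ennreal (norm (F (t + \<tau>))) * indicator {T..} (t + \<tau>)) \<partial>lborel"
    consider "t \<le> 0" | "0 < t" "t \<le> T" | "T < t" using T by linarith
    then show "ennreal (half_powr (\<delta> - 1) t) * ennreal (norm (W t)) \<le> ennreal (half_powr (\<delta> - 1) t * indicator {..T} t) * ennreal (Gamma \<sigma> * A) + ?R"
    proof cases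
      case 1
      then show ?thesis by (simp add: half_powr_neg)
    next
      case 2
      have "ennreal (half_powr (\<delta> - 1) t) * ennreal (norm (W t)) \<le> ennreal (half_powr (\<delta> - 1) t) * ennreal (Gamma \<sigma> * A)"
        using Wle[OF 2(1)] by (intro mult_left_mono ennreal_leI) auto
      then show ?thesis using 2 by (simp add: add_increasing2)
    next
      case 3
      have "ennreal (norm (W t)) \<le> (\<integral>\<^sup>+\<tau>. ennreal (half_powr (\<sigma> - 1) \<tau>) * ennreal (norm (F (t + \<tau>))) \<partial>lborel)"
      proof (cases "integrable lborel (\<lambda>\<tau>. complex_of_real (half_powr (\<sigma> - 1) \<tau>) * F (t + \<tau>))")
        case True
        from integral_norm_bound_ennreal[OF True] show ?thesis
          unfolding W_def by (simp add: norm_mult half_powr_nonneg ennreal_mult)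
      qed (simp add: not_integrable_integral_eq W_def)
      then have "ennreal (half_powr (\<delta> - 1) t) * ennreal (norm (W t)) \<le> ennreal (half_powr (\<delta> - 1) t) * (\<integral>\<^sup>+\<tau>. ennreal (half_powr (\<sigma> - 1) \<tau>) * ennreal (norm (F (t + \<tau>))) \<partial>lborel)"
        by (rule mult_left_mono) simp
      also have "\<dots> = (\<integral>\<^sup>+\<tau>. ennreal (half_powr (\<delta> - 1) t) * (ennreal (half_powr (\<sigma> - 1) \<tau>) * ennreal (norm (F (t + \<tau>)))) \<partial>lborel)"
        by (rule nn_integral_cmult[symmetric]) measurable
      also have "\<dots> = ?R"
      proof (rule nn_integral_cong)
        fix \<tau>
        show "ennreal (half_powr (\<delta> - 1) t) * (ennreal (half_powr (\<sigma> - 1) \<tau>) * ennreal (norm (F (t + \<tau>)))) =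
          ennreal (half_powr (\<delta> - 1) t * half_powr (\<sigma> - 1) \<tau>) * (ennreal (norm (F (t + \<tau>))) * indicator {T..} (t + \<tau>))"
          using 3 by (cases "\<tau> > 0") (auto simp: half_powr_neg ennreal_mult half_powr_nonneg mult.assoc)
      qed
      finally show ?thesis by (simp add: add_increasing)
    qed
  qed
  also have "\<dots> = (\<integral>\<^sup>+t. ennreal (half_powr (\<delta> - 1) t * indicator {..T} t) * ennreal (Gamma \<sigma> * A) \<partial>lborel) +
      (\<integral>\<^sup>+t. (\<integral>\<^sup>+\<tau>. ennreal (half_powr (\<delta> - 1) t * half_powr (\<sigma> - 1) \<tau>) * (ennreal (norm (F (t + \<tau>))) * indicator {T..} (t + \<tau>)) \<partial>lborel) \<partial>lborel)"
    by (rule nn_integral_add) measurable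
  also have "(\<integral>\<^sup>+t. ennreal (half_powr (\<delta> - 1) t * indicator {..T} t) * ennreal (Gamma \<sigma> * A) \<partial>lborel) = ennreal (T powr \<delta> / \<delta> * (Gamma \<sigma> * A))"
  proof -
    have "(\<integral>\<^sup>+t. ennreal (half_powr (\<delta> - 1) t * indicator {..T} t) * ennreal (Gamma \<sigma> * A) \<partial>lborel) = ennreal (T powr (\<delta> - 1 + 1) / (\<delta> - 1 + 1)) * ennreal (Gamma \<sigma> * A)"
      by (subst nn_integral_multc) (use \<delta> T in \<open>simp_all add: nn_integral_half_powr_small\<close>)
    then show ?thesis using \<delta> G A(2) by (simp only: diff_add_cancel) (subst ennreal_mult[symmetric], auto)
  qed
  \<comment> \<open>The composition formula read backwards: the double integral collapses to one
    over r = t + \<tau> \<ge> T.\<close>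
  also have "(\<integral>\<^sup>+t. (\<integral>\<^sup>+\<tau>. ennreal (half_powr (\<delta> - 1) t * half_powr (\<sigma> - 1) \<tau>) * (ennreal (norm (F (t + \<tau>))) * indicator {T..} (t + \<tau>)) \<partial>lborel) \<partial>lborel)
     = ennreal (Beta \<delta> \<sigma>) * (\<integral>\<^sup>+r. ennreal (half_powr (\<delta> + \<sigma> - 1) r) * (ennreal (norm (F r)) * indicator {T..} r) \<partial>lborel)"
    by (rule beta_half_powr_compose_nn[OF \<delta> \<sigma>0]) measurable
  also have "(\<integral>\<^sup>+r. ennreal (half_powr (\<delta> + \<sigma> - 1) r) * (ennreal (norm (F r)) * indicator {T..} r) \<partial>lborel) \<le> (\<integral>\<^sup>+r. ennreal (lap_const k * B) * ennreal (half_powr (- \<gamma> - 1) r * indicator {T..} r) \<partial>lborel)"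
  proof (rule nn_integral_mono)
    fix r
    show "ennreal (half_powr (\<delta> + \<sigma> - 1) r) * (ennreal (norm (F r)) * indicator {T..} r) \<le> ennreal (lap_const k * B) * ennreal (half_powr (- \<gamma> - 1) r * indicator {T..} r)"
    proof (cases "T \<le> r")
      case True
      then have r: "r > 0" using T by simp
      have "half_powr (\<delta> + \<sigma> - 1) r * norm (F r) \<le> half_powr (\<delta> + \<sigma> - 1) r * (lap_const k * B * r powr (- real k - \<beta> / 2))"
        using heat_lap_eval_bound[OF r, of k x] r by (intro mult_left_mono half_powr_nonneg) (simp add: F_def)
      also have "\<dots> = lap_const k * B * (r powr (\<delta> + \<sigma> - 1) * r powr (- real k - \<beta> / 2))"
        unfolding half_powr_pos[OF r] by (simp only: mult_ac)
      \<comment> \<open>The exponents add up to -s1/2 - \<beta>/2 - 1, which is where \<gamma> = (s1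
        + \<beta>)/2 comes from.\<close>
      also have "r powr (\<delta> + \<sigma> - 1) * r powr (- real k - \<beta> / 2) = half_powr (- \<gamma> - 1) r"
        unfolding half_powr_pos[OF r] powr_add[symmetric]
        by (rule arg_cong[where f = "\<lambda>p. r powr p"]) (simp add: \<delta>_def \<sigma>_def \<gamma>_def field_simps)
      finally have "ennreal (half_powr (\<delta> + \<sigma> - 1) r * norm (F r)) \<le> ennreal (lap_const k * B * half_powr (- \<gamma> - 1) r)"
        by (rule ennreal_leI)
      then show ?thesis using True lap_const_nonneg B_nonneg
        by (simp add: ennreal_mult half_powr_nonneg)
    qed simp
  qed
  also have "(\<integral>\<^sup>+r. ennreal (lap_const k * B) * ennreal (half_powr (- \<gamma> - 1) r * indicator {T..} r) \<partial>lborel) = ennreal (lap_const k * B * (T powr (- \<gamma>) / \<gamma>))"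
  proof -
    have "(\<integral>\<^sup>+r. ennreal (lap_const k * B) * ennreal (half_powr (- \<gamma> - 1) r * indicator {T..} r) \<partial>lborel) = ennreal (lap_const k * B) * ennreal (- (T powr (- \<gamma> - 1 + 1)) / (- \<gamma> - 1 + 1))"
      by (subst nn_integral_cmult) (use \<gamma> T in \<open>simp_all add: nn_integral_half_powr_large\<close>)
    moreover have "- (T powr (- \<gamma> - 1 + 1)) / (- \<gamma> - 1 + 1) = T powr (- \<gamma>) / \<gamma>" by simp
    ultimately show ?thesis
      using \<gamma> lap_const_nonneg[of k] B_nonneg by (simp only:) (subst ennreal_mult[symmetric], auto)
  qed
  finally have "ennreal (Beta \<delta> \<sigma> * norm I) \<le> ennreal (T powr \<delta> / \<delta> * (Gamma \<sigma> * A)) + ennreal (Beta \<delta> \<sigma>) * ennreal (lap_const k * B * (T powr (- \<gamma>) / \<gamma>))"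
    by (simp add: mult_left_mono add_left_mono)
  also have "\<dots> = ennreal (T powr \<delta> / \<delta> * (Gamma \<sigma> * A) + Beta \<delta> \<sigma> * (lap_const k * B * (T powr (- \<gamma>) / \<gamma>)))"
  proof -
    have nn: "0 \<le> T powr \<delta> / \<delta> * (Gamma \<sigma> * A)" "0 \<le> Beta \<delta> \<sigma>" "0 \<le> lap_const k * B * (T powr (- \<gamma>) / \<gamma>)"
      using \<delta> \<gamma> G Bp A(2) lap_const_nonneg[of k] B_nonneg by auto
    show ?thesis unfolding ennreal_plus[OF nn(1) mult_nonneg_nonneg[OF nn(2,3)]] ennreal_mult[OF nn(2,3)] ..
  qed
  finally have I: "Beta \<delta> \<sigma> * norm I \<le> T powr \<delta> / \<delta> * (Gamma \<sigma> * A) + Beta \<delta> \<sigma> * (lap_const k * B * (T powr (- \<gamma>) / \<gamma>))"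
    using \<delta> \<gamma> G Bp A(2) lap_const_nonneg[of k] B_nonneg by (subst (asm) ennreal_le_iff) auto
  have "lap_repr k (\<sigma> + \<delta>) x = complex_of_real (1 / Gamma (\<sigma> + \<delta>)) * I"
    unfolding lap_repr_def I_def hF by (simp add: add.commute)
  then have "norm (lap_repr k (\<sigma> + \<delta>) x) = (Beta \<delta> \<sigma> * norm I) / (Gamma (\<sigma> + \<delta>) * Beta \<delta> \<sigma>)"
    using G Bp by (simp add: norm_mult norm_divide)
  also have "\<dots> \<le> ((Gamma \<sigma> / \<delta> + Beta \<delta> \<sigma> * lap_const k / \<gamma>) * (A * T powr \<delta> + B * T powr (- \<gamma>))) / (Gamma (\<sigma> + \<delta>) * Beta \<delta> \<sigma>)"
  proof (rule divide_right_mono)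
    let ?a = "Gamma \<sigma> / \<delta>" and ?b = "Beta \<delta> \<sigma> * lap_const k / \<gamma>" and ?X = "A * T powr \<delta>" and ?Y = "B * T powr (- \<gamma>)"
    have nn: "0 \<le> ?a" "0 \<le> ?b" "0 \<le> ?X" "0 \<le> ?Y" using \<delta> \<gamma> G Bp A(2) lap_const_nonneg[of k] B_nonneg by auto
    have "Beta \<delta> \<sigma> * norm I \<le> ?a * ?X + ?b * ?Y" using I by (simp add: mult_ac)
    \<comment> \<open>Nonnegative cross terms are added so that one constant multiplies the sum, the
      form required by \<open>interpolation_optimise\<close>.\<close>
    also have "\<dots> \<le> (?a + ?b) * (?X + ?Y)"
      using mult_nonneg_nonneg[OF nn(1,4)] mult_nonneg_nonneg[OF nn(2,3)] unfolding ring_distribs by linarith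
    finally show "Beta \<delta> \<sigma> * norm I \<le> (?a + ?b) * (?X + ?Y)" .
  qed (use G Bp in auto)
  finally show ?thesis by simp
qed

end

theorem theorem1:
  fixes s s1 \<beta> \<theta> :: real
  assumes "0 < s1" and "s1 < s" and "s < real CARD('n::finite)" and "0 < \<beta>"
    and "\<theta> = (s - s1) / (\<beta> + s)"
  shows "0 < \<theta> \<and> \<theta> < 1 \<and>
    (\<exists>C>0. \<forall>(f :: real^'n \<Rightarrow> real) u.
       smooth f \<and> represents u (\<lambda>x. complex_of_real (f x)) \<and> u \<in> besov_space \<beta> \<longrightarrow>
       (\<forall>x. ennreal (norm (continuous_representative (frac_laplacian s1 u) x) powr (1 / (1 - \<theta>)))
          \<le> ennreal C * maximal_function (continuous_representative (frac_laplacian s u)) x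
              * ennreal (besov_norm \<beta> u powr (\<theta> / (1 - \<theta>)))))"
proof (intro conjI)
  have \<theta>: "0 < \<theta>" "\<theta> < 1" unfolding assms(5) using assms(1-4) by (simp_all add: divide_simps)
  then show "0 < \<theta>" "\<theta> < 1" by blast+
  \<comment> \<open>The growth and decay exponents of the splitting at T; their sum is (\<beta> +
    s)/2, so \<delta> / (\<delta> + \<gamma>) is exactly \<theta>.\<close>
  define \<delta> \<gamma> where "\<delta> = (s - s1) / 2" and "\<gamma> = (s1 + \<beta>) / 2"
  have \<delta>: "\<delta> > 0" and \<gamma>: "\<gamma> > 0" using assms by (simp_all add: \<delta>_def \<gamma>_def)
  have dg: "\<delta> + \<gamma> = (\<beta> + s) / 2" by (simp add: \<delta>_def \<gamma>_def field_simps)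
  have "(a / 2) / (b / 2) = a / b" for a b :: real by simp
  then have "\<delta> / (\<delta> + \<gamma>) = \<theta>" unfolding dg assms(5) by (simp only: \<delta>_def)
  moreover have "\<gamma> / (\<delta> + \<gamma>) = 1 - \<delta> / (\<delta> + \<gamma>)" using \<delta> \<gamma> by (simp add: field_simps)
  ultimately have \<theta>eq: "\<delta> / (\<delta> + \<gamma>) = \<theta>" "\<gamma> / (\<delta> + \<gamma>) = 1 - \<theta>" by simp_all
  \<comment> \<open>Large enough for both conditions on \<sigma>. The choice depends on s, n and
    \<beta> only, as the independence of C from \<open>f\<close> demands.\<close>
  obtain k :: nat where k0: "s / 2 + real CARD('n) + \<beta> \<le> real k" using real_arch_simple by blast
  define \<sigma> where "\<sigma> = real k - s / 2"
  have k: "real k - s / 2 \<ge> real CARD('n)" "real k - s / 2 > \<beta> / 2"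
    using k0 assms by (auto simp: field_simps intro: less_le_trans)
  have \<sigma>0: "\<sigma> > 0" using k assms by (simp add: \<sigma>_def)
  have \<sigma>1: "\<sigma> + \<delta> = real k - s1 / 2" by (simp add: \<sigma>_def \<delta>_def field_simps)
  \<comment> \<open>This is \<open>lap_const k\<close> spelled out, because C must be fixed before a
    distribution is given and the locale entered.\<close>
  define L where "L = heat_lap_norm TYPE('n) k * 2 powr (real k + \<beta> / 2)"
  have L: "L \<ge> 0" by (simp add: L_def heat_lap_norm_nonneg)
  define K where "K = (Gamma \<sigma> / \<delta> + Beta \<delta> \<sigma> * L / \<gamma>) / (Gamma (\<sigma> + \<delta>) * Beta \<delta> \<sigma>)"
  have K: "K > 0"
    unfolding K_def using \<sigma>0 \<delta> \<gamma> L
    by (intro divide_pos_pos add_pos_nonneg mult_pos_pos divide_nonneg_pos mult_nonneg_nonneg)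
       (auto simp: Beta_def Gamma_real_pos less_imp_le)
  \<comment> \<open>The power 1/(1 - \<theta>) turns A^(1 - \<theta>) B^\<theta> into A
    B^(\<theta>/(1 - \<theta>)), which makes the bound linear in the maximal function; the factor 2
    K of the optimised estimate is raised to it as well.\<close>
  define C where "C = (2 * K) powr (1 / (1 - \<theta>))"
  have C: "C > 0" using K by (simp add: C_def)
  show "\<exists>C>0. \<forall>(f :: real^'n \<Rightarrow> real) u.
       smooth f \<and> represents u (\<lambda>x. complex_of_real (f x)) \<and> u \<in> besov_space \<beta> \<longrightarrow>
       (\<forall>x. ennreal (norm (continuous_representative (frac_laplacian s1 u) x) powr (1 / (1 - \<theta>)))
          \<le> ennreal C * maximal_function (continuous_representative (frac_laplacian s u)) x
              * ennreal (besov_norm \<beta> u powr (\<theta> / (1 - \<theta>))))"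
  proof (intro exI conjI allI impI)
    show "C > 0" by (rule C)
    fix f :: "real^'n \<Rightarrow> real" and u x
    assume "smooth f \<and> represents u (\<lambda>x. complex_of_real (f x)) \<and> u \<in> besov_space \<beta>"
    then interpret besov_fun u "\<lambda>x. complex_of_real (f x)" \<beta>
      using assms(4) smooth_bounded_linear[OF bounded_linear_of_real, of f]
      by unfold_locales (auto simp: besov_space_def)
    let ?g = "lap_repr k \<sigma>" and ?g1 = "lap_repr k (\<sigma> + \<delta>)"
    have g: "continuous_representative (frac_laplacian s u) = ?g"
      by (rule continuous_representative_frac_laplacian) (use assms k in \<open>auto simp: \<sigma>_def\<close>)
    have g1: "continuous_representative (frac_laplacian s1 u) = ?g1"
      by (rule continuous_representative_frac_laplacian) (use assms k \<delta> \<sigma>1 in \<open>auto simp: \<sigma>_def\<close>)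
    define M where "M = maximal_function ?g x"
    show "ennreal (norm (continuous_representative (frac_laplacian s1 u) x) powr (1 / (1 - \<theta>)))
          \<le> ennreal C * maximal_function (continuous_representative (frac_laplacian s u)) x
              * ennreal (besov_norm \<beta> u powr (\<theta> / (1 - \<theta>)))"
      unfolding g g1 M_def[symmetric]
    proof (cases "M = top")
      \<comment> \<open>The right side is infinite unless B = 0, and in that case the left side
        vanishes as well.\<close>
      case True
      show "ennreal (norm (?g1 x) powr (1 / (1 - \<theta>))) \<le> ennreal C * M * ennreal (B powr (\<theta> / (1 - \<theta>)))"
      proof (cases "B = 0")
        case True
        then show ?thesis by (simp add: lap_repr_zero)
      next
        case False
        then have "ennreal C * M * ennreal (B powr (\<theta> / (1 - \<theta>))) = top"
          using \<open>M = top\<close> C by (simp add: ennreal_mult_top ennreal_top_mult)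
        then show ?thesis by simp
      qed
    next
      case False
      then obtain A where A: "M = ennreal A" "A \<ge> 0" by (cases M) auto
      have "norm (?g1 x) \<le> 2 * K * (A powr (\<gamma> / (\<delta> + \<gamma>)) * B powr (\<delta> / (\<delta> + \<gamma>)))"
      proof (rule interpolation_optimise)
        show "norm (?g1 x) \<le> K * (A * T powr \<delta> + B * T powr (- \<gamma>))" if T: "T > 0" for T
          using lap_repr_split_bound[OF assms(1,2) k _ A(2) T, of x] A(1)
          unfolding K_def L_def lap_const_def M_def \<sigma>_def \<delta>_def \<gamma>_def by simp
      qed (use A K \<delta> \<gamma> B_nonneg in auto)
      then have "norm (?g1 x) powr (1 / (1 - \<theta>)) \<le> (2 * K * (A powr (1 - \<theta>) * B powr \<theta>)) powr (1 / (1 - \<theta>))"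
        unfolding \<theta>eq using \<theta> by (intro powr_mono2) auto
      also have "\<dots> = C * (A * B powr (\<theta> / (1 - \<theta>)))"
        using \<theta> K A(2) by (simp add: C_def powr_mult powr_powr)
      finally have "ennreal (norm (?g1 x) powr (1 / (1 - \<theta>))) \<le> ennreal (C * (A * B powr (\<theta> / (1 - \<theta>))))"
        by (rule ennreal_leI)
      also have "\<dots> = ennreal C * M * ennreal (B powr (\<theta> / (1 - \<theta>)))"
        using C A by (simp add: ennreal_mult mult.assoc)
      finally show "ennreal (norm (?g1 x) powr (1 / (1 - \<theta>))) \<le> ennreal C * M * ennreal (B powr (\<theta> / (1 - \<theta>)))" .
    qed
  qed
qed

end
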